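(* Let $\Omega\subset\mathbb{R}^{n+1}$ be an open set satisfying the $2$-sided corkscrew condition, with $n$-dimensional Ahlfors--David regular boundary $\partial\Omega$. Then the following are equivalent: (a) $\Omega$ satisfies the local John condition; (b) $\Omega$ satisfies the Harnack chain condition.
   Context: Let $n\ge1$. For $x\in\partial\Omega$, $r>0$ write $\Delta(x,r)=B(x,r)\cap\partial\Omega$ ($B(x,r)$ open Euclidean ball), and $\delta(X)=\operatorname{dist}(X,\partial\Omega)$. A closed set $E\subset\mathbb{R}^{n+1}$ is $n$-dimensional Ahlfors--David regular if there is $D\ge1$ with $D^{-1}r^n\le\mathcal{H}^n(B(x,r)\cap E)\le Dr^n$ for all $x\in E$, $r\in(0,\operatorname{diam}(E))$ ($\operatorname{diam}(E)$ may be infinite). $2$-sided corkscrew condition: there is $c\in(0,1)$ such that for every $x\in\partial\Omega$ and $0<r<\operatorname{diam}(\partial\Omega)$ there are $X,X'$ with $B(X,cr)\subset B(x,r)\cap\Omega$ and $B(X',cr)\subset B(x,r)\cap\operatorname{int}(\mathbb{R}^{n+1}\setminus\Omega)$. Paths: a path in $\Omega$ is a continuous $\gamma:[0,1]\to\overline\Omega$ with $\gamma(t)\in\Omega$ for all $t\in(0,1]$; it goes from $\gamma(0)$ to $\gamma(1)$; $\ell(\gamma)$ is its length, and for $Z\in\gamma$ (i.e. $Z=\gamma(t)$ for some $t$), $\gamma(\gamma(0),Z)$ is the piece of $\gamma$ from $\gamma(0)$ to $Z$. For $D\ge1$, a path $\gamma$ from $X$ to $Y$ is $D$-non-tangential if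 $\ell(\gamma(X,Z))\le D\,\delta(Z)$ for every $Z\in\gamma$. Local John condition: there is $D_0\ge1$ such that for every $x\in\partial\Omega$ and $r\in(0,\operatorname{diam}(\partial\Omega))$ there is $Y_x\in B(x,r)\cap\Omega$ with $B(Y_x,r/D_0)\subset\Omega$ such that for every $z\in\Delta(x,r)$ there is a $D_0$-non-tangential path $\gamma_z$ in $\Omega$ from $z$ to $Y_x$ with $\ell(\gamma_z)\le D_0r$. Harnack chain condition: there is $C\ge1$ and, for every $\Lambda\ge1$, a number $C(\Lambda)$, such that for every $\rho>0$, $\Lambda\ge1$ and $X,X'\in\Omega$ with $\delta(X),\delta(X')\ge\rho$ and $|X-X'|<\Lambda\rho$ there are open balls $B_1,\dots,B_N\subset\Omega$, $N\le C(\Lambda)$, with $X\in B_1$, $X'\in B_N$, $B_k\cap B_{k+1}\ne\emptyset$ and $C^{-1}\operatorname{diam}(B_k)\le\operatorname{dist}(B_k,\partial\Omega)\le C\operatorname{diam}(B_k)$. *)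

theory Defs
  imports "HOL-Analysis.Analysis"
begin

(* The library's diameter is real-valued and unspecified on unbounded sets; here the value
   infinity is needed. *)
definition ediam :: "'a::metric_space set \<Rightarrow> ennreal" where
  "ediam S = (SUP x\<in>S. SUP y\<in>S. ennreal (dist x y))"

lemma ediam_eq_diameter:
  assumes "bounded S"
  shows "ediam S = ennreal (diameter S)"
proof (cases "S = {}")
  case True
  then show ?thesis by (simp add: ediam_def bot_ennreal)
next
  case False
  show ?thesis
  proof (rule antisym)
    show "ediam S \<le> ennreal (diameter S)"
      unfolding ediam_def
      by (intro SUP_least ennreal_leI diameter_bounded_bound[OF assms])
    have le: "ennreal (dist x y) \<le> ediam S" if "x \<in> S" "y \<in> S" for x y
      unfolding ediam_def using that by (meson SUP_upper2 SUP_upper)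
    have fin: "ediam S < top"
      using \<open>ediam S \<le> ennreal (diameter S)\<close> by (simp add: order_le_less_trans)
    have "dist x y \<le> enn2real (ediam S)" if "x \<in> S" "y \<in> S" for x y
      using le[OF that] fin enn2real_mono[of "ennreal (dist x y)" "ediam S"] by simp
    then have "diameter S \<le> enn2real (ediam S)"
      using False by (auto simp: diameter_def intro!: cSUP_least)
    then show "ennreal (diameter S) \<le> ediam S"
      using fin by (metis ennreal_enn2real ennreal_leI)
  qed
qed

(* n-dimensional Hausdorff (outer) measure, without the normalising factor that makes it agree
   with Lebesgue measure on R^n: it would only change the constant in Ahlfors-David regularity.
   Empty covering sets count 0, which matters only for n = 0, where 0 ^ 0 = 1. *)
definition hausdorff_content :: "nat \<Rightarrow> real \<Rightarrow> 'a::metric_space set \<Rightarrow> ennreal" where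
  "hausdorff_content n d A =
     (INF U \<in> {U :: nat \<Rightarrow> 'a set. A \<subseteq> (\<Union>i. U i) \<and> (\<forall>i. ediam (U i) \<le> ennreal d)}.
        \<Sum>i. if U i = {} then 0 else ediam (U i) ^ n)"

definition hausdorff_measure :: "nat \<Rightarrow> 'a::metric_space set \<Rightarrow> ennreal" where
  "hausdorff_measure n A = (SUP d\<in>{0<..}. hausdorff_content n d A)"

definition ahlfors_david_regular :: "nat \<Rightarrow> 'a::metric_space set \<Rightarrow> bool" where
  "ahlfors_david_regular n E \<longleftrightarrow>
     closed E \<and>
     (\<exists>D\<ge>1. \<forall>x\<in>E. \<forall>r>0. ennreal r < ediam E \<longrightarrow>
        ennreal (r ^ n / D) \<le> hausdorff_measure n (ball x r \<inter> E) \<and>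
        hausdorff_measure n (ball x r \<inter> E) \<le> ennreal (D * r ^ n))"

(* Distance to the boundary. The library sets infdist x {} = 0 and setdist S {} = 0, so if the
   boundary is empty (\<Omega> empty or the whole space), the corkscrew, local John and Harnack chain
   conditions all hold vacuously. *)
definition bdist :: "'a::metric_space set \<Rightarrow> 'a \<Rightarrow> real" where
  "bdist \<Omega> X = infdist X (frontier \<Omega>)"

definition two_sided_corkscrew :: "'a::metric_space set \<Rightarrow> bool" where
  "two_sided_corkscrew \<Omega> \<longleftrightarrow>
     (\<exists>c. 0 < c \<and> c < 1 \<and>
        (\<forall>x\<in>frontier \<Omega>. \<forall>r>0. ennreal r < ediam (frontier \<Omega>) \<longrightarrow>
           (\<exists>X X'. ball X (c * r) \<subseteq> ball x r \<inter> \<Omega> \<and>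
                   ball X' (c * r) \<subseteq> ball x r \<inter> interior (- \<Omega>))))"

(* The starting point may lie on the boundary. *)
definition path_in_from_to ::
    "'a::metric_space set \<Rightarrow> (real \<Rightarrow> 'a) \<Rightarrow> 'a \<Rightarrow> 'a \<Rightarrow> bool" where
  "path_in_from_to \<Omega> \<gamma> X Y \<longleftrightarrow>
     path \<gamma> \<and> path_image \<gamma> \<subseteq> closure \<Omega> \<and> (\<forall>t\<in>{0<..1}. \<gamma> t \<in> \<Omega>) \<and>
     pathstart \<gamma> = X \<and> pathfinish \<gamma> = Y"

(* Length of \<gamma> restricted to [a,b]: supremum of the lengths of inscribed polygons. *)
definition path_length :: "(real \<Rightarrow> 'a::metric_space) \<Rightarrow> real \<Rightarrow> real \<Rightarrow> ennreal" where
  "path_length \<gamma> a b =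
     (SUP ts\<in>{ts. sorted ts \<and> set ts \<subseteq> {a..b}}.
        \<Sum>i<length ts - 1. ennreal (dist (\<gamma> (ts ! i)) (\<gamma> (ts ! Suc i))))"

(* If \<gamma> visits Z several times, the condition is imposed on the piece up to each visit. *)
definition nontangential :: "'a::metric_space set \<Rightarrow> real \<Rightarrow> (real \<Rightarrow> 'a) \<Rightarrow> bool" where
  "nontangential \<Omega> D \<gamma> \<longleftrightarrow>
     (\<forall>t\<in>{0..1}. path_length \<gamma> 0 t \<le> ennreal (D * bdist \<Omega> (\<gamma> t)))"

definition local_john :: "'a::metric_space set \<Rightarrow> bool" where
  "local_john \<Omega> \<longleftrightarrow>
     (\<exists>D\<ge>1. \<forall>x\<in>frontier \<Omega>. \<forall>r>0. ennreal r < ediam (frontier \<Omega>) \<longrightarrow>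
        (\<exists>Y \<in> ball x r \<inter> \<Omega>. ball Y (r / D) \<subseteq> \<Omega> \<and>
           (\<forall>z \<in> ball x r \<inter> frontier \<Omega>.
              \<exists>\<gamma>. path_in_from_to \<Omega> \<gamma> z Y \<and> nontangential \<Omega> D \<gamma> \<and>
                  path_length \<gamma> 0 1 \<le> ennreal (D * r))))"

(* The k-th ball of the chain is ball (z k) (s k), 1 \<le> k \<le> N. *)
definition harnack_chain :: "'a::metric_space set \<Rightarrow> bool" where
  "harnack_chain \<Omega> \<longleftrightarrow>
     (\<exists>C\<ge>1. \<exists>M :: real \<Rightarrow> real.
        \<forall>\<rho>>0. \<forall>\<Lambda>\<ge>1. \<forall>X\<in>\<Omega>. \<forall>X'\<in>\<Omega>.
          bdist \<Omega> X \<ge> \<rho> \<and> bdist \<Omega> X' \<ge> \<rho> \<and> dist X X' < \<Lambda> * \<rho> \<longrightarrow>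
          (\<exists>(N::nat) (z :: nat \<Rightarrow> 'a) (s :: nat \<Rightarrow> real).
             1 \<le> N \<and> real N \<le> M \<Lambda> \<and>
             X \<in> ball (z 1) (s 1) \<and> X' \<in> ball (z N) (s N) \<and>
             (\<forall>k\<in>{1..N}.
                0 < s k \<and> ball (z k) (s k) \<subseteq> \<Omega> \<and>
                diameter (ball (z k) (s k)) / C \<le> setdist (ball (z k) (s k)) (frontier \<Omega>) \<and>
                setdist (ball (z k) (s k)) (frontier \<Omega>) \<le> C * diameter (ball (z k) (s k))) \<and>
             (\<forall>k\<in>{1..<N}. ball (z k) (s k) \<inter> ball (z (Suc k)) (s (Suc k)) \<noteq> {})))"

end

theory Submission
  imports Defs
begin

text \<open>
  Harnack chains imply local John: join corkscrew points of a boundary point \<open>z\<close> at the scales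
  \<open>r / 2 ^ k\<close> by polygonal paths inside Harnack chains; parametrized over the dyadic intervals they
  form a Lipschitz path ending at \<open>z\<close>, and on it the distance to the boundary grows linearly.

  Local John implies Harnack chains: let \<open>A\<close> be the component of a corkscrew point \<open>X\<close>, and \<open>W\<close> that
  of the John centre, among the points at distance at least \<open>\<epsilon> r\<close> from the boundary, and suppose
  \<open>A \<noteq> W\<close>. Consider a tube from a ball in \<open>A\<close> to a ball in the exterior. Any line running from
  \<open>A\<close> to \<open>W\<close> or to the exterior passes close to the boundary, where at every scale there are both
  a ball in \<open>W\<close> (on a John path) and a ball in the exterior. Inserting the missing one, and
  subdividing the tube repeatedly, yields more and more crossings between \<open>W\<close> and the exterior:
  after \<open>M\<close> subdivisions the boundary contains a separated set exceeding, by a factor proportional to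
  \<open>M\<close>, what Ahlfors--David regularity permits.
\<close>

section \<open>Hausdorff measure and packing\<close>

text \<open>Between the component of \<open>X\<close> and that of the John centre a line need only
  come close to the boundary, not meet it. Boundary points are therefore counted only on passages
  between the John component and the exterior: a segment joining these two sets crosses the boundary
  itself, so the crossing lies in the prescribed thin tube and crossings in different tubes can be
  kept apart. The component of \<open>X\<close> serves to force the near approach. The count grows
  linearly in M because each level inserts, into one of the N^n subtubes of every current tube, a
  passage that all the smallest tubes below that subtube then share. So every level adds the fixed
  fraction N^(-n) of the number N^(M n) of smallest tubes, while regularity bounds the total by a
  constant times N^(M n). A second obstacle is a bounded boundary: the John condition speaks only of
  radii below its diameter, but two points to be joined may have nearest boundary points a full
  diameter apart. A boundary point definitely closer than the diameter to both is found by looking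
  at a lens.\<close>

lemma ediam_empty [simp]: "ediam {} = 0"
  by (simp add: ediam_def bot_ennreal)

lemma dist_le_ediam: "x \<in> S \<Longrightarrow> y \<in> S \<Longrightarrow> ennreal (dist x y) \<le> ediam S"
  unfolding ediam_def by (meson SUP_upper2 SUP_upper)

lemma hausdorff_content_antimono:
  assumes "d \<le> d'"
  shows "hausdorff_content n d' A \<le> hausdorff_content n d A"
  unfolding hausdorff_content_def
  by (intro INF_superset_mono) (use assms in \<open>auto intro: order_trans ennreal_leI\<close>)

lemma hausdorff_content_mono:
  assumes "A \<subseteq> B"
  shows "hausdorff_content n d A \<le> hausdorff_content n d B"
  unfolding hausdorff_content_def
  by (intro INF_superset_mono) (use assms in auto)

text \<open>A covering set of diameter at most \<open>d\<close> can meet only one of the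
  \<open>A p\<close>, so a cover of the union splits into covers of the pieces that share no set.
  This superadditivity holds for arbitrary sets and is all the additivity that the packing bound
  uses.\<close>

lemma sum_hausdorff_content_le:
  fixes A :: "'b \<Rightarrow> 'a::metric_space set"
  assumes "finite P"
    and sep: "\<And>p q x y. p \<in> P \<Longrightarrow> q \<in> P \<Longrightarrow> p \<noteq> q \<Longrightarrow> x \<in> A p \<Longrightarrow> y \<in> A q \<Longrightarrow> d < dist x y"
    and "0 \<le> d"
  shows "(\<Sum>p\<in>P. hausdorff_content n d (A p)) \<le> hausdorff_content n d (\<Union>p\<in>P. A p)"
  unfolding hausdorff_content_def[of n d "\<Union>p\<in>P. A p"]
proof (rule INF_greatest)
  fix U :: "nat \<Rightarrow> 'a set"
  assume "U \<in> {U. (\<Union>p\<in>P. A p) \<subseteq> (\<Union>i. U i) \<and> (\<forall>i. ediam (U i) \<le> ennreal d)}"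
  then have cov: "(\<Union>p\<in>P. A p) \<subseteq> (\<Union>i. U i)" and "\<forall>i. ediam (U i) \<le> ennreal d"
    by blast+
  then have dm: "\<And>i. ediam (U i) \<le> ennreal d" by blast
  define w where "w V = (if V = {} then 0 else ediam V ^ n)" for V :: "'a set"
  \<comment> \<open>Discarded sets become empty instead of being dropped, so that the cover stays
    indexed by \<open>nat\<close>; empty sets weigh 0 for every \<open>n\<close>.\<close>
  define V where "V p i = (if U i \<inter> A p = {} then {} else U i)" for p i
  have "hausdorff_content n d (A p) \<le> (\<Sum>i. w (V p i))" if "p \<in> P" for p
  proof -
    have "A p \<subseteq> (\<Union>i. V p i)"
    proof
      fix x assume "x \<in> A p"
      then obtain i where "x \<in> U i" using cov \<open>p \<in> P\<close> by blast
      then have "x \<in> V p i" using \<open>x \<in> A p\<close> by (auto simp: V_def)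
      then show "x \<in> (\<Union>i. V p i)" by blast
    qed
    moreover have "\<forall>i. ediam (V p i) \<le> ennreal d"
      using dm by (simp add: V_def)
    ultimately have "V p \<in> {U. A p \<subseteq> (\<Union>i. U i) \<and> (\<forall>i. ediam (U i) \<le> ennreal d)}"
      by blast
    then show ?thesis
      unfolding hausdorff_content_def w_def by (rule INF_lower)
  qed
  then have "(\<Sum>p\<in>P. hausdorff_content n d (A p)) \<le> (\<Sum>p\<in>P. \<Sum>i. w (V p i))"
    by (rule sum_mono)
  also have "\<dots> = (\<Sum>i. \<Sum>p\<in>P. w (V p i))"
    by (rule suminf_sum[symmetric]) simp
  also have "\<dots> \<le> (\<Sum>i. w (U i))"
  proof (rule suminf_le)
    fix i
    show "(\<Sum>p\<in>P. w (V p i)) \<le> w (U i)"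
    proof (cases "\<exists>p\<in>P. U i \<inter> A p \<noteq> {}")
      case False
      then have "(\<Sum>p\<in>P. w (V p i)) = 0"
        by (intro sum.neutral) (auto simp: V_def w_def)
      then show ?thesis by simp
    next
      case True
      then obtain p where p: "p \<in> P" "U i \<inter> A p \<noteq> {}" by blast
      have "U i \<inter> A q = {}" if "q \<in> P" "q \<noteq> p" for q
      proof (rule ccontr)
        assume "U i \<inter> A q \<noteq> {}"
        then obtain x y where xy: "x \<in> U i" "x \<in> A p" "y \<in> U i" "y \<in> A q" using p by blast
        then have "ennreal (dist x y) \<le> ennreal d"
          using dist_le_ediam dm order_trans by blast
        then have "dist x y \<le> d" using \<open>0 \<le> d\<close> by (simp add: ennreal_le_iff)
        then show False using sep[OF p(1) that(1) _ xy(2,4)] that by force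
      qed
      then have "w (V q i) = 0" if "q \<in> P - {p}" for q
        using that by (auto simp: V_def w_def)
      then have "(\<Sum>p\<in>P. w (V p i)) = w (V p i)"
        using assms(1) p(1) by (simp add: sum.remove)
      also have "\<dots> = w (U i)" using p by (simp add: V_def)
      finally show ?thesis by simp
    qed
  qed auto
  finally show "(\<Sum>p\<in>P. hausdorff_content n d (A p))
      \<le> (\<Sum>i. if U i = {} then 0 else ediam (U i) ^ n)"
    by (simp add: w_def)
qed

text \<open>The strict lower bounds already hold for the content at some positive scale
  \<open>d p\<close>; as \<open>P\<close> is finite, there is a common scale \<open>e\<close>, also
  at most the separation \<open>g\<close>, at which the contents add up.\<close>

lemma card_mult_le_hausdorff_measure:
  fixes \<alpha> g :: real
  assumes "finite P" "P \<noteq> {}" "0 < g"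
    and sep: "\<And>p q x y. p \<in> P \<Longrightarrow> q \<in> P \<Longrightarrow> p \<noteq> q \<Longrightarrow> x \<in> A p \<Longrightarrow> y \<in> A q \<Longrightarrow> g < dist x y"
    and low: "\<And>p. p \<in> P \<Longrightarrow> ennreal \<alpha> < hausdorff_measure n (A p)"
    and sub: "\<And>p. p \<in> P \<Longrightarrow> A p \<subseteq> F"
  shows "of_nat (card P) * ennreal \<alpha> \<le> hausdorff_measure n F"
proof -
  have "\<exists>d>0. ennreal \<alpha> < hausdorff_content n d (A p)" if "p \<in> P" for p
    using low[OF that] unfolding hausdorff_measure_def less_SUP_iff by auto
  then obtain d where d: "\<And>p. p \<in> P \<Longrightarrow> d p > 0"
    "\<And>p. p \<in> P \<Longrightarrow> ennreal \<alpha> < hausdorff_content n (d p) (A p)" by metis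
  define e where "e = Min (insert g (d ` P))"
  have e: "e \<le> g" "\<And>p. p \<in> P \<Longrightarrow> e \<le> d p" "e > 0"
    using assms(1,3) d(1) unfolding e_def by (auto simp: Min_gr_iff)
  have "of_nat (card P) * ennreal \<alpha> = (\<Sum>p\<in>P. ennreal \<alpha>)" by simp
  also have "\<dots> \<le> (\<Sum>p\<in>P. hausdorff_content n e (A p))"
    by (intro sum_mono) (meson d(2) e(2) hausdorff_content_antimono less_imp_le order_trans)
  also have "\<dots> \<le> hausdorff_content n e (\<Union>p\<in>P. A p)"
    by (intro sum_hausdorff_content_le assms(1)) (use sep e in \<open>force+\<close>)
  also have "\<dots> \<le> hausdorff_content n e F"
    by (intro hausdorff_content_mono) (use sub in auto)
  also have "\<dots> \<le> hausdorff_measure n F"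
    unfolding hausdorff_measure_def by (intro SUP_upper) (use e in auto)
  finally show ?thesis .
qed

text \<open>Balls of radius \<open>h/3\<close> about the points of \<open>P\<close> are more than
  \<open>h/3\<close> apart and lie in \<open>ball x r\<close>, so the lower regularity bounds of the
  small balls must fit into the upper bound of the large one.\<close>

lemma ahlfors_david_packing:
  fixes E :: "'a::metric_space set"
  assumes D: "D \<ge> 1"
    and reg: "\<And>x r. x \<in> E \<Longrightarrow> 0 < r \<Longrightarrow> ennreal r < ediam E \<Longrightarrow>
        ennreal (r ^ n / D) \<le> hausdorff_measure n (ball x r \<inter> E) \<and>
        hausdorff_measure n (ball x r \<inter> E) \<le> ennreal (D * r ^ n)"
    and x: "x \<in> E" "0 < r" "ennreal r < ediam E"
    and h: "0 < h" "h \<le> r"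
    and P: "finite P" "P \<subseteq> E \<inter> ball x (r - h)"
    and sep: "\<And>p q. p \<in> P \<Longrightarrow> q \<in> P \<Longrightarrow> p \<noteq> q \<Longrightarrow> h \<le> dist p q"
  shows "real (card P) \<le> 2 * D\<^sup>2 * (3 * r / h) ^ n"
proof (cases "P = {}")
  case True
  then show ?thesis using assms by simp
next
  case False
  \<comment> \<open>Halving makes the lower bound strict, as summing at a common scale requires;
    this is the 2 in the conclusion.\<close>
  define \<alpha> where "\<alpha> = (h/3) ^ n / D / 2"
  have \<alpha>: "0 < \<alpha>" using h D by (simp add: \<alpha>_def)
  have hr: "ennreal (h/3) < ediam E"
    using x(3) h by (intro le_less_trans[OF ennreal_leI x(3)]) auto
  have "of_nat (card P) * ennreal \<alpha> \<le> hausdorff_measure n (ball x r \<inter> E)"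
  proof (rule card_mult_le_hausdorff_measure[where A = "\<lambda>p. ball p (h/3) \<inter> E" and g = "h/3"])
    show "h/3 < dist y z" if "p \<in> P" "q \<in> P" "p \<noteq> q" "y \<in> ball p (h/3) \<inter> E" "z \<in> ball q (h/3) \<inter> E" for p q y z
    proof -
      have "dist p q \<le> dist p y + dist y z + dist q z"
        by (metis add.assoc add_left_mono dist_commute dist_triangle dist_triangle_le)
      then show ?thesis using sep[OF that(1-3)] that(4,5) by auto
    qed
    show "ennreal \<alpha> < hausdorff_measure n (ball p (h/3) \<inter> E)" if "p \<in> P" for p
    proof -
      have "ennreal \<alpha> < ennreal ((h/3)^n / D)"
        using \<alpha> by (intro ennreal_lessI) (auto simp: \<alpha>_def field_simps)
      also have "\<dots> \<le> hausdorff_measure n (ball p (h/3) \<inter> E)"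
        using reg[of p "h/3"] P that h hr by auto
      finally show ?thesis .
    qed
    show "ball p (h/3) \<inter> E \<subseteq> ball x r \<inter> E" if "p \<in> P" for p
    proof -
      have "dist x p < r - h" using P that by auto
      then have "dist x y < r" if "dist p y < h/3" for y
        using that h dist_triangle[of x y p] by linarith
      then show ?thesis by auto
    qed
  qed (use False P h in auto)
  also have "\<dots> \<le> ennreal (D * r ^ n)" using reg x by blast
  finally have "ennreal (real (card P) * \<alpha>) \<le> ennreal (D * r ^ n)"
    using \<alpha> by (simp add: ennreal_mult ennreal_of_nat_eq_real_of_nat)
  then have "real (card P) * \<alpha> \<le> D * r ^ n"
    using D x by (subst (asm) ennreal_le_iff) auto
  then show ?thesis
    using h D unfolding \<alpha>_def by (simp add: field_simps power2_eq_square power_mult_distrib power_divide)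
qed

section \<open>Chains of balls\<close>

text \<open>After translation and rescaling to the unit ball, each ball of a finite cover by balls
  of radius \<open>t/2\<close> holds at most one point of the set; the number of these balls depends
  neither on \<open>x\<close> nor on \<open>R\<close>.\<close>

lemma separated_subset_card_bound:
  fixes t :: real
  assumes "0 < t"
  shows "\<exists>N::nat. \<forall>(x::'a::euclidean_space) R P. 0 < R \<longrightarrow> finite P \<longrightarrow> P \<subseteq> cball x R \<longrightarrow>
    (\<forall>p\<in>P. \<forall>q\<in>P. p \<noteq> q \<longrightarrow> t * R \<le> dist p q) \<longrightarrow> card P \<le> N"
proof -
  have "compact (cball (0::'a) 1)" by simp
  then obtain k where k: "finite k" "k \<subseteq> cball (0::'a) 1" "cball (0::'a) 1 \<subseteq> (\<Union>y\<in>k. ball y (t/2))"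
    using assms unfolding compact_eq_totally_bounded by (metis (no_types) compact_eq_totally_bounded compactE_image half_gt_zero seq_compact_imp_totally_bounded compact_imp_seq_compact \<open>compact (cball (0::'a) 1)\<close>)
  have "card P \<le> card k" if "0 < R" "finite P" "P \<subseteq> cball x R"
    and sep: "\<forall>p\<in>P. \<forall>q\<in>P. p \<noteq> q \<longrightarrow> t * R \<le> dist p q" for x :: 'a and R P
  proof -
    have "\<exists>y\<in>k. dist y ((p - x) /\<^sub>R R) < t/2" if "p \<in> P" for p
    proof -
      have "norm (p - x) \<le> R" using that \<open>P \<subseteq> cball x R\<close> by (auto simp: dist_norm norm_minus_commute)
      then have "norm ((p - x) /\<^sub>R R) \<le> 1"
        using \<open>0 < R\<close> by (simp add: divide_inverse_commute[symmetric] del: scaleR_right_diff_distrib)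
      then have "(p - x) /\<^sub>R R \<in> cball 0 1" by simp
      then show ?thesis using k(3) by (meson UN_E mem_ball subsetD)
    qed
    then obtain f where f: "\<And>p. p \<in> P \<Longrightarrow> f p \<in> k" "\<And>p. p \<in> P \<Longrightarrow> dist (f p) ((p - x) /\<^sub>R R) < t/2"
      by metis
    have "inj_on f P"
    proof (rule inj_onI, rule ccontr)
      fix p q assume pq: "p \<in> P" "q \<in> P" "f p = f q" "p \<noteq> q"
      have "dist ((p - x) /\<^sub>R R) ((q - x) /\<^sub>R R) < t"
        using f(2)[OF pq(1)] f(2)[OF pq(2)] pq(3) dist_triangle_half_r by metis
      moreover have "dist ((p - x) /\<^sub>R R) ((q - x) /\<^sub>R R) = dist p q / R"
        using \<open>0 < R\<close> by (simp add: dist_norm scaleR_diff_right[symmetric] divide_inverse mult.commute)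
      ultimately have "dist p q / R < t" by simp
      then show False using sep[rule_format, OF pq(1,2,4)] \<open>0 < R\<close> by (simp add: divide_less_eq)
    qed
    then show ?thesis using f(1) k(1) by (meson card_inj_on_le image_subsetI)
  qed
  then show ?thesis by blast
qed

definition step_chain :: "'a::metric_space set \<Rightarrow> real \<Rightarrow> 'a \<Rightarrow> 'a \<Rightarrow> nat \<Rightarrow> (nat \<Rightarrow> 'a) \<Rightarrow> bool" where
  "step_chain S h X Y m p \<longleftrightarrow> p 0 = X \<and> p m = Y \<and> (\<forall>i\<le>m. p i \<in> S) \<and> (\<forall>i<m. dist (p i) (p (Suc i)) < h)"

lemma step_chain_extend:
  assumes "step_chain S h X Y m p" "Z \<in> S" "dist Y Z < h"
  shows "step_chain S h X Z (Suc m) (p(Suc m := Z))"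
  using assms unfolding step_chain_def by (auto simp: less_Suc_eq)

text \<open>The points reachable from \<open>X\<close> by steps shorter than \<open>h\<close> form a
  set that is open in \<open>S\<close> together with its complement.\<close>

lemma connected_imp_step_chain:
  fixes S :: "'a::metric_space set"
  assumes "connected S" "X \<in> S" "Y \<in> S" "0 < h"
  shows "\<exists>m p. step_chain S h X Y m p"
proof -
  define A where "A = {Z \<in> S. \<exists>m p. step_chain S h X Z m p}"
  have step: "Z' \<in> A" if "Z \<in> A" "Z' \<in> S" "dist Z Z' < h" for Z Z'
    using that step_chain_extend unfolding A_def by blast
  have "openin (top_of_set S) A"
    unfolding openin_euclidean_subtopology_iff
    using step \<open>0 < h\<close> by (metis (no_types, lifting) A_def dist_commute mem_Collect_eq subsetI)
  moreover have "openin (top_of_set S) (S - A)"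
    unfolding openin_euclidean_subtopology_iff
    using step \<open>0 < h\<close> by (metis Diff_iff Diff_subset dist_commute)
  moreover have "X \<in> A" using assms unfolding A_def
    by (auto intro!: exI[of _ "0::nat"] exI[of _ "\<lambda>_. X"] simp: step_chain_def)
  moreover have "closedin (top_of_set S) A"
    using calculation(2) by (simp add: closedin_def A_def)
  ultimately have "A = S"
    using \<open>connected S\<close> unfolding connected_clopen by blast
  then show ?thesis using assms(3) by (auto simp: A_def)
qed

text \<open>Even-numbered points of a shortest chain are separated by the step size.\<close>

lemma step_chain_bounded:
  fixes t :: real
  assumes "0 < t"
  shows "\<exists>N::nat. \<forall>(S::'a::euclidean_space set) x R X Y. 0 < R \<longrightarrow> connected S \<longrightarrow> S \<subseteq> cball x R \<longrightarrow>
    X \<in> S \<longrightarrow> Y \<in> S \<longrightarrow> (\<exists>m\<le>N. \<exists>p. step_chain S (t * R) X Y m p)"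
proof -
  obtain N :: nat where N: "\<forall>(x::'a) R P. 0 < R \<longrightarrow> finite P \<longrightarrow> P \<subseteq> cball x R \<longrightarrow>
    (\<forall>p\<in>P. \<forall>q\<in>P. p \<noteq> q \<longrightarrow> t * R \<le> dist p q) \<longrightarrow> card P \<le> N"
    using separated_subset_card_bound[OF assms] ..
  have "\<exists>m\<le>2 * N. \<exists>p. step_chain S (t * R) X Y m p"
    if S: "0 < R" "connected S" "S \<subseteq> cball x R" "X \<in> S" "Y \<in> S" for S :: "'a set" and x R X Y
  proof -
    define h where "h = t * R"
    have "0 < h" using S assms by (simp add: h_def)
    define m where "m = (LEAST m. \<exists>p. step_chain S h X Y m p)"
    have "\<exists>m p. step_chain S h X Y m p"
      using connected_imp_step_chain S(2,4,5) \<open>0 < h\<close> .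
    then have "\<exists>p. step_chain S h X Y m p" unfolding m_def by (rule LeastI_ex)
    then obtain p where p: "step_chain S h X Y m p" by blast
    have short: "h \<le> dist (p i) (p j)" if "Suc i < j" "j \<le> m" for i j
    proof (rule ccontr)
      assume less: "\<not> h \<le> dist (p i) (p j)"
      \<comment> \<open>The chain \<open>q\<close> jumps from \<open>p i\<close> straight to
        \<open>p j\<close>, leaving out the \<open>d\<close> points in between; as
        \<open>Suc i < j\<close>, it is shorter than the minimal chain.\<close>
      define d where "d = j - Suc i"
      define q where "q k = (if k \<le> i then p k else p (k + d))" for k
      have "step_chain S h X Y (m - d) q"
        unfolding step_chain_def
      proof (intro conjI allI impI)
        show "q 0 = X" using p by (simp add: q_def step_chain_def)
        show "q (m - d) = Y" using p that by (auto simp: q_def d_def step_chain_def)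
        show "q k \<in> S" if "k \<le> m - d" for k
          using p that \<open>Suc i < j\<close> \<open>j \<le> m\<close> by (auto simp: q_def d_def step_chain_def)
        show "dist (q k) (q (Suc k)) < h" if "k < m - d" for k
        proof (cases "k = i")
          case True
          have "Suc i + d = j" using \<open>Suc i < j\<close> by (simp add: d_def)
          then show ?thesis using True less by (simp add: q_def)
        next
          case False
          then show ?thesis
            using p that \<open>Suc i < j\<close> \<open>j \<le> m\<close> by (auto simp: q_def d_def step_chain_def)
        qed
      qed
      then have "m \<le> m - d" unfolding m_def by (intro Least_le) blast
      then show False using that by (simp add: d_def)
    qed
    define P where "P = (\<lambda>i. p (2 * i)) ` {..m div 2}"
    have sep: "h \<le> dist (p (2 * i)) (p (2 * j))" if "i \<noteq> j" "i \<le> m div 2" "j \<le> m div 2" for i j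
    proof (cases "i < j")
      case True
      then show ?thesis using that by (intro short) auto
    next
      case False
      then have "h \<le> dist (p (2 * j)) (p (2 * i))" using that by (intro short) auto
      then show ?thesis by (simp add: dist_commute)
    qed
    have "inj_on (\<lambda>i. p (2 * i)) {..m div 2}"
      by (rule inj_onI) (metis sep \<open>0 < h\<close> atMost_iff dist_self not_le)
    then have "card P = Suc (m div 2)" by (simp add: P_def card_image)
    moreover have "card P \<le> N"
    proof (rule N[rule_format, OF S(1)])
      show "P \<subseteq> cball x R" using p S(3) unfolding P_def step_chain_def by auto
      show "t * R \<le> dist y z" if yz: "y \<in> P" "z \<in> P" "y \<noteq> z" for y z
      proof -
        obtain i j where ij: "y = p (2 * i)" "z = p (2 * j)" "i \<le> m div 2" "j \<le> m div 2"
          using yz(1,2) by (auto simp: P_def)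
        then have "i \<noteq> j" using yz(3) by blast
        then show ?thesis using sep[of i j] ij by (simp add: h_def)
      qed
    qed (simp add: P_def)
    ultimately have "m \<le> 2 * N" by linarith
    then show ?thesis using p unfolding h_def by blast
  qed
  then show ?thesis by blast
qed

section \<open>Distance to the boundary and Whitney balls\<close>

lemma bdist_triangle: "bdist \<Omega> x \<le> bdist \<Omega> y + dist x y"
  unfolding bdist_def by (rule infdist_triangle)

lemma bdist_le: "z \<in> frontier \<Omega> \<Longrightarrow> bdist \<Omega> x \<le> dist x z"
  unfolding bdist_def by (rule infdist_le)

lemma bdist_nonneg [simp]: "0 \<le> bdist \<Omega> x"
  unfolding bdist_def by (rule infdist_nonneg)

lemma bdist_ge_iff: "frontier \<Omega> \<noteq> {} \<Longrightarrow> r \<le> bdist \<Omega> x \<longleftrightarrow> (\<forall>z\<in>frontier \<Omega>. r \<le> dist x z)"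
  unfolding bdist_def infdist_def by (simp add: le_cINF_iff bdd_below.I[of _ 0])

lemma bdist_attained:
  fixes \<Omega> :: "'a::heine_borel set"
  assumes "frontier \<Omega> \<noteq> {}"
  obtains z where "z \<in> frontier \<Omega>" "bdist \<Omega> x = dist x z"
  using infdist_attains_inf[OF frontier_closed assms] unfolding bdist_def by metis

text \<open>Relies on the convention that the distance to the empty set is 0.\<close>

lemma bdist_pos_frontier: "0 < bdist \<Omega> x \<Longrightarrow> frontier \<Omega> \<noteq> {}"
  unfolding bdist_def by (auto simp: infdist_def split: if_splits)

lemma subset_if_connected_avoids_frontier:
  assumes "connected S" "S \<inter> frontier \<Omega> = {}" "x \<in> S" "x \<in> \<Omega>"
  shows "S \<subseteq> \<Omega>"
  using connected_Int_frontier[of S \<Omega>] assms by blast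

lemma ball_bdist_subset:
  fixes \<Omega> :: "'a::euclidean_space set"
  assumes "X \<in> \<Omega>" "r \<le> bdist \<Omega> X"
  shows "ball X r \<subseteq> \<Omega>"
proof (cases "r > 0")
  case True
  have "ball X r \<inter> frontier \<Omega> = {}" using bdist_le[of _ \<Omega> X] assms(2) by (force simp: disjoint_iff)
  then show ?thesis
    using subset_if_connected_avoids_frontier[of "ball X r" \<Omega> X] True assms by simp
qed (simp add: ball_empty)

text \<open>A connection inside \<open>deep\<close> is the intermediate goal of the passage from
  John to Harnack: in a fixed dimension the number of Whitney balls that it costs is controlled by
  the ratio of the depth \<open>\<epsilon>\<close> to the radius \<open>R\<close>, which is why both
  are recorded.\<close>

definition deep :: "'a::metric_space set \<Rightarrow> real \<Rightarrow> 'a \<Rightarrow> real \<Rightarrow> 'a set" where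
  "deep \<Omega> \<epsilon> x R = {y \<in> \<Omega>. \<epsilon> \<le> bdist \<Omega> y \<and> dist x y \<le> R}"

lemma deep_mono: "\<epsilon>' \<le> \<epsilon> \<Longrightarrow> cball x R \<subseteq> cball x' R' \<Longrightarrow> deep \<Omega> \<epsilon> x R \<subseteq> deep \<Omega> \<epsilon>' x' R'"
  unfolding deep_def by (auto simp: subset_iff)

definition whitney_ball :: "'a::metric_space set \<Rightarrow> real \<Rightarrow> 'a \<Rightarrow> real \<Rightarrow> bool" where
  "whitney_ball \<Omega> C z s \<longleftrightarrow> 0 < s \<and> ball z s \<subseteq> \<Omega> \<and>
     diameter (ball z s) / C \<le> setdist (ball z s) (frontier \<Omega>) \<and>
     setdist (ball z s) (frontier \<Omega>) \<le> C * diameter (ball z s)"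

text \<open>With \<open>d = bdist \<Omega> X\<close>, this ball has diameter \<open>d/2\<close>, and
  its distance to the boundary is between \<open>d/2\<close> and \<open>d\<close>.\<close>

lemma whitney_ball_quarter:
  fixes \<Omega> :: "'a::euclidean_space set"
  assumes "X \<in> \<Omega>" "0 < bdist \<Omega> X"
  shows "whitney_ball \<Omega> 2 X (bdist \<Omega> X / 4)"
proof -
  let ?d = "bdist \<Omega> X" and ?B = "ball X (bdist \<Omega> X / 4)"
  have ne: "frontier \<Omega> \<noteq> {}" by (rule bdist_pos_frontier[OF assms(2)])
  have diam: "diameter ?B = ?d / 2" using assms(2) diameter_ball[of X "?d/4"] by simp
  have "?d / 2 \<le> setdist ?B (frontier \<Omega>)"
  proof (rule le_setdistI)
    show "?d / 2 \<le> dist y z" if "y \<in> ?B" "z \<in> frontier \<Omega>" for y z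
      using bdist_le[OF that(2), of X] dist_triangle[of X z y] that(1) assms(2) by simp
  qed (use ne assms in auto)
  moreover have "setdist ?B (frontier \<Omega>) \<le> ?d"
  proof -
    obtain z where z: "z \<in> frontier \<Omega>" "?d = dist X z" by (rule bdist_attained[OF ne])
    then show ?thesis using setdist_le_dist[of X ?B z "frontier \<Omega>"] assms by simp
  qed
  moreover have "?B \<subseteq> \<Omega>" by (rule ball_bdist_subset) (use assms in auto)
  ultimately show ?thesis using assms diam by (simp add: whitney_ball_def)
qed

definition ball_chain :: "'a::metric_space set \<Rightarrow> real \<Rightarrow> 'a \<Rightarrow> 'a \<Rightarrow> nat \<Rightarrow> (nat \<Rightarrow> 'a) \<Rightarrow> (nat \<Rightarrow> real) \<Rightarrow> bool" where
  "ball_chain \<Omega> C X X' N z s \<longleftrightarrow>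
     X \<in> ball (z 1) (s 1) \<and> X' \<in> ball (z N) (s N) \<and>
     (\<forall>k\<in>{1..N}. whitney_ball \<Omega> C (z k) (s k)) \<and>
     (\<forall>k\<in>{1..<N}. ball (z k) (s k) \<inter> ball (z (Suc k)) (s (Suc k)) \<noteq> {})"

lemma harnack_chain_iff:
  "harnack_chain \<Omega> \<longleftrightarrow> (\<exists>C\<ge>1. \<exists>M. \<forall>\<rho>>0. \<forall>\<Lambda>\<ge>1. \<forall>X\<in>\<Omega>. \<forall>X'\<in>\<Omega>.
     bdist \<Omega> X \<ge> \<rho> \<and> bdist \<Omega> X' \<ge> \<rho> \<and> dist X X' < \<Lambda> * \<rho> \<longrightarrow>
     (\<exists>N z s. 1 \<le> N \<and> real N \<le> M \<Lambda> \<and> ball_chain \<Omega> C X X' N z s))"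
  unfolding harnack_chain_def ball_chain_def whitney_ball_def
  by (simp only: conj_assoc)

text \<open>Consecutive points of a chain of step \<open>t/4 * R\<close> are closer than a quarter
  of their depth, so each lies in the Whitney ball of its predecessor; the bound on the length of a
  step chain is uniform in the set.\<close>

lemma ball_chain_if_connected_deep:
  assumes "0 < t"
  shows "\<exists>N0::nat. \<forall>(\<Omega>::'a::euclidean_space set) \<epsilon> x R X X'. 0 < R \<longrightarrow> t * R \<le> \<epsilon> \<longrightarrow>
    connected_component (deep \<Omega> \<epsilon> x R) X X' \<longrightarrow> (\<exists>N z s. 1 \<le> N \<and> N \<le> N0 \<and> ball_chain \<Omega> 2 X X' N z s)"
proof -
  have "0 < t / 4" using assms by simp
  from step_chain_bounded[OF this, where 'a = 'a]
  obtain N0 :: nat where N0: "\<forall>(S::'a set) x R X Y. 0 < R \<longrightarrow> connected S \<longrightarrow> S \<subseteq> cball x R \<longrightarrow>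
    X \<in> S \<longrightarrow> Y \<in> S \<longrightarrow> (\<exists>m\<le>N0. \<exists>p. step_chain S (t / 4 * R) X Y m p)" ..
  have "\<exists>N z s. 1 \<le> N \<and> N \<le> Suc N0 \<and> ball_chain \<Omega> 2 X X' N z s"
    if R: "0 < R" "t * R \<le> \<epsilon>" and con: "connected_component (deep \<Omega> \<epsilon> x R) X X'"
    for \<Omega> :: "'a set" and \<epsilon> x R X X'
  proof -
    obtain S where S: "connected S" "S \<subseteq> deep \<Omega> \<epsilon> x R" "X \<in> S" "X' \<in> S"
      using con unfolding connected_component_def by blast
    have "S \<subseteq> cball x R" using S(2) by (auto simp: deep_def)
    then obtain m p where m: "m \<le> N0" "step_chain S (t / 4 * R) X X' m p"
      using N0[rule_format, OF R(1) S(1) _ S(3,4)] by blast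
    have \<epsilon>: "0 < \<epsilon>" using R assms by (meson less_le_trans mult_pos_pos)
    have p: "p i \<in> \<Omega>" "\<epsilon> \<le> bdist \<Omega> (p i)" if "i \<le> m" for i
      using m(2) S(2) that unfolding step_chain_def deep_def by auto
    \<comment> \<open>Points of the step chain are numbered from 0 and balls from 1, whence the
      shift.\<close>
    have "ball_chain \<Omega> 2 X X' (Suc m) (\<lambda>k. p (k - 1)) (\<lambda>k. bdist \<Omega> (p (k - 1)) / 4)"
      unfolding ball_chain_def
    proof (intro conjI ballI)
      show "X \<in> ball (p (1 - 1)) (bdist \<Omega> (p (1 - 1)) / 4)"
        using p[of 0] \<epsilon> m(2) by (auto simp: step_chain_def)
      show "X' \<in> ball (p (Suc m - 1)) (bdist \<Omega> (p (Suc m - 1)) / 4)"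
        using p[of m] \<epsilon> m(2) by (auto simp: step_chain_def)
      show "whitney_ball \<Omega> 2 (p (k - 1)) (bdist \<Omega> (p (k - 1)) / 4)" if "k \<in> {1..Suc m}" for k
      proof (rule whitney_ball_quarter)
        have "k - 1 \<le> m" using that by auto
        then show "p (k - 1) \<in> \<Omega>" "0 < bdist \<Omega> (p (k - 1))"
          using p[of "k - 1"] \<epsilon> by auto
      qed
      fix k assume k: "k \<in> {1..<Suc m}"
      then have km: "k - 1 < m" "Suc (k - 1) = k" by auto
      then have "dist (p (k - 1)) (p k) < t / 4 * R"
        using m(2) km unfolding step_chain_def by metis
      moreover have "t / 4 * R \<le> bdist \<Omega> (p (k - 1)) / 4" using p(2)[of "k - 1"] R(2) km(1) by simp
      moreover have "0 < bdist \<Omega> (p k)" using p[of k] k \<epsilon> by auto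
      ultimately have "p k \<in> ball (p (k - 1)) (bdist \<Omega> (p (k - 1)) / 4) \<inter>
          ball (p (Suc k - 1)) (bdist \<Omega> (p (Suc k - 1)) / 4)" by simp
      then show "ball (p (k - 1)) (bdist \<Omega> (p (k - 1)) / 4) \<inter>
          ball (p (Suc k - 1)) (bdist \<Omega> (p (Suc k - 1)) / 4) \<noteq> {}" by blast
    qed
    moreover have "1 \<le> Suc m" "Suc m \<le> Suc N0" using m(1) by auto
    ultimately show ?thesis by blast
  qed
  then show ?thesis by blast
qed

section \<open>Subdividing tubes\<close>

definition separated :: "real \<Rightarrow> 'a::metric_space set \<Rightarrow> bool" where
  "separated h P \<longleftrightarrow> (\<forall>p\<in>P. \<forall>q\<in>P. p \<noteq> q \<longrightarrow> h \<le> dist p q)"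

text \<open>A tube parallel to \<open>e\<close> is given by its cross section, an axis-parallel cube of side \<open>s\<close> with
  corner \<open>u\<close>, in coordinates with respect to the orthonormal vectors \<open>B\<close>.\<close>

definition tube :: "'a::euclidean_space set \<Rightarrow> ('a \<Rightarrow> real) \<Rightarrow> real \<Rightarrow> 'a set" where
  "tube B u s = {y. \<forall>b\<in>B. u b \<le> y \<bullet> b \<and> y \<bullet> b \<le> u b + s}"

definition subcorner :: "('a \<Rightarrow> real) \<Rightarrow> real \<Rightarrow> ('a \<Rightarrow> nat) \<Rightarrow> 'a \<Rightarrow> real" where
  "subcorner u s i b = u b + real (i b) * s"

lemma tube_mono: "s \<le> s' \<Longrightarrow> tube B u s \<subseteq> tube B u s'"
  by (force simp: tube_def)

lemma subtube_subset:
  assumes "i \<in> B \<rightarrow>\<^sub>E {..<N}" "0 \<le> s"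
  shows "tube B (subcorner u s i) (s - h) \<subseteq> tube B u (real N * s - h)"
proof
  fix y assume y: "y \<in> tube B (subcorner u s i) (s - h)"
  have "u b \<le> y \<bullet> b \<and> y \<bullet> b \<le> u b + (real N * s - h)" if b: "b \<in> B" for b
  proof -
    have "i b < N" using assms(1) b by auto
    then have "real (i b) + 1 \<le> real N" by linarith
    then have "(real (i b) + 1) * s \<le> real N * s" using assms(2) by (rule mult_right_mono)
    moreover have "0 \<le> real (i b) * s" using assms(2) by simp
    moreover have "u b + real (i b) * s \<le> y \<bullet> b" "y \<bullet> b \<le> u b + real (i b) * s + (s - h)"
      using y b by (auto simp: tube_def subcorner_def)
    ultimately show ?thesis by (auto simp: algebra_simps)
  qed
  then show "y \<in> tube B u (real N * s - h)" by (simp add: tube_def)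
qed

text \<open>Neighbouring closed tubes share a face, so the point sets are confined to tubes
  shortened by \<open>h\<close>; in a coordinate where the indices differ this leaves a gap of width
  \<open>h\<close>.\<close>

lemma dist_subtubes_ge:
  assumes "i \<in> B \<rightarrow>\<^sub>E {..<N}" "j \<in> B \<rightarrow>\<^sub>E {..<N}" "i \<noteq> j" "0 \<le> s"
    and norm: "\<And>b. b \<in> B \<Longrightarrow> norm b = 1"
    and y: "y \<in> tube B (subcorner u s i) (s - h)" and z: "z \<in> tube B (subcorner u s j) (s - h)"
  shows "h \<le> dist y z"
proof -
  have *: "h \<le> dist y z" if b: "b \<in> B" and less: "i b < j b"
    and y: "y \<in> tube B (subcorner u s i) (s - h)" and z: "z \<in> tube B (subcorner u s j) (s - h)" for i j y z b
  proof -
    have "real (i b) + 1 \<le> real (j b)" using less by linarith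
    then have "(real (i b) + 1) * s \<le> real (j b) * s" using assms(4) by (rule mult_right_mono)
    moreover have "y \<bullet> b \<le> u b + real (i b) * s + (s - h)" "u b + real (j b) * s \<le> z \<bullet> b"
      using y z b by (auto simp: tube_def subcorner_def)
    ultimately have "h \<le> (z - y) \<bullet> b" by (simp add: algebra_simps)
    also have "\<dots> \<le> norm (z - y) * norm b" by (rule norm_cauchy_schwarz)
    finally show ?thesis using norm[OF b] by (simp add: dist_norm norm_minus_commute)
  qed
  obtain b where b: "b \<in> B" "i b \<noteq> j b" using assms(1-3) by (metis PiE_ext)
  then consider "i b < j b" | "j b < i b" by linarith
  then show ?thesis
    by cases (use *[OF b(1) _ y z] *[OF b(1) _ z y] in \<open>simp_all add: dist_commute\<close>)
qed

lemma subtubes_union: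
  fixes u :: "'a::euclidean_space \<Rightarrow> real"
  assumes "finite B" and norm: "\<And>b. b \<in> B \<Longrightarrow> norm b = 1" and "0 < h" "0 \<le> s"
    and P: "\<And>i. i \<in> B \<rightarrow>\<^sub>E {..<N} \<Longrightarrow> finite (P i) \<and> separated h (P i) \<and> P i \<subseteq> tube B (subcorner u s i) (s - h)"
  defines "Q \<equiv> \<Union>i\<in>B \<rightarrow>\<^sub>E {..<N}. P i"
  shows "finite Q" "separated h Q" "Q \<subseteq> tube B u (real N * s - h)"
    "card Q = (\<Sum>i\<in>B \<rightarrow>\<^sub>E {..<N}. card (P i))"
proof -
  let ?I = "B \<rightarrow>\<^sub>E {..<N}"
  have fI: "finite ?I" using assms(1) by (intro finite_PiE) auto
  then show "finite Q" using P by (auto simp: Q_def)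
  have far: "h \<le> dist y z" if "i \<in> ?I" "j \<in> ?I" "i \<noteq> j" "y \<in> P i" "z \<in> P j" for i j y z
    by (rule dist_subtubes_ge[OF that(1-3) assms(4) norm]) (use P that in blast)+
  show "separated h Q"
    unfolding separated_def
  proof (intro ballI impI)
    fix y z assume yz: "y \<in> Q" "z \<in> Q" "y \<noteq> z"
    then obtain i j where ij: "i \<in> ?I" "j \<in> ?I" "y \<in> P i" "z \<in> P j" by (auto simp: Q_def)
    show "h \<le> dist y z"
    proof (cases "i = j")
      case True
      then show ?thesis using P[OF ij(1)] ij yz(3) by (simp add: separated_def)
    next
      case False
      then show ?thesis using far ij by blast
    qed
  qed
  show "Q \<subseteq> tube B u (real N * s - h)"
    unfolding Q_def using P subtube_subset[OF _ assms(4)] by (intro UN_least) blast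
  show "card Q = (\<Sum>i\<in>?I. card (P i))"
    unfolding Q_def
  proof (rule card_UN_disjoint[OF fI])
    show "\<forall>i\<in>?I. finite (P i)" using P by blast
    show "\<forall>i\<in>?I. \<forall>j\<in>?I. i \<noteq> j \<longrightarrow> P i \<inter> P j = {}"
      using far \<open>0 < h\<close> by (metis disjoint_iff dist_self not_le)
  qed
qed

text \<open>The function \<open>\<delta>\<close> will be the distance to the boundary. A clearance
  equal to the side of the tube makes a flag pass to every subtube, and lets a flag at an
  intermediate height separate the boundary points below it from those above it.\<close>

definition flag :: "('a::euclidean_space \<Rightarrow> real) \<Rightarrow> 'a set \<Rightarrow> 'a \<Rightarrow> ('a \<Rightarrow> real) \<Rightarrow> real \<Rightarrow> real \<Rightarrow> 'a set \<Rightarrow> bool" where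
  "flag \<delta> B e u s t G \<longleftrightarrow> (\<forall>y\<in>tube B u s. y \<bullet> e = t \<longrightarrow> y \<in> G \<and> s \<le> \<delta> y)"

lemma flag_subtube:
  assumes "flag \<delta> B e u (real N * s) t G" "i \<in> B \<rightarrow>\<^sub>E {..<N}" "0 \<le> s" "1 \<le> N"
  shows "flag \<delta> B e (subcorner u s i) s t G"
proof -
  have "s \<le> real N * s" using assms(3,4) by (simp add: mult_le_cancel_right1)
  then show ?thesis
    using assms(1) subtube_subset[OF assms(2,3), of u 0] unfolding flag_def by fastforce
qed

section \<open>Orthonormal frames and counting crossings in tubes\<close>

locale orthonormal_frame =
  fixes B :: "'a::euclidean_space set" and e :: 'a and n :: nat
  assumes finite_B: "finite B" and card_B: "card B = n"
    and norm_B: "\<And>b. b \<in> B \<Longrightarrow> norm b = 1" and norm_e: "norm e = 1"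
    and orth: "\<And>b b'. b \<in> B \<Longrightarrow> b' \<in> B \<Longrightarrow> b \<noteq> b' \<Longrightarrow> b \<bullet> b' = 0"
    and orth_e: "\<And>b. b \<in> B \<Longrightarrow> b \<bullet> e = 0"
    and spans: "span (insert e B) = UNIV"
begin

definition axis_point :: "('a \<Rightarrow> real) \<Rightarrow> real \<Rightarrow> 'a" where
  "axis_point v t = (\<Sum>b\<in>B. v b *\<^sub>R b) + t *\<^sub>R e"

lemma axis_point_inner [simp]:
  "b \<in> B \<Longrightarrow> axis_point v t \<bullet> b = v b" "axis_point v t \<bullet> e = t"
proof -
  assume b: "b \<in> B"
  have "(\<Sum>c\<in>B. v c *\<^sub>R c) \<bullet> b = (\<Sum>c\<in>B. if c = b then v c else 0)"
    unfolding inner_sum_left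
    by (intro sum.cong refl) (use b orth norm_B in \<open>auto simp: norm_eq_1\<close>)
  also have "\<dots> = v b" using b finite_B by simp
  finally show "axis_point v t \<bullet> b = v b"
    using orth_e[OF b] by (simp add: axis_point_def inner_add_left inner_commute[of e b])
next
  have "(\<Sum>c\<in>B. v c *\<^sub>R c) \<bullet> e = 0"
    unfolding inner_sum_left using orth_e by simp
  then show "axis_point v t \<bullet> e = t"
    using norm_e by (simp add: axis_point_def inner_add_left norm_eq_1)
qed

lemma eq_axis_point: "y = axis_point (\<lambda>b. y \<bullet> b) (y \<bullet> e)"
proof -
  define z where "z = y - axis_point (\<lambda>b. y \<bullet> b) (y \<bullet> e)"
  have "z \<bullet> c = 0" if "c \<in> insert e B" for c
    using that by (auto simp: z_def inner_diff_left)
  then have "orthogonal z c" if "c \<in> span (insert e B)" for c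
    using that orthogonal_to_span by (metis orthogonal_def)
  then have "orthogonal z z" using spans by blast
  then show ?thesis by (simp add: z_def orthogonal_def)
qed

lemma norm_le_coords: "norm y \<le> (\<Sum>b\<in>B. \<bar>y \<bullet> b\<bar>) + \<bar>y \<bullet> e\<bar>"
proof -
  have "norm y = norm (axis_point (\<lambda>b. y \<bullet> b) (y \<bullet> e))" using eq_axis_point by metis
  also have "\<dots> \<le> norm (\<Sum>b\<in>B. (y \<bullet> b) *\<^sub>R b) + norm ((y \<bullet> e) *\<^sub>R e)"
    unfolding axis_point_def by (rule norm_triangle_ineq)
  also have "norm (\<Sum>b\<in>B. (y \<bullet> b) *\<^sub>R b) \<le> (\<Sum>b\<in>B. norm ((y \<bullet> b) *\<^sub>R b))" by (rule norm_sum)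
  finally show ?thesis using norm_B norm_e by simp
qed

text \<open>This crude bound by the sum of the coordinates is the origin of the factor
  \<open>real n\<close> in the later constants.\<close>

lemma norm_le_if_coords_le:
  assumes "\<And>b. b \<in> B \<Longrightarrow> \<bar>y \<bullet> b\<bar> \<le> s" "y \<bullet> e = 0"
  shows "norm y \<le> real n * s"
proof -
  have "norm y \<le> (\<Sum>b\<in>B. \<bar>y \<bullet> b\<bar>)" using norm_le_coords[of y] assms(2) by simp
  also have "\<dots> \<le> (\<Sum>b\<in>B. s)" using assms(1) by (rule sum_mono)
  finally show ?thesis by (simp add: card_B)
qed

lemma card_subtubes: "card (B \<rightarrow>\<^sub>E {..<N}) = N ^ n"
  using finite_B by (simp add: card_PiE card_B)

text \<open>Each of the \<open>N ^ (M * n)\<close> thinnest tubes contributes one crossing, on the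
  line through its corner. Subdividing one level at a time allows the separation of the pieces to be
  taken from \<open>subtubes_union\<close>.\<close>

lemma crossing_points:
  assumes flags: "flag \<delta> B e u (real N ^ M * h) a G" "flag \<delta> B e u (real N ^ M * h) t G'"
    and "0 < h" "1 \<le> N" "a < t"
    and cross: "\<And>y z. y \<in> G \<Longrightarrow> z \<in> G' \<Longrightarrow> closed_segment y z \<inter> F \<noteq> {}"
    and zero: "\<And>y. y \<in> F \<Longrightarrow> \<delta> y = 0"
  shows "\<exists>P. finite P \<and> separated h P \<and> P \<subseteq> tube B u (real N ^ M * h - h) \<inter> F \<and>
    (\<forall>p\<in>P. a < p \<bullet> e \<and> p \<bullet> e < t) \<and> card P = N ^ (M * n)"
  using flags
proof (induction M arbitrary: u)
  case 0
  \<comment> \<open>The shortened tube has side \<open>h - h = 0\<close> here, so the crossing must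
    be sought on the line through the corner itself.\<close>
  let ?y = "axis_point u a" and ?z = "axis_point u t"
  have fl: "?y \<in> G" "?z \<in> G'" "h \<le> \<delta> ?y" "h \<le> \<delta> ?z"
    using 0 \<open>0 < h\<close> by (auto simp: flag_def tube_def)
  then obtain p where p: "p \<in> closed_segment ?y ?z" "p \<in> F" using cross by blast
  then obtain k where k: "0 \<le> k" "k \<le> 1" "p = (1 - k) *\<^sub>R ?y + k *\<^sub>R ?z"
    by (auto simp: in_segment)
  have "p \<noteq> ?y" "p \<noteq> ?z" using zero[OF p(2)] fl \<open>0 < h\<close> by auto
  then have k01: "0 < k" "k < 1" using k by (auto simp: less_le)
  have inner: "p \<bullet> e = a + k * (t - a)" "\<And>b. b \<in> B \<Longrightarrow> p \<bullet> b = u b"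
    unfolding k(3) by (simp_all add: inner_add_left algebra_simps)
  have "0 < k * (t - a)" "k * (t - a) < 1 * (t - a)"
    using k01 \<open>a < t\<close> by (auto intro!: mult_strict_right_mono)
  then have "a < p \<bullet> e" "p \<bullet> e < t" unfolding inner(1) by auto
  then show ?case
    using p(2) inner(2) by (intro exI[of _ "{p}"]) (auto simp: separated_def tube_def)
next
  case (Suc M)
  define s where "s = real N ^ M * h"
  have s: "0 \<le> s" "real N ^ Suc M * h = real N * s" using \<open>0 < h\<close> by (auto simp: s_def)
  have "\<exists>P. finite P \<and> separated h P \<and> P \<subseteq> tube B (subcorner u s i) (s - h) \<inter> F \<and>
    (\<forall>p\<in>P. a < p \<bullet> e \<and> p \<bullet> e < t) \<and> card P = N ^ (M * n)" if "i \<in> B \<rightarrow>\<^sub>E {..<N}" for i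
    unfolding s_def
    by (rule Suc.IH; fold s_def; rule flag_subtube[OF _ that s(1) \<open>1 \<le> N\<close>])
       (use Suc.prems in \<open>simp_all only: s(2)\<close>)
  then obtain P where P: "\<And>i. i \<in> B \<rightarrow>\<^sub>E {..<N} \<Longrightarrow> finite (P i) \<and> separated h (P i) \<and>
    P i \<subseteq> tube B (subcorner u s i) (s - h) \<inter> F \<and>
    (\<forall>p\<in>P i. a < p \<bullet> e \<and> p \<bullet> e < t) \<and> card (P i) = N ^ (M * n)" by metis
  let ?Q = "\<Union>i\<in>B \<rightarrow>\<^sub>E {..<N}. P i"
  have Q: "finite ?Q" "separated h ?Q" "?Q \<subseteq> tube B u (real N * s - h)"
    "card ?Q = (\<Sum>i\<in>B \<rightarrow>\<^sub>E {..<N}. card (P i))"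
    by (rule subtubes_union[OF finite_B norm_B \<open>0 < h\<close> s(1)]; use P in blast)+
  have "card ?Q = N ^ n * N ^ (M * n)" using Q(4) P by (simp add: card_subtubes)
  then have "card ?Q = N ^ (Suc M * n)" by (simp add: power_add)
  moreover have "?Q \<subseteq> F" "\<forall>p\<in>?Q. a < p \<bullet> e \<and> p \<bullet> e < t"
    using P by blast+
  ultimately show ?case
    unfolding s(2) using Q(1-3) by (intro exI[of _ ?Q] conjI Int_greatest)
qed

text \<open>Every tube running from \<open>A\<close> to one of the two sets \<open>G i\<close> contains a ball of the other one in
  between; each level of the subdivision into \<open>N ^ n\<close> subtubes therefore yields one subtube with
  an additional passage between \<open>G True\<close> and \<open>G False\<close>.\<close>

lemma many_crossing_points:
  fixes G :: "bool \<Rightarrow> 'a set"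
  assumes "0 < h" "1 \<le> N" "0 < \<kappa>" "1 \<le> n" "real n \<le> \<kappa> * real N"
    and cross: "\<And>i y z. y \<in> G i \<Longrightarrow> z \<in> G (\<not> i) \<Longrightarrow> closed_segment y z \<inter> F \<noteq> {}"
    and \<delta>: "\<And>y. y \<in> F \<Longrightarrow> \<delta> y = 0" "\<And>y z. \<delta> y \<le> \<delta> z + dist y z"
    and ins: "\<And>u s t i. h \<le> s \<Longrightarrow> tube B u s \<subseteq> tube B u0 s0 \<Longrightarrow> a < t \<Longrightarrow> t \<le> t0 \<Longrightarrow>
      flag \<delta> B e u s a A \<Longrightarrow> flag \<delta> B e u s t (G i) \<Longrightarrow>
      \<exists>V. a < V \<bullet> e \<and> V \<bullet> e < t \<and> (\<forall>b\<in>B. u b \<le> V \<bullet> b \<and> V \<bullet> b < u b + s) \<and>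
        (\<forall>y. dist V y \<le> \<kappa> * s \<longrightarrow> y \<in> G (\<not> i) \<and> \<kappa> * s \<le> \<delta> y)"
    and "tube B u (real N ^ M * h) \<subseteq> tube B u0 s0" "a < t" "t \<le> t0"
    and flags: "flag \<delta> B e u (real N ^ M * h) a A" "flag \<delta> B e u (real N ^ M * h) t (G i)"
  shows "\<exists>P. finite P \<and> separated h P \<and> P \<subseteq> tube B u (real N ^ M * h - h) \<inter> F \<and>
    (\<forall>p\<in>P. a < p \<bullet> e \<and> p \<bullet> e < t) \<and> M * N ^ (M * n) \<le> card P * N ^ n"
  using assms(10-14)
proof (induction M arbitrary: u t i)
  case 0
  then show ?case by (intro exI[of _ "{}"]) (auto simp: separated_def)
next
  case (Suc M)
  define s where "s = real N ^ M * h"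
  have N1: "1 \<le> real N" using \<open>1 \<le> N\<close> by simp
  have s: "0 < s" "h \<le> s" "real N ^ Suc M * h = real N * s"
    using \<open>0 < h\<close> N1 one_le_power[OF N1, of M] by (auto simp: s_def)
  have "h \<le> real N * s" using s N1 by (meson less_imp_le mult_le_cancel_right1 not_le order_trans)
  note prems = Suc.prems[unfolded s(3)]
  obtain V where V: "a < V \<bullet> e" "V \<bullet> e < t" "\<And>b. b \<in> B \<Longrightarrow> u b \<le> V \<bullet> b \<and> V \<bullet> b < u b + real N * s"
    "\<And>y. dist V y \<le> \<kappa> * (real N * s) \<Longrightarrow> y \<in> G (\<not> i) \<and> \<kappa> * (real N * s) \<le> \<delta> y"
    using ins[OF \<open>h \<le> real N * s\<close> prems] by blast
  let ?I = "B \<rightarrow>\<^sub>E {..<N}"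
  have sub: "tube B (subcorner u s j) s \<subseteq> tube B u0 s0" if "j \<in> ?I" for j
    using subtube_subset[OF that, of s u 0] s(1) prems(1) by auto
  have flag_a: "flag \<delta> B e (subcorner u s j) s a A" if "j \<in> ?I" for j
    using flag_subtube[OF prems(4) that] s(1) \<open>1 \<le> N\<close> by simp
  have flag_t: "flag \<delta> B e (subcorner u s j) s t (G i)" if "j \<in> ?I" for j
    using flag_subtube[OF prems(5) that] s(1) \<open>1 \<le> N\<close> by simp
  \<comment> \<open>The index of a subtube whose cross section contains the transverse position of
    \<open>V\<close>; the strict upper bound on \<open>V \<bullet> b\<close> keeps it below
    \<open>N\<close>, and the restriction to \<open>B\<close> makes it extensional.\<close>
  define j0 where "j0 = (\<lambda>b\<in>B. nat \<lfloor>(V \<bullet> b - u b) / s\<rfloor>)"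
  have j0: "j0 b < N" "u b + real (j0 b) * s \<le> V \<bullet> b" "V \<bullet> b \<le> u b + real (j0 b) * s + s"
    if b: "b \<in> B" for b
  proof -
    define x where "x = (V \<bullet> b - u b) / s"
    have x: "0 \<le> x" "x < real N" "V \<bullet> b = u b + x * s"
      using V(3)[OF b] s(1) by (auto simp: x_def field_simps)
    have j: "real (j0 b) \<le> x" "x < real (j0 b) + 1"
      using x(1) b by (auto simp: j0_def x_def[symmetric] of_nat_nat)
    then show "j0 b < N" using x(2) by linarith
    show "u b + real (j0 b) * s \<le> V \<bullet> b" using j(1) s(1) x(3) by simp
    have "x * s \<le> (real (j0 b) + 1) * s" using j(2) s(1) by (intro mult_right_mono) auto
    then show "V \<bullet> b \<le> u b + real (j0 b) * s + s" using x(3) by (simp add: algebra_simps)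
  qed
  have j0I: "j0 \<in> ?I" using j0(1) by (auto simp: j0_def)
  \<comment> \<open>The choice \<open>real n \<le> \<kappa> * real N\<close> lets the ball of radius
    \<open>\<kappa> * (real N * s)\<close> about \<open>V\<close> cover the whole cross section of
    the subtube at that height, which becomes a flag for \<open>G (\<not> i)\<close>.\<close>
  have kN: "real n * s \<le> \<kappa> * (real N * s)" "s \<le> \<kappa> * (real N * s)"
  proof -
    show 1: "real n * s \<le> \<kappa> * (real N * s)" using mult_right_mono[OF assms(5), of s] s(1) by (simp add: mult.assoc)
    have "1 * s \<le> real n * s" using \<open>1 \<le> n\<close> s(1) by (intro mult_right_mono) auto
    then show "s \<le> \<kappa> * (real N * s)" using 1 by simp
  qed
  have flag_V: "flag \<delta> B e (subcorner u s j0) s (V \<bullet> e) (G (\<not> i))"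
    unfolding flag_def
  proof (intro ballI impI)
    fix y assume y: "y \<in> tube B (subcorner u s j0) s" "y \<bullet> e = V \<bullet> e"
    have "norm (V - y) \<le> real n * s"
    proof (rule norm_le_if_coords_le)
      fix b assume b: "b \<in> B"
      have "u b + real (j0 b) * s \<le> y \<bullet> b" "y \<bullet> b \<le> u b + real (j0 b) * s + s"
        using y(1) b by (auto simp: tube_def subcorner_def)
      then show "\<bar>(V - y) \<bullet> b\<bar> \<le> s" using j0(2,3)[OF b] by (simp add: inner_diff_left)
    qed (use y in \<open>simp add: inner_diff_left\<close>)
    then have "dist V y \<le> \<kappa> * (real N * s)" using kN(1) by (simp add: dist_norm)
    then show "y \<in> G (\<not> i) \<and> s \<le> \<delta> y" using V(4) kN(2) by force
  qed
  \<comment> \<open>The end height and the target vary because the subtube \<open>j0\<close> is used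
    only up to \<open>V\<close>, with the other target, and the remaining subtubes in full.\<close>
  have IH: "\<exists>P. finite P \<and> separated h P \<and> P \<subseteq> tube B (subcorner u s j) (s - h) \<inter> F \<and>
    (\<forall>p\<in>P. a < p \<bullet> e \<and> p \<bullet> e < t') \<and> M * N ^ (M * n) \<le> card P * N ^ n"
    if "j \<in> ?I" "a < t'" "t' \<le> t" "flag \<delta> B e (subcorner u s j) s t' (G i')" for j t' i'
    by (rule Suc.IH[of "subcorner u s j" t' i', folded s_def]) (use that sub flag_a prems in auto)
  obtain P0 where P0: "finite P0 \<and> separated h P0 \<and> P0 \<subseteq> tube B (subcorner u s j0) (s - h) \<inter> F \<and>
    (\<forall>p\<in>P0. a < p \<bullet> e \<and> p \<bullet> e < V \<bullet> e) \<and> M * N ^ (M * n) \<le> card P0 * N ^ n"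
    using IH[OF j0I V(1) _ flag_V] V(2) by auto
  \<comment> \<open>Above \<open>V\<close> the subtube \<open>j0\<close> runs from one of the two
    sets \<open>G\<close> to the other, and every thinnest tube in it yields a crossing: the gain of
    the present level.\<close>
  obtain P1 where P1: "finite P1 \<and> separated h P1 \<and> P1 \<subseteq> tube B (subcorner u s j0) (s - h) \<inter> F \<and>
    (\<forall>p\<in>P1. V \<bullet> e < p \<bullet> e \<and> p \<bullet> e < t) \<and> card P1 = N ^ (M * n)"
    using crossing_points[of \<delta> "subcorner u s j0" N M h "V \<bullet> e" "G (\<not> i)" t "G i" F]
      flag_V flag_t[OF j0I] \<open>0 < h\<close> \<open>1 \<le> N\<close> V(2) cross[of _ "\<not> i"] \<delta>(1)
    unfolding s_def by auto
  have "\<exists>P. finite P \<and> separated h P \<and> P \<subseteq> tube B (subcorner u s j) (s - h) \<inter> F \<and>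
    (\<forall>p\<in>P. a < p \<bullet> e \<and> p \<bullet> e < t) \<and> M * N ^ (M * n) \<le> card P * N ^ n" if "j \<in> ?I" for j
    using IH[OF that _ _ flag_t[OF that]] prems(2) by auto
  then obtain R where R: "\<And>j. j \<in> ?I \<Longrightarrow> finite (R j) \<and> separated h (R j) \<and>
    R j \<subseteq> tube B (subcorner u s j) (s - h) \<inter> F \<and>
    (\<forall>p\<in>R j. a < p \<bullet> e \<and> p \<bullet> e < t) \<and> M * N ^ (M * n) \<le> card (R j) * N ^ n" by metis
  \<comment> \<open>The segment from a point below \<open>V\<close> to one above it passes through
    the flag at height \<open>V \<bullet> e\<close>, where \<open>\<delta>\<close> is at least
    \<open>s\<close>, while \<open>\<delta>\<close> vanishes at both ends; so these are at least
    \<open>2 * s\<close> apart.\<close>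
  have far: "h \<le> dist p q" if p: "p \<in> P0" and q: "q \<in> P1" for p q
  proof (rule ccontr)
    assume less: "\<not> h \<le> dist p q"
    have pe: "p \<bullet> e < V \<bullet> e" "V \<bullet> e < q \<bullet> e" using p q P0 P1 by auto
    define k where "k = (V \<bullet> e - p \<bullet> e) / (q \<bullet> e - p \<bullet> e)"
    have k: "0 \<le> k" "k \<le> 1" "k * (q \<bullet> e - p \<bullet> e) = V \<bullet> e - p \<bullet> e" using pe by (auto simp: k_def)
    define w where "w = (1 - k) *\<^sub>R p + k *\<^sub>R q"
    have "w \<bullet> e = V \<bullet> e" using k(3) by (simp add: w_def inner_add_left algebra_simps)
    moreover have "w \<in> tube B (subcorner u s j0) s"
      unfolding tube_def
    proof (intro CollectI ballI)
      fix b assume b: "b \<in> B"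
      let ?c = "subcorner u s j0 b"
      have "?c \<le> p \<bullet> b" "p \<bullet> b \<le> ?c + s" "?c \<le> q \<bullet> b" "q \<bullet> b \<le> ?c + s"
        using p q P0 P1 b \<open>0 < h\<close> by (force simp: tube_def)+
      then have "p \<bullet> b \<in> {?c..?c + s}" "q \<bullet> b \<in> {?c..?c + s}" by auto
      then have "(1 - k) *\<^sub>R (p \<bullet> b) + k *\<^sub>R (q \<bullet> b) \<in> {?c..?c + s}"
        using k by (intro convexD) auto
      then show "?c \<le> w \<bullet> b \<and> w \<bullet> b \<le> ?c + s" by (simp add: w_def inner_add_left)
    qed
    ultimately have "s \<le> \<delta> w" using flag_V by (auto simp: flag_def)
    moreover have "\<delta> p = 0" "\<delta> q = 0" using \<delta>(1) P0 P1 p q by auto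
    ultimately have "s \<le> dist w p" "s \<le> dist w q" using \<delta>(2)[of w p] \<delta>(2)[of w q] by auto
    moreover have "dist p q = dist p w + dist w q"
      using k by (intro between[THEN iffD1]) (auto simp: between_mem_segment in_segment w_def)
    ultimately show False using less s by (simp add: dist_commute)
  qed
  define P where "P j = (if j = j0 then P0 \<union> P1 else R j)" for j
  have P: "finite (P j) \<and> separated h (P j) \<and> P j \<subseteq> tube B (subcorner u s j) (s - h)" if "j \<in> ?I" for j
  proof (cases "j = j0")
    case True
    have "separated h (P0 \<union> P1)"
      using far P0 P1 unfolding separated_def by (metis Un_iff dist_commute)
    then show ?thesis using True P0 P1 by (auto simp: P_def)
  next
    case False
    then show ?thesis using R[OF that] by (auto simp: P_def)
  qed
  let ?Q = "\<Union>j\<in>?I. P j"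
  have Q: "finite ?Q" "separated h ?Q" "?Q \<subseteq> tube B u (real N * s - h)"
    "card ?Q = (\<Sum>j\<in>?I. card (P j))"
    by (rule subtubes_union[OF finite_B norm_B \<open>0 < h\<close> less_imp_le[OF s(1)] P]; assumption)+
  have fI: "finite ?I" using finite_B by (intro finite_PiE) auto
  have "P0 \<inter> P1 = {}" using P0 P1 by fastforce
  then have c0: "M * N ^ (M * n) + N ^ (M * n) * N ^ n \<le> card (P j0) * N ^ n"
    using P0 P1 by (simp add: P_def card_Un_disjoint add_mult_distrib)
  have cj: "M * N ^ (M * n) \<le> card (P j) * N ^ n" if "j \<in> ?I - {j0}" for j
    using R that by (auto simp: P_def)
  \<comment> \<open>The gain \<open>N ^ (M * n)\<close> occurs in only one of the
    \<open>N ^ n\<close> subtubes; the factor \<open>N ^ n\<close> kept beside the cardinality in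
    the claim raises it to \<open>N ^ (Suc M * n)\<close>.\<close>
  have "Suc M * N ^ (Suc M * n) = (\<Sum>j\<in>?I. M * N ^ (M * n)) + N ^ (M * n) * N ^ n"
    by (simp add: card_subtubes power_add algebra_simps)
  also have "\<dots> = (M * N ^ (M * n) + N ^ (M * n) * N ^ n) + (\<Sum>j\<in>?I - {j0}. M * N ^ (M * n))"
    using fI j0I by (subst sum.remove[of ?I j0]) auto
  also have "\<dots> \<le> card (P j0) * N ^ n + (\<Sum>j\<in>?I - {j0}. card (P j) * N ^ n)"
    by (intro add_mono c0 sum_mono cj)
  also have "\<dots> = (\<Sum>j\<in>?I. card (P j) * N ^ n)"
    using fI j0I by (simp add: sum.remove)
  also have "\<dots> = card ?Q * N ^ n" by (simp add: Q(4) sum_distrib_right)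
  finally have "Suc M * N ^ (Suc M * n) \<le> card ?Q * N ^ n" .
  moreover have "?Q \<subseteq> F" "\<forall>p\<in>?Q. a < p \<bullet> e \<and> p \<bullet> e < t"
  proof -
    have Pj: "P j \<subseteq> F \<and> (\<forall>p\<in>P j. a < p \<bullet> e \<and> p \<bullet> e < t)" if "j \<in> ?I" for j
    proof (cases "j = j0")
      case True
      then show ?thesis using P0 P1 V(1,2) by (force simp: P_def)
    next
      case False
      then show ?thesis using R[OF that] by (simp add: P_def)
    qed
    then show "?Q \<subseteq> F" "\<forall>p\<in>?Q. a < p \<bullet> e \<and> p \<bullet> e < t" by blast+
  qed
  ultimately show ?case
    unfolding s(3) using Q(1-3) by (intro exI[of _ ?Q] conjI Int_greatest)
qed

end

lemma orthonormal_frame_exists: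
  fixes e :: "'a::euclidean_space"
  assumes "norm e = 1" "DIM('a) = n + 1"
  shows "\<exists>B. orthonormal_frame B e n"
proof -
  obtain S where S: "e \<in> S" "pairwise orthogonal S" "\<And>x. x \<in> S \<Longrightarrow> norm x = 1"
    "independent S" "card S = DIM('a)" "span S = UNIV"
    using vector_in_orthonormal_basis[OF assms(1)] by metis
  have "orthonormal_frame (S - {e}) e n"
  proof
    show "finite (S - {e})" using S(4) by (simp add: finiteI_independent)
    show "card (S - {e}) = n" using S(1,5) assms(2) by simp
    show "span (insert e (S - {e})) = UNIV" using S(1,6) by (simp add: insert_absorb)
  qed (use S assms in \<open>auto simp: pairwise_def orthogonal_def\<close>)
  then show ?thesis ..
qed

section \<open>Connecting corkscrew points to John centres\<close>

lemma dist_le_path_length: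
  assumes "a \<le> u" "u \<le> v" "v \<le> b"
  shows "ennreal (dist (\<gamma> u) (\<gamma> v)) \<le> path_length \<gamma> a b"
proof -
  have "(\<Sum>i<length [u, v] - 1. ennreal (dist (\<gamma> ([u, v] ! i)) (\<gamma> ([u, v] ! Suc i)))) \<le> path_length \<gamma> a b"
    unfolding path_length_def by (rule SUP_upper) (use assms in auto)
  then show ?thesis by simp
qed

lemma bdist_ge_if_ball_subset_interior:
  assumes "ball y r \<subseteq> S" "S \<inter> frontier \<Omega> = {}" "frontier \<Omega> \<noteq> {}"
  shows "r \<le> bdist \<Omega> y"
  unfolding bdist_ge_iff[OF assms(3)]
proof
  fix z assume "z \<in> frontier \<Omega>"
  then have "z \<notin> ball y r" using assms by blast
  then show "r \<le> dist y z" by simp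
qed

lemma exterior_disjoint_frontier: "interior (- S) \<inter> frontier S = {}"
  by (auto simp: frontier_def interior_closure)

text \<open>From the time when the John path is \<open>\<sigma> / 2\<close> away from
  \<open>z\<close>, its length from \<open>z\<close> is at least \<open>\<sigma> / 2\<close>, so
  non-tangentiality keeps the depth at least \<open>\<sigma> / (2 * J)\<close> all the way to
  \<open>Y\<close>. Half of this depth remains on a ball about the point reached, and the rest of
  the path joins that ball to \<open>Y\<close>.\<close>

lemma john_path_ball:
  fixes \<Omega> :: "'a::euclidean_space set"
  assumes "1 \<le> J" "z \<in> frontier \<Omega>" "dist x z < r"
    and \<gamma>: "path_in_from_to \<Omega> \<gamma> z Y" "nontangential \<Omega> J \<gamma>" "path_length \<gamma> 0 1 \<le> ennreal (J * r)"
    and \<sigma>: "0 < \<sigma>" "\<sigma> \<le> r" "\<sigma> \<le> dist z Y" "\<epsilon> \<le> \<sigma> / (4 * J)"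
  shows "\<exists>V. dist z V < \<sigma> \<and> (\<forall>y. dist V y \<le> \<sigma> / (4 * J) \<longrightarrow>
    connected_component (deep \<Omega> \<epsilon> x ((J + 2) * r)) Y y \<and> \<sigma> / (4 * J) \<le> bdist \<Omega> y)"
proof -
  have J: "0 < J" "0 < r" using assms(1) \<sigma> by auto
  have path: "continuous_on {0..1} \<gamma>" "\<gamma> 0 = z" "\<gamma> 1 = Y" "\<And>t. 0 < t \<Longrightarrow> t \<le> 1 \<Longrightarrow> \<gamma> t \<in> \<Omega>"
    using \<gamma>(1) by (auto simp: path_in_from_to_def path_def pathstart_def pathfinish_def)
  have "\<exists>t\<ge>0. t \<le> 1 \<and> dist z (\<gamma> t) = \<sigma> / 2"
    by (rule IVT') (use path \<sigma> in \<open>auto intro!: continuous_intros\<close>)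
  then obtain t where t: "0 \<le> t" "t \<le> 1" "dist z (\<gamma> t) = \<sigma> / 2" by blast
  have "t \<noteq> 0" using t(3) path(2) \<sigma>(1) by auto
  then have t0: "0 < t" using t(1) by simp
  have late: "\<sigma> / (2 * J) \<le> bdist \<Omega> (\<gamma> t')" if "t \<le> t'" "t' \<le> 1" for t'
  proof -
    have "ennreal (\<sigma> / 2) \<le> path_length \<gamma> 0 t'"
      using dist_le_path_length[of 0 0 t t' \<gamma>] t path(2) that by simp
    also have "\<dots> \<le> ennreal (J * bdist \<Omega> (\<gamma> t'))"
      using \<gamma>(2) t(1) that by (auto simp: nontangential_def)
    finally have "\<sigma> / 2 \<le> J * bdist \<Omega> (\<gamma> t')" using J by (subst (asm) ennreal_le_iff) auto
    then show ?thesis using J by (simp add: field_simps)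
  qed
  have near: "dist z (\<gamma> t') \<le> J * r" if "0 \<le> t'" "t' \<le> 1" for t'
  proof -
    have "ennreal (dist z (\<gamma> t')) \<le> path_length \<gamma> 0 1"
      using dist_le_path_length[of 0 0 t' 1 \<gamma>] path(2) that by simp
    then have "ennreal (dist z (\<gamma> t')) \<le> ennreal (J * r)" using \<gamma>(3) by simp
    then show ?thesis using J by (subst (asm) ennreal_le_iff) auto
  qed
  define V where "V = \<gamma> t"
  have half: "\<sigma> / (4 * J) < \<sigma> / (2 * J)" using J \<sigma>(1) by (simp add: field_simps)
  have "\<sigma> / (4 * J) \<le> \<sigma> / 1"
    using \<sigma>(1) assms(1) by (intro divide_left_mono) auto
  then have quarter: "\<sigma> / (4 * J) \<le> r" using \<sigma>(2) by simp
  let ?T = "cball V (\<sigma> / (4 * J))" and ?D = "deep \<Omega> \<epsilon> x ((J + 2) * r)"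
  have T: "y \<in> \<Omega> \<and> \<sigma> / (4 * J) \<le> bdist \<Omega> y" if "y \<in> ?T" for y
  proof
    have "\<sigma> / (2 * J) \<le> bdist \<Omega> V" using late[of t] t by (simp add: V_def)
    then show "\<sigma> / (4 * J) \<le> bdist \<Omega> y"
      using bdist_triangle[of \<Omega> V y] that by simp
    have "ball V (bdist \<Omega> V) \<subseteq> \<Omega>"
      by (rule ball_bdist_subset) (use path(4)[OF t0 t(2)] in \<open>simp_all add: V_def\<close>)
    then show "y \<in> \<Omega>" using that half \<open>\<sigma> / (2 * J) \<le> bdist \<Omega> V\<close> by (auto simp: subset_iff)
  qed
  \<comment> \<open>The path stays within \<open>J * r\<close> of \<open>z\<close>; the distance
    from \<open>x\<close> to \<open>z\<close> and the radius of the ball cost one further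
    \<open>r\<close> each, hence \<open>(J + 2) * r\<close>.\<close>
  have "?T \<union> \<gamma> ` {t..1} \<subseteq> ?D"
  proof (rule Un_least)
    show "?T \<subseteq> ?D"
    proof
      fix y assume y: "y \<in> ?T"
      have "dist x y \<le> dist x z + dist z V + dist V y"
        using dist_triangle[of x y V] dist_triangle[of x V z] by linarith
      also have "\<dots> \<le> r + J * r + r"
        using assms(3) near[of t] t y quarter by (intro add_mono) (auto simp: V_def)
      finally show "y \<in> ?D"
        using T[OF y] \<sigma>(4) by (simp add: deep_def algebra_simps)
    qed
    show "\<gamma> ` {t..1} \<subseteq> ?D"
    proof clarify
      fix t' assume t': "t' \<in> {t..1}"
      have "dist x (\<gamma> t') \<le> r + J * r"
        using dist_triangle[of x "\<gamma> t'" z] assms(3) near[of t'] t' t0 by simp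
      then have "dist x (\<gamma> t') \<le> (J + 2) * r" using J by (simp add: algebra_simps)
      then show "\<gamma> t' \<in> ?D"
        using late[of t'] path(4)[of t'] t' t0 \<sigma>(4) half by (simp add: deep_def)
    qed
  qed
  moreover have "connected (?T \<union> \<gamma> ` {t..1})"
  proof (rule connected_Un)
    show "connected (\<gamma> ` {t..1})"
      using path(1) t0 by (intro connected_continuous_image) (auto elim: continuous_on_subset)
    show "?T \<inter> \<gamma> ` {t..1} \<noteq> {}" using t \<sigma> J by (force simp: V_def)
  qed simp
  moreover have "Y \<in> ?T \<union> \<gamma> ` {t..1}" using path(3) t(2) by force
  ultimately have "connected_component ?D Y y" if "y \<in> ?T" for y
    using that unfolding connected_component_def by blast
  then show ?thesis
    using T t(3) \<sigma>(1) by (intro exI[of _ V]) (auto simp: V_def)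
qed

locale john_corkscrew =
  fixes \<Omega> :: "'a::euclidean_space set" and c J :: real
  assumes open_\<Omega>: "open \<Omega>" and c: "0 < c" and J: "1 \<le> J"
    and corkscrew: "\<And>x r. x \<in> frontier \<Omega> \<Longrightarrow> 0 < r \<Longrightarrow> ennreal r < ediam (frontier \<Omega>) \<Longrightarrow>
      \<exists>X X'. ball X (c * r) \<subseteq> ball x r \<inter> \<Omega> \<and> ball X' (c * r) \<subseteq> ball x r \<inter> interior (- \<Omega>)"
    and john: "\<And>x r. x \<in> frontier \<Omega> \<Longrightarrow> 0 < r \<Longrightarrow> ennreal r < ediam (frontier \<Omega>) \<Longrightarrow>
      \<exists>Y \<in> ball x r \<inter> \<Omega>. ball Y (r / J) \<subseteq> \<Omega> \<and> (\<forall>z \<in> ball x r \<inter> frontier \<Omega>.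
        \<exists>\<gamma>. path_in_from_to \<Omega> \<gamma> z Y \<and> nontangential \<Omega> J \<gamma> \<and> path_length \<gamma> 0 1 \<le> ennreal (J * r))"
begin

lemma frontier_not_mem: "z \<in> frontier \<Omega> \<Longrightarrow> z \<notin> \<Omega>"
  using open_\<Omega> by (simp add: frontier_def interior_open)

definition john_centre :: "'a \<Rightarrow> real \<Rightarrow> 'a \<Rightarrow> bool" where
  "john_centre x r Y \<longleftrightarrow> Y \<in> ball x r \<inter> \<Omega> \<and> ball Y (r / J) \<subseteq> \<Omega> \<and> (\<forall>z \<in> ball x r \<inter> frontier \<Omega>.
     \<exists>\<gamma>. path_in_from_to \<Omega> \<gamma> z Y \<and> nontangential \<Omega> J \<gamma> \<and> path_length \<gamma> 0 1 \<le> ennreal (J * r))"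

text \<open>Supplies whichever phase a passage lacks: for the John component a ball on the path from
  \<open>z\<close>, for the exterior half of a corkscrew ball at \<open>z\<close>. The bound
  \<open>\<sigma> \<le> r / J\<close> makes the path long enough, since
  \<open>ball Y (r / J)\<close> contains no boundary point.\<close>

lemma small_balls_near_boundary:
  fixes i :: bool
  assumes x: "x \<in> frontier \<Omega>" "0 < r" "ennreal r < ediam (frontier \<Omega>)" and Y: "john_centre x r Y"
    and z: "z \<in> frontier \<Omega>" "dist x z < r"
    and \<sigma>: "0 < \<sigma>" "\<sigma> \<le> r / J" "\<epsilon> \<le> \<sigma> / (4 * J)"
    and \<kappa>: "\<kappa> \<le> c / 2" "\<kappa> \<le> 1 / (4 * J)"
  shows "\<exists>V. dist z V < \<sigma> \<and> (\<forall>y. dist V y \<le> \<kappa> * \<sigma> \<longrightarrow>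
    y \<in> (if i then connected_component_set (deep \<Omega> \<epsilon> x ((J + 2) * r)) Y else interior (- \<Omega>)) \<and>
    \<kappa> * \<sigma> \<le> bdist \<Omega> y)"
proof (cases i)
  case True
  have "r / J \<le> r" using J x(2) by (simp add: divide_le_eq mult_le_cancel_left1)
  moreover have "r / J \<le> dist Y z"
    using Y frontier_not_mem[OF z(1)] by (force simp: john_centre_def)
  moreover obtain \<gamma> where "path_in_from_to \<Omega> \<gamma> z Y" "nontangential \<Omega> J \<gamma>" "path_length \<gamma> 0 1 \<le> ennreal (J * r)"
    using Y z unfolding john_centre_def by (meson IntI mem_ball)
  ultimately obtain V where V: "dist z V < \<sigma>" "\<And>y. dist V y \<le> \<sigma> / (4 * J) \<Longrightarrow>
    connected_component (deep \<Omega> \<epsilon> x ((J + 2) * r)) Y y \<and> \<sigma> / (4 * J) \<le> bdist \<Omega> y"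
    using john_path_ball[OF J z, of \<gamma> Y \<sigma> \<epsilon>] \<sigma> by (auto simp: dist_commute)
  have "\<kappa> * \<sigma> \<le> \<sigma> / (4 * J)" using mult_right_mono[OF \<kappa>(2), of \<sigma>] \<sigma>(1) by simp
  then have "y \<in> connected_component_set (deep \<Omega> \<epsilon> x ((J + 2) * r)) Y \<and> \<kappa> * \<sigma> \<le> bdist \<Omega> y"
    if "dist V y \<le> \<kappa> * \<sigma>" for y
    using V(2)[of y] that by simp
  then show ?thesis using V(1) True by auto
next
  case False
  have "r / J \<le> r" using J x(2) by (simp add: divide_le_eq mult_le_cancel_left1)
  then have "ennreal \<sigma> < ediam (frontier \<Omega>)"
    using \<sigma> x by (intro le_less_trans[OF ennreal_leI x(3)]) auto
  then obtain V where V: "ball V (c * \<sigma>) \<subseteq> ball z \<sigma>" "ball V (c * \<sigma>) \<subseteq> interior (- \<Omega>)"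
    using corkscrew[OF z(1) \<sigma>(1)] by blast
  have c\<sigma>: "0 < c * \<sigma>" "\<kappa> * \<sigma> \<le> c / 2 * \<sigma>" using c \<sigma> mult_right_mono[OF \<kappa>(1), of \<sigma>] by auto
  have "y \<in> interior (- \<Omega>) \<and> \<kappa> * \<sigma> \<le> bdist \<Omega> y" if y: "dist V y \<le> \<kappa> * \<sigma>" for y
  proof
    have "ball y (c * \<sigma> / 2) \<subseteq> ball V (c * \<sigma>)"
    proof
      fix w assume "w \<in> ball y (c * \<sigma> / 2)"
      then show "w \<in> ball V (c * \<sigma>)" using dist_triangle[of V w y] y c\<sigma> by simp
    qed
    then have sub: "ball y (c * \<sigma> / 2) \<subseteq> interior (- \<Omega>)" using V(2) by blast
    then show "y \<in> interior (- \<Omega>)" using c\<sigma> by auto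
    have "c * \<sigma> / 2 \<le> bdist \<Omega> y"
      by (rule bdist_ge_if_ball_subset_interior[OF sub exterior_disjoint_frontier]) (use x in auto)
    then show "\<kappa> * \<sigma> \<le> bdist \<Omega> y" using c\<sigma> by simp
  qed
  moreover have "V \<in> ball z \<sigma>" using V(1) c\<sigma>(1) by (meson centre_in_ball subsetD)
  ultimately show ?thesis using False by auto
qed

text \<open>If the centre line of the tube kept depth \<open>\<epsilon>\<close>, it would join
  \<open>X\<close> to \<open>Y\<close> inside \<open>D\<close>, or lead from \<Omega> to the
  exterior without meeting the boundary. So it comes near a boundary point, where the missing phase
  has a ball at scale \<open>s / 8\<close>, with its centre still inside the tube.\<close>

lemma (in orthonormal_frame) passage_ball:
  fixes i :: bool and s t :: real
  assumes JC: "john_corkscrew \<Omega> c J" and "1 \<le> n"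
    and x: "x \<in> frontier \<Omega>" "0 < r" "ennreal r < ediam (frontier \<Omega>)"
    and Y: "john_corkscrew.john_centre \<Omega> J x r Y"
    and region: "\<And>y. y \<in> tube B u0 s0 \<Longrightarrow> a \<le> y \<bullet> e \<Longrightarrow> y \<bullet> e \<le> t0 \<Longrightarrow> dist x y < r - s0"
    and s: "0 < s" "tube B u s \<subseteq> tube B u0 s0" "a < t" "t \<le> t0" "s0 \<le> r / J"
    and \<epsilon>: "0 < \<epsilon>" "\<epsilon> \<le> s / (32 * J)"
    and \<kappa>: "\<kappa> \<le> c / 16" "\<kappa> \<le> 1 / (32 * J)"
    and D: "D = deep \<Omega> \<epsilon> x ((J + 2) * r)" and nc: "\<not> connected_component D X Y"
    and G: "G = (\<lambda>i. if i then connected_component_set D Y else interior (- \<Omega>))"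
    and flags: "flag (bdist \<Omega>) B e u s a (connected_component_set D X)" "flag (bdist \<Omega>) B e u s t (G i)"
  shows "\<exists>V. a < V \<bullet> e \<and> V \<bullet> e < t \<and> (\<forall>b\<in>B. u b \<le> V \<bullet> b \<and> V \<bullet> b < u b + s) \<and>
    (\<forall>y. dist V y \<le> \<kappa> * s \<longrightarrow> y \<in> G (\<not> i) \<and> \<kappa> * s \<le> bdist \<Omega> y)"
proof -
  interpret john_corkscrew \<Omega> c J by (rule JC)
  \<comment> \<open>Opposite corners of the small tube lie in the large one; as \<open>n\<close> is
    positive, there is a coordinate in which to compare the sides.\<close>
  have "s \<le> s0"
  proof -
    obtain b where b: "b \<in> B" using card_B \<open>1 \<le> n\<close> by fastforce
    have "axis_point u 0 \<in> tube B u0 s0" "axis_point (\<lambda>b. u b + s) 0 \<in> tube B u0 s0"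
      by (rule subsetD[OF s(2)], use s(1) in \<open>simp add: tube_def\<close>)+
    then show ?thesis using b by (force simp: tube_def)
  qed
  define v where "v = (\<lambda>b. u b + s / 2)"
  let ?p = "axis_point v a" and ?q = "axis_point v t"
  have pq: "?p \<in> tube B u s" "?q \<in> tube B u s" using s(1) by (auto simp: tube_def v_def)
  have p: "connected_component D X ?p" "s \<le> bdist \<Omega> ?p" and q: "?q \<in> G i" "s \<le> bdist \<Omega> ?q"
    using flags pq unfolding flag_def by auto
  have seg: "w = axis_point v (w \<bullet> e) \<and> a \<le> w \<bullet> e \<and> w \<bullet> e \<le> t \<and> dist x w < r - s0" if "w \<in> closed_segment ?p ?q" for w
  proof -
    obtain k where k: "0 \<le> k" "k \<le> 1" "w = (1 - k) *\<^sub>R ?p + k *\<^sub>R ?q"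
      using \<open>w \<in> closed_segment ?p ?q\<close> by (auto simp: in_segment)
    have h: "w \<bullet> e = (1 - k) *\<^sub>R a + k *\<^sub>R t" unfolding k(3) by (simp add: inner_add_left)
    have "a \<in> {a..t}" "t \<in> {a..t}" using s(3) by auto
    then have "(1 - k) *\<^sub>R a + k *\<^sub>R t \<in> {a..t}" using k by (intro convexD) auto
    then have ht: "a \<le> w \<bullet> e" "w \<bullet> e \<le> t" unfolding h by auto
    have vb: "w \<bullet> b = v b" if "b \<in> B" for b
      unfolding k(3) using that by (simp add: inner_add_left algebra_simps)
    have "w = axis_point (\<lambda>b. w \<bullet> b) (w \<bullet> e)" by (rule eq_axis_point)
    also have "\<dots> = axis_point v (w \<bullet> e)" by (simp add: axis_point_def vb)
    finally have w: "w = axis_point v (w \<bullet> e)" .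
    have "w \<in> tube B u s" using vb s(1) by (auto simp: tube_def v_def)
    then have "dist x w < r - s0" using region[of w] ht s(2,4) by auto
    then show ?thesis using w ht by blast
  qed
  have dist_axis: "dist (axis_point v t1) (axis_point v t2) = \<bar>t1 - t2\<bar>" for t1 t2
    using norm_e by (simp add: axis_point_def dist_norm scaleR_diff_left[symmetric])
  have "\<exists>w\<in>closed_segment ?p ?q. bdist \<Omega> w < \<epsilon>"
  proof (rule ccontr)
    assume "\<not> ?thesis"
    then have ge: "\<And>w. w \<in> closed_segment ?p ?q \<Longrightarrow> \<epsilon> \<le> bdist \<Omega> w" by force
    have "w \<notin> frontier \<Omega>" if "w \<in> closed_segment ?p ?q" for w
      using ge[OF that] \<epsilon>(1) bdist_le[of w \<Omega> w] by auto
    then have "closed_segment ?p ?q \<inter> frontier \<Omega> = {}" by blast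
    moreover have "?p \<in> \<Omega>" using connected_component_in[OF p(1)] by (simp add: D deep_def)
    ultimately have sub: "closed_segment ?p ?q \<subseteq> \<Omega>"
      by (intro subset_if_connected_avoids_frontier[of _ _ ?p]) auto
    have "0 \<le> s0" using \<open>s \<le> s0\<close> s(1) by simp
    have "r \<le> (J + 2) * r" using J x(2) by (simp add: mult_le_cancel_right1)
    then have "closed_segment ?p ?q \<subseteq> D"
      using sub ge seg \<open>0 \<le> s0\<close> by (force simp: D deep_def)
    then have con: "connected_component D ?p ?q"
      unfolding connected_component_def by (intro exI[of _ "closed_segment ?p ?q"]) auto
    show False
    proof (cases i)
      case True
      then have "connected_component D Y ?q" using q(1) by (simp add: G)
      then show False
        using nc p(1) con by (meson connected_component_sym connected_component_trans)
    next
      case False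
      then have "?q \<in> - \<Omega>" using q(1) interior_subset by (auto simp: G)
      then show False using sub by auto
    qed
  qed
  then obtain w where w: "w \<in> closed_segment ?p ?q" "bdist \<Omega> w < \<epsilon>" by blast
  obtain z where z: "z \<in> frontier \<Omega>" "dist w z < \<epsilon>"
    using bdist_attained[of \<Omega> w] x(1) w(2) by (metis empty_iff)
  note segw = seg[OF w(1)]
  have J0: "0 < J" using J by simp
  have s32: "s / (32 * J) \<le> s / 32" using J s(1) by (intro divide_left_mono) auto
  \<comment> \<open>Both ends have depth at least \<open>s\<close> and \<open>w\<close> has depth
    below \<open>\<epsilon>\<close>, so \<open>w\<close> is far from both; this keeps the height of
    \<open>V\<close>, which is within \<open>s / 4\<close> of \<open>w\<close>, strictly between
    \<open>a\<close> and \<open>t\<close>.\<close>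
  have "s \<le> \<epsilon> + dist ?p w" "s \<le> \<epsilon> + dist ?q w"
    using bdist_triangle[of \<Omega> ?p w] bdist_triangle[of \<Omega> ?q w] p(2) q(2) w(2) by auto
  then have high: "a + s / 2 \<le> w \<bullet> e" "w \<bullet> e \<le> t - s / 2"
    using segw dist_axis[of a "w \<bullet> e"] dist_axis[of t "w \<bullet> e"] \<epsilon>(2) s32 s(1) by auto
  have "dist x z < r"
    using dist_triangle[of x z w] segw z(2) \<epsilon>(2) s32 \<open>s \<le> s0\<close> s(1) by simp
  \<comment> \<open>The bounds on \<open>\<epsilon>\<close> and \<open>\<kappa>\<close> are those of
    \<open>small_balls_near_boundary\<close> for the scale \<open>s / 8\<close> and the constant
    \<open>8 * \<kappa>\<close>.\<close>
  moreover have "\<epsilon> \<le> s / 8 / (4 * J)" using \<epsilon>(2) by simp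
  moreover have "s / 8 \<le> r / J" using s(1,5) \<open>s \<le> s0\<close> by linarith
  moreover have "8 * \<kappa> \<le> c / 2" "8 * \<kappa> \<le> 1 / (4 * J)" using \<kappa> J0 by (auto simp: field_simps)
  ultimately obtain V where V: "dist z V < s / 8" "\<And>y. dist V y \<le> 8 * \<kappa> * (s / 8) \<Longrightarrow>
    y \<in> (if \<not> i then connected_component_set (deep \<Omega> \<epsilon> x ((J + 2) * r)) Y else interior (- \<Omega>)) \<and>
    8 * \<kappa> * (s / 8) \<le> bdist \<Omega> y"
    using small_balls_near_boundary[OF x Y z(1), of "s / 8" \<epsilon> "8 * \<kappa>" "\<not> i"] s(1) by auto
  have wV: "dist V w < s / 4"
    using dist_triangle[of V w z] V(1) z(2) \<epsilon>(2) s32 s(1) by (simp add: dist_commute)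
  have coord: "\<bar>(V - w) \<bullet> b\<bar> < s / 4" if "norm b = 1" for b
    using Cauchy_Schwarz_ineq2[of "V - w" b] wV that by (simp add: dist_norm)
  have "u b \<le> V \<bullet> b \<and> V \<bullet> b < u b + s" if b: "b \<in> B" for b
  proof -
    have "w \<bullet> b = u b + s / 2" using segw axis_point_inner(1)[OF b] by (metis v_def)
    then show ?thesis using coord[OF norm_B[OF b]] s(1) unfolding inner_diff_left by linarith
  qed
  moreover have "a < V \<bullet> e" "V \<bullet> e < t"
    using coord[OF norm_e] high s(1) unfolding inner_diff_left by linarith+
  moreover have "y \<in> G (\<not> i) \<and> \<kappa> * s \<le> bdist \<Omega> y" if "dist V y \<le> \<kappa> * s" for y
    using V(2)[of y] that by (cases i) (simp_all add: G D)
  ultimately show ?thesis by blast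
qed


text \<open>The constants are chosen so that, were \<open>X\<close> not connected to the John centre, the \<open>M\<close>-fold
  subdivision would produce more separated boundary points than Ahlfors--David regularity allows.\<close>

lemma connected_to_john_centre:
  assumes "1 \<le> n" and dim: "DIM('a) = n + 1" and D: "1 \<le> D" and c1: "0 < c1"
    and reg: "\<And>x r. x \<in> frontier \<Omega> \<Longrightarrow> 0 < r \<Longrightarrow> ennreal r < ediam (frontier \<Omega>) \<Longrightarrow>
        ennreal (r ^ n / D) \<le> hausdorff_measure n (ball x r \<inter> frontier \<Omega>) \<and>
        hausdorff_measure n (ball x r \<inter> frontier \<Omega>) \<le> ennreal (D * r ^ n)"
  shows "\<exists>\<epsilon>>0. \<forall>x r Y X. x \<in> frontier \<Omega> \<longrightarrow> 0 < r \<longrightarrow> ennreal r < ediam (frontier \<Omega>) \<longrightarrow>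
    john_centre x r Y \<longrightarrow> ball X (c1 * r) \<subseteq> ball x r \<inter> \<Omega> \<longrightarrow>
    connected_component (deep \<Omega> (\<epsilon> * r) x ((J + 2) * r)) X Y"
proof -
  \<comment> \<open>\<open>c2 * r\<close> will be the radius of a ball about \<open>X\<close> and of
    one about the exterior point \<open>X'\<close>; the bound \<open>1 / J\<close> keeps the tube
    thin compared with \<open>r / J\<close>.\<close>
  define c2 where "c2 = min (min c c1) (1 / J)"
  \<comment> \<open>A tube of side \<open>\<sigma> * r\<close> then stays within
    \<open>c2 * r / 8\<close> of its axis, by the bound through the sum of \<open>n\<close>
    coordinates, so its two ends fit well inside those balls.\<close>
  define \<sigma> where "\<sigma> = c2 / (4 * real n)"
  define \<kappa> where "\<kappa> = min (c / 16) (1 / (32 * J))"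
  define N where "N = nat \<lceil>real n / \<kappa>\<rceil>"
  have J0: "0 < J" using J by simp
  have c2: "0 < c2" "c2 \<le> c" "c2 \<le> c1" "c2 \<le> 1 / J" using c c1 J0 by (auto simp: c2_def)
  have \<sigma>: "0 < \<sigma>" "real n * \<sigma> = c2 / 4" using c2 \<open>1 \<le> n\<close> by (auto simp: \<sigma>_def)
  have "1 * \<sigma> \<le> real n * \<sigma>" using \<open>1 \<le> n\<close> \<sigma>(1) by (intro mult_right_mono) auto
  then have \<sigma>_le: "\<sigma> \<le> c2 / 4" using \<sigma>(2) by simp
  have \<kappa>: "0 < \<kappa>" "\<kappa> \<le> c / 16" "\<kappa> \<le> 1 / (32 * J)" using c J0 by (auto simp: \<kappa>_def)
  have "0 < real n / \<kappa>" using \<kappa> \<open>1 \<le> n\<close> by simp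
  then have N1: "1 \<le> N" by (simp add: N_def Suc_le_eq)
  have "real n / \<kappa> \<le> real N" unfolding N_def by (rule real_nat_ceiling_ge)
  then have N2: "real n \<le> \<kappa> * real N" using \<kappa>(1) by (simp add: field_simps)
  \<comment> \<open>Packing allows
    \<open>2 * D\<^sup>2 * (3 / \<sigma>) ^ n * real N ^ (M * n)\<close> points; times the
    \<open>N ^ n\<close> of the counting lemma this is \<open>Q * real N ^ (M * n)\<close>, so any
    \<open>M\<close> above \<open>Q\<close> gives a contradiction.\<close>
  define Q where "Q = 2 * D\<^sup>2 * (3 / \<sigma>) ^ n * real N ^ n"
  obtain M :: nat where M: "Q < real M" using reals_Archimedean2 by blast
  \<comment> \<open>After \<open>M\<close> subdivisions the tubes have side
    \<open>\<sigma> * r / real N ^ M\<close>, and \<open>passage_ball\<close> requires a depth of at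
    most \<open>1 / (32 * J)\<close> times the side.\<close>
  define \<epsilon> where "\<epsilon> = \<sigma> / (real N ^ M * (32 * J))"
  have \<epsilon>: "0 < \<epsilon>" using \<sigma>(1) N1 J0 by (simp add: \<epsilon>_def)
  have "connected_component (deep \<Omega> (\<epsilon> * r) x ((J + 2) * r)) X Y"
    if x: "x \<in> frontier \<Omega>" "0 < r" "ennreal r < ediam (frontier \<Omega>)"
      and Y: "john_centre x r Y" and X: "ball X (c1 * r) \<subseteq> ball x r \<inter> \<Omega>" for x r Y X
  proof (rule ccontr)
    let ?D = "deep \<Omega> (\<epsilon> * r) x ((J + 2) * r)"
    assume nc: "\<not> connected_component ?D X Y"
    obtain X' where X': "ball X' (c * r) \<subseteq> ball x r \<inter> interior (- \<Omega>)" using corkscrew[OF x] by blast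
    define \<rho> where "\<rho> = c2 * r"
    define s0 where "s0 = \<sigma> * r"
    define h where "h = s0 / real N ^ M"
    have \<rho>: "0 < \<rho>" "ball X \<rho> \<subseteq> ball x r \<inter> \<Omega>" "ball X' \<rho> \<subseteq> ball x r \<inter> interior (- \<Omega>)"
    proof -
      show "0 < \<rho>" using c2 x(2) by (simp add: \<rho>_def)
      have "\<rho> \<le> c1 * r" "\<rho> \<le> c * r" using c2 x(2) by (auto simp: \<rho>_def intro!: mult_right_mono)
      then show "ball X \<rho> \<subseteq> ball x r \<inter> \<Omega>" "ball X' \<rho> \<subseteq> ball x r \<inter> interior (- \<Omega>)"
        using X X' subset_ball by (meson order_trans)+
    qed
    have s0: "0 < s0" "real n * s0 = \<rho> / 4" "s0 \<le> \<rho> / 4" "s0 \<le> r / J"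
    proof -
      show "0 < s0" using \<sigma> x(2) by (simp add: s0_def)
      show "real n * s0 = \<rho> / 4" using \<sigma>(2) by (simp add: s0_def \<rho>_def flip: mult.assoc)
      show le: "s0 \<le> \<rho> / 4" using mult_right_mono[OF \<sigma>_le, of r] x(2) by (simp add: s0_def \<rho>_def)
      have "\<rho> \<le> r / J" using mult_right_mono[OF c2(4), of r] x(2) by (simp add: \<rho>_def)
      then show "s0 \<le> r / J" using le \<rho>(1) by linarith
    qed
    have NM: "1 \<le> real N ^ M" using N1 by (intro one_le_power) simp
    have h: "0 < h" "h \<le> s0" "real N ^ M * h = s0"
    proof -
      have "0 < real N ^ M" using NM by linarith
      then show "0 < h" "real N ^ M * h = s0" using s0(1) by (simp_all add: h_def)
      show "h \<le> s0" using divide_left_mono[OF NM, of s0] s0(1) \<open>0 < real N ^ M\<close> by (simp add: h_def)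
    qed
    have \<epsilon>r: "0 < \<epsilon> * r" "\<epsilon> * r = h / (32 * J)"
      using \<epsilon> x(2) by (simp, simp add: \<epsilon>_def h_def s0_def)
    have \<epsilon>r_le: "\<epsilon> * r \<le> s / (32 * J)" if "h \<le> s" for s
      unfolding \<epsilon>r(2) using that J0 by (intro divide_right_mono) auto
    have "s0 / (32 * J) \<le> s0 / 1" using s0(1) J by (intro divide_left_mono) auto
    then have "\<epsilon> * r \<le> s0" using \<epsilon>r_le[OF h(2)] by simp
    have XO: "X \<in> \<Omega>" using \<rho>(1,2) by auto
    have X'O: "X' \<in> interior (- \<Omega>)" using \<rho>(1,3) by auto
    have "X \<noteq> X'" using XO X'O interior_subset by blast
    define l where "l = norm (X' - X)"
    define e where "e = (X' - X) /\<^sub>R l"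
    have l: "0 < l" "X' = X + l *\<^sub>R e" using \<open>X \<noteq> X'\<close> by (auto simp: l_def e_def)
    have "norm e = 1" using \<open>X \<noteq> X'\<close> by (simp add: e_def l_def)
    then obtain B where "orthonormal_frame B e n" using orthonormal_frame_exists dim by blast
    then interpret orthonormal_frame B e n .
    define u0 where "u0 = (\<lambda>b. X \<bullet> b - s0 / 2)"
    define a where "a = X \<bullet> e"
    define t0 where "t0 = X' \<bullet> e"
    have ee: "e \<bullet> e = 1" using norm_e by (simp add: norm_eq_1)
    have at: "t0 = a + l" by (simp add: t0_def a_def l(2) inner_add_left ee)
    have near: "dist (X + k *\<^sub>R e) y \<le> \<rho> / 8" if y: "y \<in> tube B u0 s0" and k: "y \<bullet> e = a + k" for y k
    proof -
      have "norm (X + k *\<^sub>R e - y) \<le> real n * (s0 / 2)"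
      proof (rule norm_le_if_coords_le)
        fix b assume b: "b \<in> B"
        have "X \<bullet> b - s0 / 2 \<le> y \<bullet> b" "y \<bullet> b \<le> X \<bullet> b - s0 / 2 + s0"
          using y b by (auto simp: tube_def u0_def)
        moreover have "(X + k *\<^sub>R e - y) \<bullet> b = X \<bullet> b - y \<bullet> b"
          using orth_e[OF b] by (simp add: inner_add_left inner_diff_left inner_commute[of e b])
        ultimately show "\<bar>(X + k *\<^sub>R e - y) \<bullet> b\<bar> \<le> s0 / 2" by linarith
      qed (use k ee in \<open>simp add: inner_add_left inner_diff_left a_def\<close>)
      also have "\<dots> = real n * s0 / 2" by simp
      also have "\<dots> = \<rho> / 8" unfolding s0(2) by simp
      finally show ?thesis by (simp add: dist_norm)
    qed
    have cXX': "dist x X \<le> r - \<rho>" "dist x X' \<le> r - \<rho>"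
      using \<rho> unfolding Int_subset_iff le_inf_iff ball_subset_ball_iff by (auto simp: dist_commute)
    have region: "dist x y < r - s0" if y: "y \<in> tube B u0 s0" "a \<le> y \<bullet> e" "y \<bullet> e \<le> t0" for y
    proof -
      define k where "k = y \<bullet> e - a"
      have k: "0 \<le> k" "k \<le> l" using y at by (auto simp: k_def)
      have "X + k *\<^sub>R e = (1 - k / l) *\<^sub>R X + (k / l) *\<^sub>R X'"
        using l(1) by (simp add: l(2) algebra_simps)
      also have "\<dots> \<in> cball x (r - \<rho>)"
        using k l(1) cXX' by (intro convexD[OF convex_cball]) auto
      finally have "dist x (X + k *\<^sub>R e) \<le> r - \<rho>" by simp
      moreover have "dist (X + k *\<^sub>R e) y \<le> \<rho> / 8" by (rule near) (use y in \<open>auto simp: k_def\<close>)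
      ultimately show ?thesis
        using dist_triangle[of x y "X + k *\<^sub>R e"] s0(3) \<rho>(1) by linarith
    qed
    have inball: "s0 \<le> bdist \<Omega> y" if "dist Z y \<le> \<rho> / 8" "ball Z \<rho> \<subseteq> S" "S \<inter> frontier \<Omega> = {}" for Z y S
    proof (rule bdist_ge_if_ball_subset_interior[OF _ that(3)])
      show "ball y s0 \<subseteq> S"
      proof
        fix w assume "w \<in> ball y s0"
        then have "dist Z w < \<rho>" using dist_triangle[of Z w y] that(1) s0(3) \<rho>(1) by simp
        then show "w \<in> S" using that(2) by auto
      qed
    qed (use x in auto)
    have \<Omega>F: "\<Omega> \<inter> frontier \<Omega> = {}" using frontier_not_mem by blast
    let ?A = "connected_component_set ?D X"
    define G where "G = (\<lambda>i. if i then connected_component_set ?D Y else interior (- \<Omega>))"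
    have "cball X (\<rho> / 8) \<subseteq> ?D"
    proof
      fix y assume y: "y \<in> cball X (\<rho> / 8)"
      have "s0 \<le> bdist \<Omega> y" using inball[of X y \<Omega>] y \<rho>(2) \<Omega>F by auto
      moreover have "y \<in> ball X \<rho>" using y \<rho>(1) by auto
      then have "y \<in> \<Omega>" "dist x y < r" using \<rho>(2) by auto
      moreover have "r \<le> (J + 2) * r" using J x(2) by (simp add: mult_le_cancel_right1)
      ultimately show "y \<in> ?D" using \<open>\<epsilon> * r \<le> s0\<close> by (simp add: deep_def)
    qed
    then have A: "y \<in> ?A" if "dist X y \<le> \<rho> / 8" for y
      using that \<rho>(1) unfolding mem_Collect_eq connected_component_def
      by (intro exI[of _ "cball X (\<rho> / 8)"]) auto
    have flag_a: "flag (bdist \<Omega>) B e u0 s0 a ?A"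
      unfolding flag_def
    proof (intro ballI impI)
      fix y assume "y \<in> tube B u0 s0" "y \<bullet> e = a"
      then have y: "dist X y \<le> \<rho> / 8" using near[of y 0] by simp
      then show "y \<in> ?A \<and> s0 \<le> bdist \<Omega> y" using A inball[of X y \<Omega>] \<rho>(2) \<Omega>F by auto
    qed
    have flag_t: "flag (bdist \<Omega>) B e u0 s0 t0 (G False)"
      unfolding flag_def
    proof (intro ballI impI)
      fix y assume "y \<in> tube B u0 s0" "y \<bullet> e = t0"
      then have y: "dist X' y \<le> \<rho> / 8" using near[of y l] at l(2) by simp
      then have "y \<in> ball X' \<rho>" using \<rho>(1) by simp
      then have "y \<in> interior (- \<Omega>)" using \<rho>(3) by blast
      then show "y \<in> G False \<and> s0 \<le> bdist \<Omega> y"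
        using inball[of X' y "interior (- \<Omega>)"] y \<rho>(3) exterior_disjoint_frontier by (auto simp: G_def)
    qed
    have JC: "john_corkscrew \<Omega> c J" by unfold_locales
    have cross: "closed_segment y z \<inter> frontier \<Omega> \<noteq> {}" if yz: "y \<in> G i" "z \<in> G (\<not> i)" for i y z
    proof (rule connected_Int_frontier)
      have "w \<in> \<Omega>" if "w \<in> G True" for w
        using that connected_component_in[of ?D Y w] by (auto simp: deep_def G_def)
      moreover have "w \<notin> \<Omega>" if "w \<in> G False" for w using that interior_subset by (auto simp: G_def)
      ultimately have "y \<in> \<Omega> \<and> z \<notin> \<Omega> \<or> z \<in> \<Omega> \<and> y \<notin> \<Omega>" using yz by (cases i) auto
      then show "closed_segment y z \<inter> \<Omega> \<noteq> {}" "closed_segment y z - \<Omega> \<noteq> {}" by auto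
    qed simp
    have "\<exists>P. finite P \<and> separated h P \<and> P \<subseteq> tube B u0 (real N ^ M * h - h) \<inter> frontier \<Omega> \<and>
      (\<forall>p\<in>P. a < p \<bullet> e \<and> p \<bullet> e < t0) \<and> M * N ^ (M * n) \<le> card P * N ^ n"
    proof (rule many_crossing_points[where A = ?A and G = G and i = False and \<kappa> = \<kappa> and \<delta> = "bdist \<Omega>"
          and ?u0.0 = u0 and ?s0.0 = s0 and ?t0.0 = t0])
      show "bdist \<Omega> y = 0" if "y \<in> frontier \<Omega>" for y
        using bdist_le[OF that, of y] bdist_nonneg[of \<Omega> y] by simp
      show "bdist \<Omega> y \<le> bdist \<Omega> z + dist y z" for y z by (rule bdist_triangle)
      fix u s t i
      assume h': "h \<le> s" and *: "tube B u s \<subseteq> tube B u0 s0" "a < t" "t \<le> t0"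
        "flag (bdist \<Omega>) B e u s a ?A" "flag (bdist \<Omega>) B e u s t (G i)"
      have "0 < s" using h' h(1) by simp
      show "\<exists>V. a < V \<bullet> e \<and> V \<bullet> e < t \<and> (\<forall>b\<in>B. u b \<le> V \<bullet> b \<and> V \<bullet> b < u b + s) \<and>
        (\<forall>y. dist V y \<le> \<kappa> * s \<longrightarrow> y \<in> G (\<not> i) \<and> \<kappa> * s \<le> bdist \<Omega> y)"
        by (rule passage_ball[OF JC \<open>1 \<le> n\<close> x Y region \<open>0 < s\<close> *(1-3) s0(4) \<epsilon>r(1) \<epsilon>r_le[OF h']
              \<kappa>(2,3) refl nc G_def *(4,5)])
    qed (use h N1 N2 \<kappa> \<open>1 \<le> n\<close> at l(1) flag_a flag_t cross in auto)
    then obtain P where P: "finite P" "separated h P" "P \<subseteq> tube B u0 (s0 - h) \<inter> frontier \<Omega>"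
      "\<forall>p\<in>P. a < p \<bullet> e \<and> p \<bullet> e < t0" "M * N ^ (M * n) \<le> card P * N ^ n" unfolding h(3) by blast
    have "real (card P) \<le> 2 * D\<^sup>2 * (3 * r / h) ^ n"
    proof (rule ahlfors_david_packing[OF D reg x h(1) _ P(1)])
      have "r / J \<le> r" using J x(2) by (simp add: divide_le_eq mult_le_cancel_left1)
      then show "h \<le> r" using h(2) s0(4) by simp
      show "P \<subseteq> frontier \<Omega> \<inter> ball x (r - h)"
      proof
        fix p assume p: "p \<in> P"
        have "p \<in> tube B u0 s0" using P(3) p tube_mono[of "s0 - h" s0] h(1) by auto
        then have "dist x p < r - s0" using region P(4) p by (meson less_imp_le)
        then show "p \<in> frontier \<Omega> \<inter> ball x (r - h)" using P(3) p h(2) by auto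
      qed
      show "h \<le> dist p q" if "p \<in> P" "q \<in> P" "p \<noteq> q" for p q
        using P(2) that by (simp add: separated_def)
    qed
    also have "3 * r / h = 3 / \<sigma> * real N ^ M"
      using x(2) \<sigma>(1) N1 by (simp add: h_def s0_def field_simps)
    also have "2 * D\<^sup>2 * (3 / \<sigma> * real N ^ M) ^ n = 2 * D\<^sup>2 * (3 / \<sigma>) ^ n * real N ^ (M * n)"
      by (simp only: power_mult_distrib power_mult mult.assoc)
    finally have "real (card P) * real N ^ n \<le> 2 * D\<^sup>2 * (3 / \<sigma>) ^ n * real N ^ (M * n) * real N ^ n"
      by (rule mult_right_mono) simp
    also have "\<dots> = Q * real N ^ (M * n)" by (simp add: Q_def)
    also have "\<dots> < real M * real N ^ (M * n)" using M N1 by (intro mult_strict_right_mono) auto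
    finally have "real (card P * N ^ n) < real (M * N ^ (M * n))" by simp
    then show False using P(5) by linarith
  qed
  then show ?thesis using \<epsilon> by blast
qed

end

section \<open>From local John to Harnack chains\<close>

lemma meets_frontier_if_phases_differ:
  fixes p q :: "'a::euclidean_space"
  assumes "p \<in> \<Omega> \<longleftrightarrow> q \<notin> \<Omega>"
  shows "closed_segment p q \<inter> frontier \<Omega> \<noteq> {}"
proof (rule connected_Int_frontier)
  show "closed_segment p q \<inter> \<Omega> \<noteq> {}" "closed_segment p q - \<Omega> \<noteq> {}" using assms by auto
qed simp

text \<open>If the lens contained no boundary point, it would lie in one phase and the unbounded region in
  the other, so the boundary would contain two points on opposite sides of the lens at distance
  more than the diameter.\<close>

lemma frontier_point_in_lens:
  fixes \<Omega> :: "'a::euclidean_space set"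
  assumes dim: "2 \<le> DIM('a)" and "0 < c" "0 < \<Delta>"
    and x: "x \<in> frontier \<Omega>" "x' \<in> frontier \<Omega>"
    and diam: "\<And>y z. y \<in> frontier \<Omega> \<Longrightarrow> z \<in> frontier \<Omega> \<Longrightarrow> dist y z \<le> \<Delta>"
    and V: "ball V (c * (\<Delta> / 4)) \<subseteq> ball x (\<Delta> / 4) \<inter> \<Omega>"
    and V': "ball V' (c * (\<Delta> / 4)) \<subseteq> ball x (\<Delta> / 4) \<inter> interior (- \<Omega>)"
    and \<eta>: "\<eta> \<le> c / 4" "\<eta> \<le> 1 / 5"
  shows "\<exists>z\<in>frontier \<Omega>. dist z x \<le> (1 - \<eta>) * \<Delta> \<and> dist z x' \<le> (1 - \<eta>) * \<Delta>"
proof (rule ccontr)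
  assume no: "\<not> ?thesis"
  define L where "L = cball x ((1 - \<eta>) * \<Delta>) \<inter> cball x' ((1 - \<eta>) * \<Delta>)"
  have L: "connected L" "L \<inter> frontier \<Omega> = {}"
    using no by (auto simp: L_def dist_commute intro!: convex_connected convex_Int)
  define U where "U = - cball x' \<Delta>"
  have U: "connected U" "U \<inter> frontier \<Omega> = {}"
    using diam[OF x(2)] dim by (auto simp: U_def intro!: connected_complement_bounded_convex)
  have c\<Delta>: "0 < c * (\<Delta> / 4)" "\<eta> * \<Delta> \<le> c * (\<Delta> / 4)" "4 / 5 * \<Delta> \<le> (1 - \<eta>) * \<Delta>"
  proof -
    show "0 < c * (\<Delta> / 4)" using assms by simp
    show "\<eta> * \<Delta> \<le> c * (\<Delta> / 4)" using mult_right_mono[OF \<eta>(1), of \<Delta>] \<open>0 < \<Delta>\<close> by simp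
    have "4 / 5 \<le> 1 - \<eta>" using \<eta> by simp
    then show "4 / 5 * \<Delta> \<le> (1 - \<eta>) * \<Delta>" by (rule mult_right_mono) (use \<open>0 < \<Delta>\<close> in simp)
  qed
  \<comment> \<open>A corkscrew ball that misses \<open>U\<close> stays within
    \<open>\<Delta>\<close> of \<open>x'\<close>, so its centre keeps a distance of
    \<open>c * (\<Delta> / 4)\<close>, at least \<open>\<eta> * \<Delta>\<close>, from the rim and
    lies in the lens.\<close>
  have inL: "W \<in> L" if W: "ball W (c * (\<Delta> / 4)) \<subseteq> ball x (\<Delta> / 4)" "ball W (c * (\<Delta> / 4)) \<inter> U = {}" for W
  proof -
    have "W \<in> ball x (\<Delta> / 4)" using W(1) c\<Delta>(1) by (meson centre_in_ball subsetD)
    then have "dist x W < \<Delta> / 4" by simp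
    then have "dist x W \<le> (1 - \<eta>) * \<Delta>" using c\<Delta>(3) \<open>0 < \<Delta>\<close> by linarith
    moreover have "ball W (c * (\<Delta> / 4)) \<subseteq> cball x' \<Delta>" using W(2) by (auto simp: U_def)
    then have "dist W x' + c * (\<Delta> / 4) \<le> \<Delta>" using c\<Delta>(1) unfolding ball_subset_cball_iff by auto
    then have "dist x' W \<le> (1 - \<eta>) * \<Delta>" using c\<Delta>(2) by (simp add: dist_commute algebra_simps)
    ultimately show ?thesis by (simp add: L_def)
  qed
  \<comment> \<open>Whichever phase fills \<open>U\<close>, the corkscrew ball of the other phase
    misses \<open>U\<close>; its centre then decides the phase of the lens.\<close>
  have phases: "p \<in> \<Omega> \<longleftrightarrow> q \<notin> \<Omega>" if "p \<in> L" "q \<in> U" for p q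
  proof (cases "q \<in> \<Omega>")
    case True
    then have "U \<subseteq> \<Omega>" using subset_if_connected_avoids_frontier[OF U] that by blast
    then have "ball V' (c * (\<Delta> / 4)) \<inter> U = {}" using V' interior_subset by blast
    then have "V' \<in> L" using inL V' by blast
    moreover have "V' \<notin> \<Omega>" using V' c\<Delta>(1) interior_subset by (meson Compl_iff centre_in_ball le_inf_iff subsetD)
    ultimately have "p \<notin> \<Omega>" using subset_if_connected_avoids_frontier[OF L] that by blast
    then show ?thesis using True by blast
  next
    case False
    then have "U \<inter> \<Omega> = {}" using subset_if_connected_avoids_frontier[OF U] that by blast
    then have "ball V (c * (\<Delta> / 4)) \<inter> U = {}" using V by blast
    then have "V \<in> L" using inL V by blast
    moreover have "V \<in> \<Omega>" using V c\<Delta>(1) by (meson centre_in_ball le_inf_iff subsetD)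
    ultimately have "p \<in> \<Omega>" using subset_if_connected_avoids_frontier[OF L] that by blast
    then show ?thesis using False by blast
  qed
  obtain v0 :: 'a where v0: "v0 \<noteq> 0" "orthogonal (x' - x) v0"
    using orthogonal_to_vector_exists[OF dim] by blast
  define v where "v = v0 /\<^sub>R norm v0"
  have v: "norm v = 1" "orthogonal (x' - x) v" using v0 by (auto simp: v_def orthogonal_clauses)
  define m where "m = (1/2) *\<^sub>R (x + x')"
  \<comment> \<open>On the line through the midpoint perpendicular to \<open>x' - x\<close>, the
    point at \<open>3/5 * \<Delta>\<close> is still in the lens because 1/4 + 9/25 < 16/25, and the
    point at \<open>3 * \<Delta>\<close> is in \<open>U\<close>. The boundary points on the two
    sides are then at least \<open>6/5 * \<Delta>\<close> apart.\<close>
  have far: "\<exists>k\<ge>3/5 * \<Delta>. m + (k * s) *\<^sub>R v \<in> frontier \<Omega>" if s: "\<bar>s\<bar> = 1" for s :: real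
  proof -
    let ?p = "m + (3/5 * \<Delta> * s) *\<^sub>R v" and ?q = "m + (3 * \<Delta> * s) *\<^sub>R v"
    have len: "norm ((1/2) *\<^sub>R (x' - x)) \<le> \<Delta> / 2" using diam[OF x] by (simp add: dist_norm norm_minus_commute)
    have pd: "norm (\<sigma> *\<^sub>R (1/2) *\<^sub>R (x' - x) + (3/5 * \<Delta> * s) *\<^sub>R v) \<le> (1 - \<eta>) * \<Delta>" if "\<bar>\<sigma>\<bar> = 1" for \<sigma> :: real
    proof -
      have "orthogonal (\<sigma> *\<^sub>R (1/2) *\<^sub>R (x' - x)) ((3/5 * \<Delta> * s) *\<^sub>R v)"
        using v(2) by (simp add: orthogonal_clauses)
      then have "(norm (\<sigma> *\<^sub>R (1/2) *\<^sub>R (x' - x) + (3/5 * \<Delta> * s) *\<^sub>R v))\<^sup>2 =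
          (norm (\<sigma> *\<^sub>R (1/2) *\<^sub>R (x' - x)))\<^sup>2 + (norm ((3/5 * \<Delta> * s) *\<^sub>R v))\<^sup>2"
        by (rule norm_add_Pythagorean)
      also have "\<dots> \<le> (\<Delta> / 2)\<^sup>2 + (3/5 * \<Delta>)\<^sup>2"
        using len that s v(1) \<open>0 < \<Delta>\<close> by (intro add_mono power_mono) (auto simp: abs_mult)
      also have "\<dots> \<le> (4 / 5 * \<Delta>)\<^sup>2" by (simp add: power2_eq_square)
      finally have "norm (\<sigma> *\<^sub>R (1/2) *\<^sub>R (x' - x) + (3/5 * \<Delta> * s) *\<^sub>R v) \<le> 4 / 5 * \<Delta>"
        by (rule power2_le_imp_le) (use \<open>0 < \<Delta>\<close> in simp)
      then show ?thesis using c\<Delta>(3) by simp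
    qed
    have mx: "m - x = 1 *\<^sub>R (1/2) *\<^sub>R (x' - x)" "m - x' = (-1) *\<^sub>R (1/2) *\<^sub>R (x' - x)"
      by (simp_all add: m_def algebra_simps flip: scaleR_add_left)
    have "?p \<in> L"
    proof -
      have "?p - x = (m - x) + (3/5 * \<Delta> * s) *\<^sub>R v" "?p - x' = (m - x') + (3/5 * \<Delta> * s) *\<^sub>R v" by auto
      then have eq: "?p - x = 1 *\<^sub>R (1/2) *\<^sub>R (x' - x) + (3/5 * \<Delta> * s) *\<^sub>R v"
          "?p - x' = (-1) *\<^sub>R (1/2) *\<^sub>R (x' - x) + (3/5 * \<Delta> * s) *\<^sub>R v"
        unfolding mx .
      have "norm (?p - x) \<le> (1 - \<eta>) * \<Delta>" "norm (?p - x') \<le> (1 - \<eta>) * \<Delta>"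
        unfolding eq by (rule pd; simp)+
      then show ?thesis by (simp add: L_def dist_norm norm_minus_commute)
    qed
    moreover have "?q \<in> U"
    proof -
      have "norm ((3 * \<Delta> * s) *\<^sub>R v) \<le> norm (?q - x') + norm (m - x')"
        using norm_triangle_ineq4[of "?q - x'" "m - x'"] by simp
      moreover have "norm ((3 * \<Delta> * s) *\<^sub>R v) = 3 * \<Delta>" using s v(1) \<open>0 < \<Delta>\<close> by (simp add: abs_mult)
      moreover have "norm (m - x') \<le> \<Delta> / 2" using len unfolding mx by simp
      ultimately have "\<Delta> < norm (?q - x')" using \<open>0 < \<Delta>\<close> by simp
      then show ?thesis by (simp add: U_def dist_norm norm_minus_commute)
    qed
    ultimately obtain z where z: "z \<in> closed_segment ?p ?q" "z \<in> frontier \<Omega>"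
      using meets_frontier_if_phases_differ[OF phases] by blast
    obtain u where u: "0 \<le> u" "u \<le> 1" "z = (1 - u) *\<^sub>R ?p + u *\<^sub>R ?q"
      using z(1) by (auto simp: in_segment)
    define k where "k = 3/5 * \<Delta> + u * (12/5 * \<Delta>)"
    have comb: "(1 - u) *\<^sub>R (m + A *\<^sub>R v) + u *\<^sub>R (m + A' *\<^sub>R v) = m + ((1 - u) * A + u * A') *\<^sub>R v" for A A'
      by (simp add: algebra_simps)
    have "(1 - u) * (3/5 * \<Delta> * s) + u * (3 * \<Delta> * s) = k * s" by (simp add: k_def field_simps)
    then have "z = m + (k * s) *\<^sub>R v" unfolding u(3) comb by simp
    moreover have "3/5 * \<Delta> \<le> k" using u(1) \<open>0 < \<Delta>\<close> by (simp add: k_def)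
    ultimately show ?thesis using z(2) by blast
  qed
  obtain k where k: "3/5 * \<Delta> \<le> k" "m + (k * 1) *\<^sub>R v \<in> frontier \<Omega>" using far[of 1] by auto
  obtain k' where k': "3/5 * \<Delta> \<le> k'" "m + (k' * (-1)) *\<^sub>R v \<in> frontier \<Omega>" using far[of "-1"] by auto
  have "dist (m + (k * 1) *\<^sub>R v) (m + (k' * (-1)) *\<^sub>R v) = norm ((k + k') *\<^sub>R v)"
    by (simp add: dist_norm scaleR_add_left)
  also have "\<dots> = \<bar>k + k'\<bar>" using v(1) by simp
  finally show False using diam[OF k(2) k'(2)] k(1) k'(1) \<open>0 < \<Delta>\<close> by simp
qed

text \<open>On the segment to a nearest boundary point the depth equals the distance to that point,
  so it falls only to \<open>\<tau>\<close>. This carries points that may be far out into a John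
  ball whose radius has to stay below the diameter of the boundary.\<close>

lemma connected_component_towards_frontier:
  fixes \<Omega> :: "'a::euclidean_space set"
  assumes X: "X \<in> \<Omega>" "x \<in> frontier \<Omega>" "bdist \<Omega> X = dist X x" and \<tau>: "0 < \<tau>" "\<tau> \<le> bdist \<Omega> X"
    and R: "dist z x + bdist \<Omega> X \<le> R"
  shows "\<exists>X'. dist X' x = \<tau> \<and> ball X' \<tau> \<subseteq> \<Omega> \<and> connected_component (deep \<Omega> \<tau> z R) X X'"
proof -
  define d where "d = bdist \<Omega> X"
  have d: "0 < d" "\<tau> \<le> d" "dist X x = d" using assms by (auto simp: d_def)
  define X' where "X' = x + (\<tau> / d) *\<^sub>R (X - x)"
  have n: "norm (X - x) = d" using d(3) by (simp add: dist_norm)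
  have seg: "y \<in> deep \<Omega> \<tau> z R" if y: "y \<in> closed_segment X X'" for y
  proof -
    obtain u where u: "0 \<le> u" "u \<le> 1" "y = (1 - u) *\<^sub>R X + u *\<^sub>R X'"
      using y by (auto simp: in_segment)
    define k where "k = 1 - u + u * (\<tau> / d)"
    have yk: "y = x + k *\<^sub>R (X - x)" unfolding u(3) X'_def k_def by (simp add: algebra_simps)
    have k: "\<tau> / d \<le> k" "k \<le> 1" "0 < k"
    proof -
      have le1: "0 < \<tau> / d" "\<tau> / d \<le> 1" using d \<tau> by auto
      have "k = (1 - u) *\<^sub>R 1 + u *\<^sub>R (\<tau> / d)" by (simp add: k_def)
      also have "\<dots> \<in> {\<tau> / d..1}" using u le1 by (intro convexD) auto
      finally show "\<tau> / d \<le> k" "k \<le> 1" by auto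
      then show "0 < k" using le1 by linarith
    qed
    have yx: "dist y x = k * d" using k n by (simp add: yk dist_norm)
    have "X - y = (1 - k) *\<^sub>R (X - x)" by (simp add: yk algebra_simps)
    then have Xy: "dist X y = (1 - k) * d" using k n by (simp add: dist_norm)
    have "\<tau> \<le> k * d" using k(1) d(1) by (simp add: field_simps)
    then have "\<tau> \<le> bdist \<Omega> y" using bdist_triangle[of \<Omega> X y] Xy by (simp add: d_def[symmetric] algebra_simps)
    moreover have "y \<in> ball X d" using Xy mult_pos_pos[OF k(3) d(1)] by (simp add: algebra_simps)
    then have "y \<in> \<Omega>" using ball_bdist_subset[OF X(1), of d] by (auto simp: d_def)
    moreover have "k * d \<le> d" using k d(1) by (simp add: mult_le_cancel_right1)
    then have "dist z y \<le> R" using dist_triangle[of z y x] R yx by (simp add: d_def dist_commute)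
    ultimately show ?thesis by (simp add: deep_def)
  qed
  then have con: "connected_component (deep \<Omega> \<tau> z R) X X'"
    unfolding connected_component_def by (intro exI[of _ "closed_segment X X'"]) auto
  have "X' \<in> deep \<Omega> \<tau> z R" using seg by simp
  then have "ball X' \<tau> \<subseteq> \<Omega>" by (intro ball_bdist_subset) (auto simp: deep_def)
  moreover have "dist X' x = \<tau>" using \<tau> d(1) n by (simp add: X'_def dist_norm)
  ultimately show ?thesis using con by blast
qed

lemma ediam_not_greater_imp:
  assumes "\<not> ennreal R < ediam F" "x \<in> F"
  obtains \<Delta> where "0 \<le> \<Delta>" "\<Delta> \<le> max R 0" "ediam F = ennreal \<Delta>" "\<And>y z. y \<in> F \<Longrightarrow> z \<in> F \<Longrightarrow> dist y z \<le> \<Delta>"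
proof -
  have le: "ediam F \<le> ennreal R" using assms(1) by simp
  then have fin: "ediam F = ennreal (enn2real (ediam F))"
    by (metis ennreal_enn2real ennreal_less_top order_le_less_trans)
  show thesis
  proof
    show "0 \<le> enn2real (ediam F)" by simp
    show "enn2real (ediam F) \<le> max R 0"
      using enn2real_mono[OF le] by (cases "0 \<le> R") (auto simp: ennreal_neg)
    show "ediam F = ennreal (enn2real (ediam F))" by (rule fin)
    show "dist y z \<le> enn2real (ediam F)" if "y \<in> F" "z \<in> F" for y z
    proof -
      have "ennreal (dist y z) \<le> ennreal (enn2real (ediam F))" using dist_le_ediam[OF that] fin by simp
      then show ?thesis by (subst (asm) ennreal_le_iff) auto
    qed
  qed
qed

context john_corkscrew
begin

text \<open>John centres exist only at radii below the diameter of the boundary, so points at a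
  scale comparable to the diameter or beyond need separate arguments: the lens if
  \<open>\<rho>\<close> is below ten diameters, an annulus around the whole boundary
  otherwise.\<close>

lemma connected_deep_if_john_corkscrew:
  assumes "1 \<le> n" and dim: "DIM('a) = n + 1" and D: "1 \<le> D"
    and reg: "\<And>x r. x \<in> frontier \<Omega> \<Longrightarrow> 0 < r \<Longrightarrow> ennreal r < ediam (frontier \<Omega>) \<Longrightarrow>
        ennreal (r ^ n / D) \<le> hausdorff_measure n (ball x r \<inter> frontier \<Omega>) \<and>
        hausdorff_measure n (ball x r \<inter> frontier \<Omega>) \<le> ennreal (D * r ^ n)"
    and \<Lambda>: "1 \<le> \<Lambda>"
  shows "\<exists>t>0. \<forall>\<rho> X X'. 0 < \<rho> \<longrightarrow> X \<in> \<Omega> \<longrightarrow> X' \<in> \<Omega> \<longrightarrow> \<rho> \<le> bdist \<Omega> X \<longrightarrow> \<rho> \<le> bdist \<Omega> X' \<longrightarrow>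
    dist X X' < \<Lambda> * \<rho> \<longrightarrow>
    (\<exists>x R \<epsilon>. 0 < R \<and> t * R \<le> \<epsilon> \<and> connected_component (deep \<Omega> \<epsilon> x R) X X')"
proof -
  define \<eta> where "\<eta> = min (c / 4) (1 / 5)"
  have \<eta>: "0 < \<eta>" "\<eta> \<le> c / 4" "\<eta> \<le> 1 / 5" using c by (auto simp: \<eta>_def)
  \<comment> \<open>Serves two scales: \<open>c1 * R \<le> \<rho>\<close> for
    \<open>R = 20 * (\<Lambda> * \<rho>)\<close>, and
    \<open>c1 * \<Delta> \<le> \<eta> * \<Delta> / 160\<close>, well below the margin
    \<open>\<eta> * \<Delta> / 2\<close> of the lens case.\<close>
  define c1 where "c1 = \<eta> / (160 * \<Lambda>)"
  have c1: "0 < c1" "c1 \<le> 1 / (20 * \<Lambda>)" using \<eta> \<Lambda> by (auto simp: c1_def field_simps)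
  have c1_small: "c1 \<le> \<eta> / 160" unfolding c1_def by (rule divide_left_mono) (use \<eta>(1) \<Lambda> in auto)
  obtain \<epsilon>1 where \<epsilon>1: "0 < \<epsilon>1" "\<forall>x r Y X. x \<in> frontier \<Omega> \<longrightarrow> 0 < r \<longrightarrow> ennreal r < ediam (frontier \<Omega>) \<longrightarrow>
    john_centre x r Y \<longrightarrow> ball X (c1 * r) \<subseteq> ball x r \<inter> \<Omega> \<longrightarrow>
    connected_component (deep \<Omega> (\<epsilon>1 * r) x ((J + 2) * r)) X Y"
    using connected_to_john_centre[OF assms(1-3) c1(1) reg] by blast
  \<comment> \<open>In the lens case the depths are below \<open>5 * (\<Lambda> * \<rho>)\<close>,
    hence below \<open>50 * (\<Lambda> * \<Delta>)\<close>, and the nearest boundary points are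
    within \<open>\<Delta>\<close> of \<open>z\<close>; the summand \<open>60 * \<Lambda>\<close>
    covers both.\<close>
  define K where "K = J + 2 + 60 * \<Lambda>"
  have K: "0 < K" using J \<Lambda> by (simp add: K_def)
  \<comment> \<open>The least of the ratios of depth to radius that occur: in the annulus, in a John
    ball of radius \<open>R\<close>, and in the lens case.\<close>
  define t where "t = min (min (1 / (10 * \<Lambda>)) (\<epsilon>1 / (J + 2))) (min (\<epsilon>1 / 2) c1 / K)"
  have t: "0 < t" "t \<le> 1 / (10 * \<Lambda>)" "t \<le> \<epsilon>1 / (J + 2)" "t \<le> min (\<epsilon>1 / 2) c1 / K"
    using \<Lambda> \<epsilon>1 J K c1 by (auto simp: t_def)
  have "\<exists>x R \<epsilon>. 0 < R \<and> t * R \<le> \<epsilon> \<and> connected_component (deep \<Omega> \<epsilon> x R) X X'"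
    if \<rho>: "0 < \<rho>" "X \<in> \<Omega>" "X' \<in> \<Omega>" "\<rho> \<le> bdist \<Omega> X" "\<rho> \<le> bdist \<Omega> X'" "dist X X' < \<Lambda> * \<rho>" for \<rho> X X'
  proof (cases "4 * dist X X' \<le> bdist \<Omega> X")
    case True
    define d where "d = bdist \<Omega> X"
    have d: "0 < d" using \<rho> by (simp add: d_def)
    have "cball X (d / 4) \<subseteq> deep \<Omega> (3 / 4 * d) X (d / 4)"
    proof
      fix y assume y: "y \<in> cball X (d / 4)"
      then have "y \<in> \<Omega>" using ball_bdist_subset[OF \<rho>(2), of d] d by (auto simp: d_def)
      then show "y \<in> deep \<Omega> (3 / 4 * d) X (d / 4)"
        using bdist_triangle[of \<Omega> X y] y by (auto simp: deep_def d_def)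
    qed
    then have "connected_component (deep \<Omega> (3 / 4 * d) X (d / 4)) X X'"
      unfolding connected_component_def using True d
      by (intro exI[of _ "cball X (d / 4)"]) (auto simp: d_def)
    moreover have "t * (d / 4) \<le> 3 / 4 * d"
    proof -
      have "1 / (10 * \<Lambda>) \<le> 1" using \<Lambda> by simp
      then have "t \<le> 1" using t(2) by simp
      then have "t * (d / 4) \<le> 1 * (d / 4)" by (rule mult_right_mono) (use d in simp)
      then show ?thesis using d by simp
    qed
    ultimately show ?thesis using d by (intro exI[of _ X] exI[of _ "d / 4"] exI[of _ "3 / 4 * d"]) simp
  next
    case False
    have \<Lambda>\<rho>: "\<rho> \<le> \<Lambda> * \<rho>" using \<Lambda> \<rho>(1) by (simp add: mult_le_cancel_right1)
    have bX: "bdist \<Omega> X < 4 * (\<Lambda> * \<rho>)" using False \<rho>(6) by simp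
    have bX': "bdist \<Omega> X' < 5 * (\<Lambda> * \<rho>)"
      using bdist_triangle[of \<Omega> X' X] bX \<rho>(6) by (simp add: dist_commute)
    have ne: "frontier \<Omega> \<noteq> {}" using bdist_pos_frontier[of \<Omega> X] \<rho> by simp
    obtain x where x: "x \<in> frontier \<Omega>" "bdist \<Omega> X = dist X x" by (rule bdist_attained[OF ne])
    obtain x' where x': "x' \<in> frontier \<Omega>" "bdist \<Omega> X' = dist X' x'" by (rule bdist_attained[OF ne])
    \<comment> \<open>Both points are within \<open>5 * (\<Lambda> * \<rho>)\<close> of
      \<open>x\<close>, so their balls of radius \<open>\<rho>\<close> lie in
      \<open>ball x R\<close>.\<close>
    define R where "R = 20 * (\<Lambda> * \<rho>)"
    have R0: "0 < R" using \<Lambda> \<rho> by (simp add: R_def)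
    show ?thesis
    proof (cases "ennreal R < ediam (frontier \<Omega>)")
      case True
      obtain Y where Y: "john_centre x R Y" using john[OF x(1) R0 True] by (auto simp: john_centre_def)
      have c1R: "c1 * R \<le> \<rho>"
        using mult_right_mono[OF c1(2), of R] R0 \<Lambda> by (simp add: R_def)
      have con: "connected_component (deep \<Omega> (\<epsilon>1 * R) x ((J + 2) * R)) Z Y"
        if Z: "Z \<in> \<Omega>" "\<rho> \<le> bdist \<Omega> Z" "dist x Z \<le> 5 * (\<Lambda> * \<rho>)" for Z
      proof -
        have "ball Z \<rho> \<subseteq> \<Omega>" using ball_bdist_subset Z by blast
        moreover have "ball Z \<rho> \<subseteq> ball x R"
          unfolding ball_subset_ball_iff using Z(3) \<Lambda>\<rho> R0 by (simp add: R_def dist_commute)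
        moreover have "ball Z (c1 * R) \<subseteq> ball Z \<rho>" using c1R by (rule subset_ball)
        ultimately have "ball Z (c1 * R) \<subseteq> ball x R \<inter> \<Omega>" by blast
        then show ?thesis using \<epsilon>1(2) x(1) R0 True Y by blast
      qed
      have "connected_component (deep \<Omega> (\<epsilon>1 * R) x ((J + 2) * R)) X Y"
        by (rule con) (use \<rho> bX x(2) in \<open>auto simp: dist_commute\<close>)
      moreover have "connected_component (deep \<Omega> (\<epsilon>1 * R) x ((J + 2) * R)) X' Y"
        by (rule con) (use \<rho> bX x(2) dist_triangle[of x X' X] in \<open>auto simp: dist_commute\<close>)
      ultimately have "connected_component (deep \<Omega> (\<epsilon>1 * R) x ((J + 2) * R)) X X'"
        by (meson connected_component_sym connected_component_trans)
      moreover have "t * ((J + 2) * R) \<le> \<epsilon>1 * R"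
        using mult_right_mono[OF t(3), of "(J + 2) * R"] J R0 by simp
      moreover have "0 < (J + 2) * R" using J R0 by simp
      ultimately show ?thesis by blast
    next
      case False
      obtain \<Delta> where \<Delta>: "0 \<le> \<Delta>" "\<Delta> \<le> R" "ediam (frontier \<Omega>) = ennreal \<Delta>"
        "\<And>y z. y \<in> frontier \<Omega> \<Longrightarrow> z \<in> frontier \<Omega> \<Longrightarrow> dist y z \<le> \<Delta>"
        using ediam_not_greater_imp[OF False x(1)] R0 by (metis less_imp_le max.absorb1)
      show ?thesis
      proof (cases "\<rho> < 10 * \<Delta>")
        case True
        have \<Delta>0: "0 < \<Delta>" using True \<rho>(1) by simp
        have "ennreal (\<Delta> / 4) < ediam (frontier \<Omega>)"
          unfolding \<Delta>(3) using \<Delta>0 by (intro ennreal_lessI) auto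
        then obtain V V' where V: "ball V (c * (\<Delta> / 4)) \<subseteq> ball x (\<Delta> / 4) \<inter> \<Omega>"
          "ball V' (c * (\<Delta> / 4)) \<subseteq> ball x (\<Delta> / 4) \<inter> interior (- \<Omega>)"
          using corkscrew[OF x(1), of "\<Delta> / 4"] \<Delta>0 by auto
        have "2 \<le> DIM('a)" using dim \<open>1 \<le> n\<close> by simp
        then obtain z where z: "z \<in> frontier \<Omega>" "dist z x \<le> (1 - \<eta>) * \<Delta>" "dist z x' \<le> (1 - \<eta>) * \<Delta>"
          using frontier_point_in_lens[OF _ c(1) \<Delta>0 x(1) x'(1) \<Delta>(4) V \<eta>(2,3)] by blast
        \<comment> \<open>Below the diameter, so that the John condition applies, yet
          \<open>\<eta> * \<Delta> / 2\<close> above the bound on the distances from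
          \<open>z\<close> to \<open>x\<close> and \<open>x'\<close>: room for the balls of radius
          \<open>\<tau>\<close> reached by moving towards the boundary.\<close>
        define r where "r = (1 - \<eta> / 2) * \<Delta>"
        define \<tau> where "\<tau> = c1 * \<Delta>"
        have \<eta>\<Delta>: "0 < \<eta> * \<Delta>" "\<eta> * \<Delta> \<le> \<Delta> / 5" using \<eta> \<Delta>0 mult_right_mono[OF \<eta>(3), of \<Delta>] by auto
        have "r = \<Delta> - \<eta> * \<Delta> / 2" by (simp add: r_def algebra_simps)
        then have r: "0 < r" "\<Delta> / 2 \<le> r" "r < \<Delta>" using \<eta>\<Delta> \<Delta>0 by linarith+
        have rd: "ennreal r < ediam (frontier \<Omega>)"
          unfolding \<Delta>(3) using r \<Delta>0 by (intro ennreal_lessI) auto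
        have \<tau>: "0 < \<tau>" "\<tau> \<le> \<rho>" "\<tau> \<le> \<eta> * \<Delta> / 160" "c1 * r \<le> \<tau>"
        proof -
          show "0 < \<tau>" using c1 \<Delta>0 by (simp add: \<tau>_def)
          have "\<tau> \<le> 1 / (20 * \<Lambda>) * R"
            unfolding \<tau>_def using c1 \<Delta>(1,2) \<Lambda> by (intro mult_mono) auto
          then show "\<tau> \<le> \<rho>" using \<Lambda> by (simp add: R_def)
          show "\<tau> \<le> \<eta> * \<Delta> / 160" using mult_right_mono[OF c1_small, of \<Delta>] \<Delta>0 by (simp add: \<tau>_def)
          show "c1 * r \<le> \<tau>" unfolding \<tau>_def using c1 r by (intro mult_left_mono) auto
        qed
        obtain Y where Y: "john_centre z r Y" using john[OF z(1) r(1) rd] by (auto simp: john_centre_def)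
        define \<epsilon> where "\<epsilon> = min (\<epsilon>1 * r) \<tau>"
        let ?D = "deep \<Omega> \<epsilon> z (K * \<Delta>)"
        have \<Lambda>\<Delta>: "\<Lambda> * \<rho> \<le> 10 * (\<Lambda> * \<Delta>)" "\<Delta> \<le> \<Lambda> * \<Delta>"
          using True \<Lambda> \<Delta>0 mult_left_mono[of \<rho> "10 * \<Delta>" \<Lambda>] by (auto simp: mult_le_cancel_right1)
        have con: "connected_component ?D Z Y"
          if Z: "Z \<in> \<Omega>" "\<rho> \<le> bdist \<Omega> Z" "bdist \<Omega> Z < 5 * (\<Lambda> * \<rho>)"
            and w: "w \<in> frontier \<Omega>" "bdist \<Omega> Z = dist Z w" "dist z w \<le> (1 - \<eta>) * \<Delta>" for Z w
        proof -
          have "\<tau> \<le> bdist \<Omega> Z" using \<tau>(2) Z(2) by simp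
          moreover have K\<Delta>: "K * \<Delta> = (J + 2) * \<Delta> + 60 * (\<Lambda> * \<Delta>)" by (simp add: K_def algebra_simps)
          have J\<Delta>: "0 \<le> (J + 2) * \<Delta>" using J \<Delta>0 by simp
          have "dist z w \<le> \<Delta>" using w(3) \<eta>\<Delta>(1) by (simp add: algebra_simps)
          then have "dist z w + bdist \<Omega> Z \<le> K * \<Delta>"
            using Z(3) \<Lambda>\<Delta> \<Delta>0 J\<Delta> unfolding K\<Delta> by linarith
          ultimately obtain Z' where Z': "dist Z' w = \<tau>" "ball Z' \<tau> \<subseteq> \<Omega>"
            "connected_component (deep \<Omega> \<tau> z (K * \<Delta>)) Z Z'"
            using connected_component_towards_frontier[OF Z(1) w(1,2) \<tau>(1)] by blast
          have "dist z Z' \<le> (1 - \<eta>) * \<Delta> + \<tau>"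
            using dist_triangle[of z Z' w] Z'(1) w(3) by (simp add: dist_commute)
          then have "dist Z' z + \<tau> \<le> r"
            using \<tau>(3) \<eta>\<Delta>(1) by (simp add: r_def dist_commute algebra_simps)
          then have "ball Z' \<tau> \<subseteq> ball z r" unfolding ball_subset_ball_iff ..
          moreover have "ball Z' (c1 * r) \<subseteq> ball Z' \<tau>" using \<tau>(4) by (rule subset_ball)
          ultimately have "ball Z' (c1 * r) \<subseteq> ball z r \<inter> \<Omega>" using Z'(2) by blast
          then have "connected_component (deep \<Omega> (\<epsilon>1 * r) z ((J + 2) * r)) Z' Y"
            using \<epsilon>1(2) z(1) r(1) rd Y by blast
          moreover have "(J + 2) * r \<le> K * \<Delta>"
            using J r \<Lambda> by (intro mult_mono) (auto simp: K_def)
          then have "deep \<Omega> (\<epsilon>1 * r) z ((J + 2) * r) \<subseteq> ?D"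
            by (intro deep_mono) (auto simp: \<epsilon>_def)
          ultimately have 1: "connected_component ?D Z' Y" by (rule connected_component_of_subset)
          have "deep \<Omega> \<tau> z (K * \<Delta>) \<subseteq> ?D" by (intro deep_mono) (auto simp: \<epsilon>_def)
          with Z'(3) have "connected_component ?D Z Z'" by (rule connected_component_of_subset)
          then show ?thesis using 1 by (rule connected_component_trans)
        qed
        have "connected_component ?D X Y" using con[OF \<rho>(2,4) _ x z(2)] bX \<Lambda>\<rho> \<rho>(1) by simp
        moreover have "connected_component ?D X' Y" using con[OF \<rho>(3,5) bX' x' z(3)] .
        ultimately have "connected_component ?D X X'"
          by (meson connected_component_sym connected_component_trans)
        moreover have "t * (K * \<Delta>) \<le> \<epsilon>"
        proof -
          have "t * (K * \<Delta>) \<le> min (\<epsilon>1 / 2) c1 / K * (K * \<Delta>)"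
            using t(4) K \<Delta>0 by (intro mult_right_mono) auto
          also have "\<dots> = min (\<epsilon>1 / 2) c1 * \<Delta>" using K by simp
          also have "\<dots> \<le> \<epsilon>"
          proof -
            have "min (\<epsilon>1 / 2) c1 * \<Delta> \<le> c1 * \<Delta>" using \<Delta>0 by (intro mult_right_mono) auto
            moreover have "min (\<epsilon>1 / 2) c1 * \<Delta> \<le> \<epsilon>1 / 2 * \<Delta>" using \<Delta>0 by (intro mult_right_mono) auto
            moreover have "\<epsilon>1 * (\<Delta> / 2) \<le> \<epsilon>1 * r" using r(2) \<epsilon>1(1) by (intro mult_left_mono) auto
            ultimately show ?thesis by (simp add: \<epsilon>_def \<tau>_def)
          qed
          finally show ?thesis .
        qed
        moreover have "0 < K * \<Delta>" using K \<Delta>0 by simp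
        ultimately show ?thesis by blast
      next
        case False
        \<comment> \<open>The whole boundary lies within \<open>\<Delta> \<le> \<rho> / 10\<close>
          of \<open>x\<close>, so this annulus stays away from it; it is connected as the dimension
          is at least 2.\<close>
        define S where "S = {y. \<rho> \<le> norm (y - x) \<and> norm (y - x) \<le> 5 * (\<Lambda> * \<rho>)}"
        have "connected S" unfolding S_def
          by (rule connected_annulus) (use dim \<open>1 \<le> n\<close> in simp)
        have XS: "X \<in> S" using x(2) bX \<rho>(1,4) \<Lambda>\<rho> by (simp add: S_def dist_norm)
        have "bdist \<Omega> X' \<le> dist X' x" using bdist_le x(1) .
        then have X'S: "X' \<in> S"
          using \<rho>(5,6) dist_triangle[of X' x X] x(2) bX by (simp add: S_def dist_commute flip: dist_norm)
        have far: "\<rho> / 2 \<le> bdist \<Omega> y" if y: "y \<in> S" for y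
          unfolding bdist_ge_iff[OF ne]
        proof
          fix w assume "w \<in> frontier \<Omega>"
          then have "dist x w \<le> \<Delta>" using \<Delta>(4) x(1) by blast
          moreover have "\<rho> \<le> dist y x" using y by (simp add: S_def dist_norm)
          ultimately show "\<rho> / 2 \<le> dist y w"
            using False dist_triangle[of y x w] \<rho>(1) \<Delta>(1) by (simp add: dist_commute)
        qed
        have "y \<notin> frontier \<Omega>" if "y \<in> S" for y
          using far[OF that] bdist_le[of y \<Omega> y] \<rho>(1) by auto
        then have "S \<inter> frontier \<Omega> = {}" by blast
        then have "S \<subseteq> \<Omega>" using subset_if_connected_avoids_frontier \<open>connected S\<close> XS \<rho>(2) by blast
        then have "S \<subseteq> deep \<Omega> (\<rho> / 2) x (5 * (\<Lambda> * \<rho>))"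
          using far by (auto simp: deep_def S_def dist_norm norm_minus_commute)
        then have "connected_component (deep \<Omega> (\<rho> / 2) x (5 * (\<Lambda> * \<rho>))) X X'"
          using \<open>connected S\<close> XS X'S unfolding connected_component_def by blast
        moreover have "t * (5 * (\<Lambda> * \<rho>)) \<le> \<rho> / 2"
          using mult_right_mono[OF t(2), of "5 * (\<Lambda> * \<rho>)"] \<Lambda> \<rho>(1) by simp
        moreover have "0 < 5 * (\<Lambda> * \<rho>)" using \<Lambda> \<rho>(1) by simp
        ultimately show ?thesis by blast
      qed
    qed
  qed
  then show ?thesis using t(1) by blast
qed

theorem harnack_chain_if_john:
  assumes "1 \<le> n" "DIM('a) = n + 1" "1 \<le> D"
    and reg: "\<And>x r. x \<in> frontier \<Omega> \<Longrightarrow> 0 < r \<Longrightarrow> ennreal r < ediam (frontier \<Omega>) \<Longrightarrow>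
        ennreal (r ^ n / D) \<le> hausdorff_measure n (ball x r \<inter> frontier \<Omega>) \<and>
        hausdorff_measure n (ball x r \<inter> frontier \<Omega>) \<le> ennreal (D * r ^ n)"
  shows "harnack_chain \<Omega>"
proof -
  have "\<exists>N0::nat. \<forall>\<rho> X X'. 0 < \<rho> \<longrightarrow> X \<in> \<Omega> \<longrightarrow> X' \<in> \<Omega> \<longrightarrow> \<rho> \<le> bdist \<Omega> X \<longrightarrow> \<rho> \<le> bdist \<Omega> X' \<longrightarrow>
    dist X X' < \<Lambda> * \<rho> \<longrightarrow> (\<exists>N z s. 1 \<le> N \<and> N \<le> N0 \<and> ball_chain \<Omega> 2 X X' N z s)" if "1 \<le> \<Lambda>" for \<Lambda>
  proof -
    obtain t where t: "0 < t" "\<forall>\<rho> X X'. 0 < \<rho> \<longrightarrow> X \<in> \<Omega> \<longrightarrow> X' \<in> \<Omega> \<longrightarrow> \<rho> \<le> bdist \<Omega> X \<longrightarrow>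
      \<rho> \<le> bdist \<Omega> X' \<longrightarrow> dist X X' < \<Lambda> * \<rho> \<longrightarrow>
      (\<exists>x R \<epsilon>. 0 < R \<and> t * R \<le> \<epsilon> \<and> connected_component (deep \<Omega> \<epsilon> x R) X X')"
      using connected_deep_if_john_corkscrew[OF assms(1-3) reg \<open>1 \<le> \<Lambda>\<close>] by blast
    obtain N0 :: nat where N0: "\<forall>(\<Omega>::'a set) \<epsilon> x R X X'. 0 < R \<longrightarrow> t * R \<le> \<epsilon> \<longrightarrow>
      connected_component (deep \<Omega> \<epsilon> x R) X X' \<longrightarrow> (\<exists>N z s. 1 \<le> N \<and> N \<le> N0 \<and> ball_chain \<Omega> 2 X X' N z s)"
      using ball_chain_if_connected_deep[OF t(1)] ..
    show ?thesis
    proof (rule exI[of _ N0], intro allI impI)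
      fix \<rho> X X'
      assume "0 < \<rho>" "X \<in> \<Omega>" "X' \<in> \<Omega>" "\<rho> \<le> bdist \<Omega> X" "\<rho> \<le> bdist \<Omega> X'" "dist X X' < \<Lambda> * \<rho>"
      then obtain x R \<epsilon> where "0 < R" "t * R \<le> \<epsilon>" "connected_component (deep \<Omega> \<epsilon> x R) X X'"
        using t(2) by blast
      then show "\<exists>N z s. 1 \<le> N \<and> N \<le> N0 \<and> ball_chain \<Omega> 2 X X' N z s" using N0 by blast
    qed
  qed
  then obtain N0 :: "real \<Rightarrow> nat" where N0: "\<And>\<Lambda> \<rho> X X'. 1 \<le> \<Lambda> \<Longrightarrow> 0 < \<rho> \<Longrightarrow> X \<in> \<Omega> \<Longrightarrow> X' \<in> \<Omega> \<Longrightarrow>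
    \<rho> \<le> bdist \<Omega> X \<Longrightarrow> \<rho> \<le> bdist \<Omega> X' \<Longrightarrow> dist X X' < \<Lambda> * \<rho> \<Longrightarrow>
    \<exists>N z s. 1 \<le> N \<and> N \<le> N0 \<Lambda> \<and> ball_chain \<Omega> 2 X X' N z s" by metis
  show ?thesis
    unfolding harnack_chain_iff
  proof (rule exI[of _ 2], rule conjI, simp, rule exI[of _ "\<lambda>\<Lambda>. real (N0 \<Lambda>)"], intro allI impI ballI)
    fix \<rho> \<Lambda> X X'
    assume "0 < \<rho>" "1 \<le> \<Lambda>" "X \<in> \<Omega>" "X' \<in> \<Omega>"
      "\<rho> \<le> bdist \<Omega> X \<and> \<rho> \<le> bdist \<Omega> X' \<and> dist X X' < \<Lambda> * \<rho>"
    then obtain N z s where "1 \<le> N" "N \<le> N0 \<Lambda>" "ball_chain \<Omega> 2 X X' N z s"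
      using N0 by blast
    then show "\<exists>N z s. 1 \<le> N \<and> real N \<le> real (N0 \<Lambda>) \<and> ball_chain \<Omega> 2 X X' N z s"
      using of_nat_mono by blast
  qed
qed

end

section \<open>From Harnack chains to local John\<close>

lemma path_length_le_if_lipschitz:
  assumes lip: "L-lipschitz_on {0..1::real} \<gamma>" and t: "0 \<le> t" "t \<le> 1"
  shows "path_length \<gamma> 0 t \<le> ennreal (L * t)"
  unfolding path_length_def
proof (rule SUP_least)
  fix ts :: "real list"
  assume "ts \<in> {ts. sorted ts \<and> set ts \<subseteq> {0..t}}"
  then have ts: "sorted ts" "set ts \<subseteq> {0..t}" by auto
  have L: "0 \<le> L" using lip by (rule lipschitz_on_nonneg)
  have mem: "ts ! i \<in> {0..t}" if "i < length ts" for i using ts(2) that nth_mem by blast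
  have "(\<Sum>i<length ts - 1. ennreal (dist (\<gamma> (ts ! i)) (\<gamma> (ts ! Suc i))))
      = ennreal (\<Sum>i<length ts - 1. dist (\<gamma> (ts ! i)) (\<gamma> (ts ! Suc i)))"
    by (rule sum_ennreal) simp
  also have "\<dots> \<le> ennreal (L * t)"
  proof (rule ennreal_leI)
    have "(\<Sum>i<length ts - 1. dist (\<gamma> (ts ! i)) (\<gamma> (ts ! Suc i))) \<le>
        (\<Sum>i<length ts - 1. L * (ts ! Suc i - ts ! i))"
    proof (rule sum_mono)
      fix i assume "i \<in> {..<length ts - 1}"
      then have i: "i < length ts" "Suc i < length ts" by auto
      have le: "ts ! i \<le> ts ! Suc i" using ts(1) i by (simp add: sorted_iff_nth_Suc)
      have "dist (\<gamma> (ts ! i)) (\<gamma> (ts ! Suc i)) \<le> L * dist (ts ! i) (ts ! Suc i)"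
        by (rule lipschitz_onD[OF lip]) (use mem[OF i(1)] mem[OF i(2)] t in auto)
      then show "dist (\<gamma> (ts ! i)) (\<gamma> (ts ! Suc i)) \<le> L * (ts ! Suc i - ts ! i)"
        using le by (simp add: dist_real_def)
    qed
    also have "\<dots> = L * (\<Sum>i<length ts - 1. ts ! Suc i - ts ! i)" by (rule sum_distrib_left[symmetric])
    also have "\<dots> = L * (ts ! (length ts - 1) - ts ! 0)" by (simp add: sum_lessThan_telescope)
    also have "\<dots> \<le> L * t"
    \<comment> \<open>For the empty list \<open>length ts - 1\<close> is 0 and the difference
      vanishes, whatever \<open>ts ! 0\<close> may be.\<close>
    proof (cases "ts = []")
      case True
      then show ?thesis using L t by simp
    next
      case False
      then show ?thesis using mem[of 0] mem[of "length ts - 1"] L by (intro mult_left_mono) auto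
    qed
    finally show "(\<Sum>i<length ts - 1. dist (\<gamma> (ts ! i)) (\<gamma> (ts ! Suc i))) \<le> L * t" .
  qed
  finally show "(\<Sum>i<length ts - 1. ennreal (dist (\<gamma> (ts ! i)) (\<gamma> (ts ! Suc i)))) \<le> ennreal (L * t)" .
qed

text \<open>Appending a segment squeezes the previous path into half the time and so doubles its
  Lipschitz constant; the exponential loss is harmless because the number of balls in a Harnack
  chain is bounded.\<close>

lemma lipschitz_polygon:
  fixes v :: "nat \<Rightarrow> 'a::real_normed_vector"
  assumes "0 \<le> \<nu>" "v 0 \<in> S"
    and "\<And>i. i < N \<Longrightarrow> dist (v i) (v (Suc i)) \<le> \<nu> \<and> closed_segment (v i) (v (Suc i)) \<subseteq> S"
  shows "\<exists>g. (2 ^ N * \<nu>)-lipschitz_on {0..1::real} g \<and> g 0 = v 0 \<and> g 1 = v N \<and> g ` {0..1} \<subseteq> S"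
  using assms(3)
proof (induction N)
  case 0
  show ?case
    using assms(1,2) by (intro exI[of _ "\<lambda>_. v 0"]) (auto simp: lipschitz_on_def)
next
  case (Suc N)
  obtain g where g: "(2 ^ N * \<nu>)-lipschitz_on {0..1::real} g" "g 0 = v 0" "g 1 = v N" "g ` {0..1} \<subseteq> S"
    using Suc by (meson less_SucI)
  let ?K = "2 ^ Suc N * \<nu>" and ?l = "linepath (v N) (v (Suc N))"
  define f where "f t = (if t \<le> 1/2 then g (2 * t) else ?l (2 * t - 1))" for t
  have "?K-lipschitz_on {0..1/2} (\<lambda>t. g (2 * t))"
  proof (rule lipschitz_onI)
    fix s t :: real assume "s \<in> {0..1/2}" "t \<in> {0..1/2}"
    then have "dist (g (2 * s)) (g (2 * t)) \<le> 2 ^ N * \<nu> * dist (2 * s) (2 * t)"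
      by (intro lipschitz_onD[OF g(1)]) auto
    also have "dist (2 * s) (2 * t) = 2 * dist s t" by (auto simp: dist_real_def abs_if)
    finally show "dist (g (2 * s)) (g (2 * t)) \<le> ?K * dist s t" by (simp add: algebra_simps)
  qed (use assms in simp)
  moreover have "?K-lipschitz_on {1/2..1} (\<lambda>t. ?l (2 * t - 1))"
  proof (rule lipschitz_onI)
    fix s t :: real
    have "?l (2 * s - 1) - ?l (2 * t - 1) = (2 * (s - t)) *\<^sub>R (v (Suc N) - v N)"
      by (simp add: linepath_def algebra_simps flip: scaleR_add_left)
    then have "dist (?l (2 * s - 1)) (?l (2 * t - 1)) = norm ((2 * (s - t)) *\<^sub>R (v (Suc N) - v N))"
      by (simp only: dist_norm)
    also have "\<dots> = 2 * dist s t * dist (v N) (v (Suc N))"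
      unfolding norm_scaleR abs_mult by (simp add: dist_norm norm_minus_commute)
    also have "\<dots> \<le> 2 * dist s t * \<nu>"
      using Suc.prems[of N] by (intro mult_left_mono) auto
    also have "\<dots> \<le> ?K * dist s t"
    proof -
      have "2 * \<nu> \<le> ?K" using assms(1) by (simp add: mult_le_cancel_right1)
      then have "2 * \<nu> * dist s t \<le> ?K * dist s t" by (rule mult_right_mono) simp
      then show ?thesis by (simp add: ac_simps)
    qed
    finally show "dist (?l (2 * s - 1)) (?l (2 * t - 1)) \<le> ?K * dist s t" .
  qed (use assms in simp)
  ultimately have "?K-lipschitz_on {0..1::real} f"
    unfolding f_def by (rule lipschitz_on_concat) (use g(3) in \<open>simp add: linepath_def\<close>)
  moreover have "f 0 = v 0" "f 1 = v (Suc N)" using g(2) by (simp_all add: f_def linepath_def)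
  moreover have "f t \<in> S" if "t \<in> {0..1}" for t
  proof (cases "t \<le> 1/2")
    case True
    then show ?thesis using g(4) that by (auto simp: f_def)
  next
    case False
    then have "?l (2 * t - 1) \<in> closed_segment (v N) (v (Suc N))"
      using that linepath_in_path[of "2 * t - 1"] by auto
    then show ?thesis using False Suc.prems[of N] by (auto simp: f_def)
  qed
  ultimately show ?case by blast
qed

lemma whitney_ball_bdist:
  fixes \<Omega> :: "'a::euclidean_space set"
  assumes "whitney_ball \<Omega> C z s" "1 \<le> C" "frontier \<Omega> \<noteq> {}" "y \<in> ball z s"
  shows "2 * s / C \<le> bdist \<Omega> y" "bdist \<Omega> y \<le> 2 * (C + 1) * s"
proof -
  let ?B = "ball z s"
  have s: "0 < s" and "?B \<noteq> {}" using assms(1) by (auto simp: whitney_ball_def)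
  have diam: "diameter ?B = 2 * s" using s diameter_ball[of z s] by simp
  have "setdist ?B (frontier \<Omega>) \<le> bdist \<Omega> y"
    unfolding bdist_ge_iff[OF assms(3)] using setdist_le_dist assms(4) by blast
  then show "2 * s / C \<le> bdist \<Omega> y" using assms(1) unfolding whitney_ball_def diam by linarith
  have "bdist \<Omega> y - 2 * s \<le> setdist ?B (frontier \<Omega>)"
  proof (rule le_setdistI)
    fix y' w assume yw: "y' \<in> ?B" "w \<in> frontier \<Omega>"
    have "dist y y' \<le> 2 * s" using dist_triangle[of y y' z] yw(1) assms(4) by (simp add: dist_commute)
    then show "bdist \<Omega> y - 2 * s \<le> dist y' w"
      using bdist_le[OF yw(2), of y] dist_triangle[of y w y'] by simp
  qed (use assms \<open>?B \<noteq> {}\<close> in auto)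
  also have "\<dots> \<le> C * (2 * s)" using assms(1) unfolding whitney_ball_def diam by linarith
  finally show "bdist \<Omega> y \<le> 2 * (C + 1) * s" by (simp add: algebra_simps)
qed

text \<open>A common point of two Whitney balls makes their radii comparable, with factor
  \<open>C * (C + 1)\<close>; starting from the depth of \<open>X\<close>, at most \<open>M\<close>
  balls keep all radii comparable to \<open>\<rho>\<close>. The single constant \<open>L\<close>
  bounds both the speed of the polygon and its loss of depth.\<close>

lemma lipschitz_path_if_ball_chain:
  fixes \<Omega> :: "'a::euclidean_space set"
  assumes chain: "ball_chain \<Omega> C X X' N z s" and N: "1 \<le> N" "N \<le> M" and C: "1 \<le> C"
    and \<rho>: "0 < \<rho>" "\<rho> \<le> bdist \<Omega> X" "bdist \<Omega> X \<le> \<Lambda> * \<rho>" and \<Lambda>: "1 \<le> \<Lambda>"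
    and L: "L = 2 ^ Suc M * (C * (C + 1)) ^ Suc M * C * \<Lambda>"
  shows "\<exists>g. (L * \<rho>)-lipschitz_on {0..1::real} g \<and> g 0 = X \<and> g 1 = X' \<and>
    g ` {0..1} \<subseteq> {y \<in> \<Omega>. \<rho> / L \<le> bdist \<Omega> y}"
proof -
  have ne: "frontier \<Omega> \<noteq> {}" using bdist_pos_frontier[of \<Omega> X] \<rho> by simp
  have chainD: "X \<in> ball (z 1) (s 1)" "X' \<in> ball (z N) (s N)"
    "\<And>k. 1 \<le> k \<Longrightarrow> k \<le> N \<Longrightarrow> whitney_ball \<Omega> C (z k) (s k)"
    "\<And>k. 1 \<le> k \<Longrightarrow> k < N \<Longrightarrow> ball (z k) (s k) \<inter> ball (z (Suc k)) (s (Suc k)) \<noteq> {}"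
    using chain by (auto simp: ball_chain_def)
  note bd = whitney_ball_bdist[OF chainD(3) C ne]
  define A where "A = C * (C + 1)"
  have A: "1 \<le> A" using C mult_mono[of 1 C 1 "C + 1"] by (simp add: A_def)
  have sizes: "\<rho> \<le> 2 * (C + 1) * A ^ M * s k \<and> 2 * s k \<le> A ^ M * (C * \<Lambda> * \<rho>)" if "1 \<le> k" "k \<le> N" for k
  proof -
    have "\<rho> \<le> 2 * (C + 1) * A ^ (k - 1) * s k \<and> 2 * s k \<le> A ^ (k - 1) * (C * \<Lambda> * \<rho>)"
      using that
    proof (induction k rule: dec_induct)
      case base
      have "2 * s 1 / C \<le> \<Lambda> * \<rho>" "\<rho> \<le> 2 * (C + 1) * s 1"
        using bd[of 1 X] chainD(1) N \<rho> by auto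
      then show ?case using C by (simp add: field_simps)
    next
      case (step k)
      obtain y where y: "y \<in> ball (z k) (s k)" "y \<in> ball (z (Suc k)) (s (Suc k))"
        using chainD(4)[of k] step by auto
      have IH: "\<rho> \<le> 2 * (C + 1) * A ^ (k - 1) * s k" "2 * s k \<le> A ^ (k - 1) * (C * \<Lambda> * \<rho>)"
        using step by auto
      have "2 * s k / C \<le> 2 * (C + 1) * s (Suc k)" "2 * s (Suc k) / C \<le> 2 * (C + 1) * s k"
        using bd[of k y] bd[of "Suc k" y] y step by auto
      then have up: "s k \<le> A * s (Suc k)" "2 * s (Suc k) \<le> A * (2 * s k)"
        using C by (simp_all add: A_def field_simps)
      have k: "A ^ (Suc k - 1) = A * A ^ (k - 1)" using step(1) by (cases k) auto
      have "2 * (C + 1) * A ^ (k - 1) * s k \<le> 2 * (C + 1) * A ^ (k - 1) * (A * s (Suc k))"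
        using up(1) A C by (intro mult_left_mono) auto
      moreover have "A * (2 * s k) \<le> A * (A ^ (k - 1) * (C * \<Lambda> * \<rho>))"
        using IH(2) A by (intro mult_left_mono) auto
      ultimately show ?case using IH(1) up(2) unfolding k by (simp add: ac_simps)
    qed
    moreover have "A ^ (k - 1) \<le> A ^ M" using A N that by (intro power_increasing) auto
    moreover have "0 < s k" using chainD(3)[OF that] by (simp add: whitney_ball_def)
    moreover have "2 * (C + 1) * A ^ (k - 1) * s k \<le> 2 * (C + 1) * A ^ M * s k"
      using calculation C by (intro mult_right_mono mult_left_mono) auto
    moreover have "A ^ (k - 1) * (C * \<Lambda> * \<rho>) \<le> A ^ M * (C * \<Lambda> * \<rho>)"
      using calculation C \<Lambda> \<rho> by (intro mult_right_mono) auto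
    ultimately show ?thesis by linarith
  qed
  define \<nu> where "\<nu> = A ^ M * (C * \<Lambda> * \<rho>)"
  have \<nu>: "0 \<le> \<nu>" using A C \<Lambda> \<rho> by (simp add: \<nu>_def)
  have AM: "1 \<le> A ^ M" using A by (rule one_le_power)
  have C\<Lambda>: "1 \<le> C * \<Lambda>" using C \<Lambda> mult_mono[of 1 C 1 \<Lambda>] by simp
  have L_eq: "L * \<rho> = 2 * A * (2 ^ M * \<nu>)" by (simp add: L \<nu>_def A_def)
  have L_ge: "A ^ Suc M \<le> L"
  proof -
    have "1 * A ^ Suc M * 1 \<le> 2 ^ Suc M * A ^ Suc M * (C * \<Lambda>)"
      using A C\<Lambda> one_le_power[of "2::real" "Suc M"] by (intro mult_mono) auto
    then show ?thesis by (simp add: L A_def ac_simps)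
  qed
  have "0 < A ^ Suc M" using A by simp
  have deep: "\<rho> / L \<le> bdist \<Omega> y" if "1 \<le> k" "k \<le> N" "y \<in> ball (z k) (s k)" for k y
  proof -
    have "2 * s k / C \<le> bdist \<Omega> y" by (rule bd) fact+
    have "\<rho> \<le> 2 * (C + 1) * A ^ M * s k" using sizes[of k] that by blast
    also have "\<dots> = A ^ M * (C + 1) * (2 * s k)" by (simp add: algebra_simps)
    also have "\<dots> = A ^ Suc M * (2 * s k / C)" using C by (simp add: A_def)
    also have "\<dots> \<le> A ^ Suc M * bdist \<Omega> y"
      using \<open>2 * s k / C \<le> bdist \<Omega> y\<close> \<open>0 < A ^ Suc M\<close> by (intro mult_left_mono) auto
    also have "\<dots> \<le> L * bdist \<Omega> y" using L_ge by (intro mult_right_mono) auto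
    finally show ?thesis using L_ge \<open>0 < A ^ Suc M\<close> by (simp add: divide_le_eq mult.commute)
  qed
  have "\<exists>y. y \<in> ball (z k) (s k) \<inter> ball (z (Suc k)) (s (Suc k))" if "1 \<le> k" "k < N" for k
    using chainD(4)[OF that] by blast
  then obtain w where w: "\<And>k. 1 \<le> k \<Longrightarrow> k < N \<Longrightarrow> w k \<in> ball (z k) (s k) \<inter> ball (z (Suc k)) (s (Suc k))"
    by metis
  \<comment> \<open>The inner vertices lie in overlaps, so the edge from \<open>v k\<close> to
    \<open>v (Suc k)\<close> has both ends in ball number \<open>Suc k\<close> and stays there by
    convexity.\<close>
  define v where "v k = (if k = 0 then X else if k = N then X' else w k)" for k
  have v: "v k \<in> ball (z (Suc k)) (s (Suc k))" "v (Suc k) \<in> ball (z (Suc k)) (s (Suc k))" if "k < N" for k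
    using chainD(1,2) w[of k] w[of "Suc k"] that by (auto simp: v_def not_less_eq less_Suc_eq_le)
  let ?S = "{y \<in> \<Omega>. \<rho> / L \<le> bdist \<Omega> y}"
  have sub: "ball (z k) (s k) \<subseteq> ?S" if "1 \<le> k" "k \<le> N" for k
    using deep[OF that] chainD(3)[OF that] by (auto simp: whitney_ball_def)
  have "\<exists>g. (2 ^ N * \<nu>)-lipschitz_on {0..1::real} g \<and> g 0 = v 0 \<and> g 1 = v N \<and> g ` {0..1} \<subseteq> ?S"
  proof (rule lipschitz_polygon[OF \<nu>])
    show "v 0 \<in> ?S" using v(1)[of 0] sub[of 1] N by auto
    fix i assume i: "i < N"
    have "dist (v i) (v (Suc i)) \<le> 2 * s (Suc i)"
      using dist_triangle[of "v i" "v (Suc i)" "z (Suc i)"] v[OF i] by (simp add: dist_commute)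
    also have "\<dots> \<le> \<nu>" using sizes[of "Suc i"] i by (simp add: \<nu>_def)
    finally have le: "dist (v i) (v (Suc i)) \<le> \<nu>" .
    have "closed_segment (v i) (v (Suc i)) \<subseteq> ball (z (Suc i)) (s (Suc i))"
      using v[OF i] by (intro closed_segment_subset) auto
    also have "\<dots> \<subseteq> ?S" by (rule sub) (use i in auto)
    finally show "dist (v i) (v (Suc i)) \<le> \<nu> \<and> closed_segment (v i) (v (Suc i)) \<subseteq> ?S"
      using le by blast
  qed
  then obtain g where g: "(2 ^ N * \<nu>)-lipschitz_on {0..1::real} g" "g 0 = v 0" "g 1 = v N" "g ` {0..1} \<subseteq> ?S"
    by blast
  have "2 ^ N * \<nu> \<le> 2 ^ M * \<nu>" using N(2) \<nu> by (intro mult_right_mono power_increasing) auto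
  also have "1 * (2 ^ M * \<nu>) \<le> 2 * A * (2 ^ M * \<nu>)" using A \<nu> by (intro mult_right_mono) auto
  finally have "2 ^ N * \<nu> \<le> L * \<rho>" unfolding L_eq by simp
  then have "(L * \<rho>)-lipschitz_on {0..1::real} g" using g(1) lipschitz_on_mono by blast
  then show ?thesis using g(2-4) N by (auto simp: v_def)
qed

section \<open>Concatenating paths over dyadic intervals\<close>

definition dyadic_level :: "real \<Rightarrow> nat" where
  "dyadic_level t = (LEAST k. (1/2) ^ Suc k < t)"

lemma dyadic_level:
  assumes "0 < t" "t \<le> 1"
  shows "(1/2) ^ Suc (dyadic_level t) < t" "t \<le> (1/2) ^ dyadic_level t"
proof -
  obtain k where k: "(1/2) ^ k < t" using real_arch_pow_inv[OF assms(1), of "1/2"] by auto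
  have "(1/2::real) ^ Suc k \<le> (1/2) ^ k" by simp
  then have "(1/2) ^ Suc k < t" using k by linarith
  then show "(1/2) ^ Suc (dyadic_level t) < t" unfolding dyadic_level_def by (rule LeastI)
  show "t \<le> (1/2) ^ dyadic_level t"
  proof (cases "dyadic_level t")
    case 0
    then show ?thesis using assms by simp
  next
    case (Suc j)
    then have "\<not> (1/2) ^ Suc j < t" unfolding dyadic_level_def using not_less_Least by (metis lessI)
    then show ?thesis using Suc by simp
  qed
qed

lemma dyadic_level_unique:
  assumes "(1/2) ^ Suc k < t" "t \<le> (1/2) ^ k"
  shows "dyadic_level t = k"
  unfolding dyadic_level_def
proof (rule Least_equality)
  fix j assume j: "(1/2) ^ Suc j < t"
  show "k \<le> j"
  proof (rule ccontr)
    assume "\<not> k \<le> j"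
    then have "(1/2::real) ^ k \<le> (1/2) ^ Suc j" by (intro power_decreasing) auto
    then show False using j assms(2) by linarith
  qed
qed (rule assms)

text \<open>The piece \<open>g k\<close> is run over an interval of length
  \<open>(1/2) ^ Suc k\<close>, which cancels the factor \<open>(1/2) ^ k\<close> in its Lipschitz
  constant and leaves \<open>2 * K\<close> on every piece. The indices fall as time grows, so that
  the path starts at the limit \<open>z\<close>.\<close>

lemma lipschitz_path_to_limit:
  fixes g :: "nat \<Rightarrow> real \<Rightarrow> 'a::metric_space"
  assumes K: "0 \<le> K" and g: "\<And>k. (K * (1/2) ^ k)-lipschitz_on {0..1::real} (g k)"
    and ends: "\<And>k. g k 0 = X (Suc k)" "\<And>k. g k 1 = X k"
    and lim: "\<And>k. dist z (X k) \<le> R * (1/2) ^ k"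
  shows "\<exists>\<gamma>. (2 * (K + R))-lipschitz_on {0..1::real} \<gamma> \<and> \<gamma> 0 = z \<and> \<gamma> 1 = X 0 \<and>
    (\<forall>t::real. 0 < t \<and> t \<le> 1 \<longrightarrow> (\<exists>k. t \<le> (1/2) ^ k \<and> \<gamma> t \<in> g k ` {0..1}))"
proof -
  define \<gamma> where "\<gamma> t = (if t \<le> 0 then z else g (dyadic_level t) (2 ^ Suc (dyadic_level t) * t - 1))" for t
  have R: "0 \<le> R" using lim[of 0] by (simp add: order_trans[OF zero_le_dist])
  \<comment> \<open>At the common end of two intervals \<open>dyadic_level\<close> selects
    \<open>Suc k\<close>; as \<open>g (Suc k)\<close> ends where \<open>g k\<close> starts, the
    formula is valid on the closed interval.\<close>
  have piece: "\<gamma> t = g k (2 ^ Suc k * t - 1)" if t: "(1/2) ^ Suc k \<le> t" "t \<le> (1/2) ^ k" for k t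
  proof (cases "t = (1/2) ^ Suc k")
    case True
    have "dyadic_level t = Suc k"
      by (rule dyadic_level_unique) (simp_all add: True)
    moreover have "2 ^ Suc (Suc k) * t - 1 = 1" "2 ^ Suc k * t - 1 = 0" "0 < t"
      unfolding True by (simp_all add: power_one_over)
    ultimately show ?thesis by (simp add: \<gamma>_def ends del: power_Suc)
  next
    case False
    then have "(1/2) ^ Suc k < t" using t by simp
    moreover have "0 < t" using t(1) zero_less_power[of "1/2::real" "Suc k"] by linarith
    ultimately show ?thesis using dyadic_level_unique[OF _ t(2)] by (simp add: \<gamma>_def)
  qed
  have unit: "2 ^ Suc k * t - 1 \<in> {0..1}" if t: "(1/2) ^ Suc k \<le> t" "t \<le> (1/2) ^ k" for k and t :: real
  proof -
    have e: "(2::real) ^ Suc k * (1/2) ^ Suc k = 1" "(2::real) ^ Suc k * (1/2) ^ k = 2"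
      by (simp_all add: power_one_over)
    have "1 \<le> 2 ^ Suc k * t" using mult_left_mono[OF t(1), of "2 ^ Suc k"] unfolding e by simp
    moreover have "2 ^ Suc k * t \<le> 2" using mult_left_mono[OF t(2), of "2 ^ Suc k"] unfolding e by simp
    ultimately show ?thesis by (simp del: power_Suc)
  qed
  have lip_piece: "(2 * K)-lipschitz_on {(1/2) ^ Suc k..(1/2) ^ k} \<gamma>" for k
  proof (rule lipschitz_onI)
    fix s t :: real assume st: "s \<in> {(1/2) ^ Suc k..(1/2) ^ k}" "t \<in> {(1/2) ^ Suc k..(1/2) ^ k}"
    have "dist (\<gamma> s) (\<gamma> t) \<le> K * (1/2) ^ k * dist (2 ^ Suc k * s - 1) (2 ^ Suc k * t - 1)"
      using st piece unit by (auto intro!: lipschitz_onD[OF g])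
    also have "dist (2 ^ Suc k * s - 1) (2 ^ Suc k * t - 1) = 2 ^ Suc k * dist s t"
    proof -
      have "2 ^ Suc k * s - 1 - (2 ^ Suc k * t - 1) = 2 ^ Suc k * (s - t)" by (simp add: algebra_simps)
      then have "dist (2 ^ Suc k * s - 1) (2 ^ Suc k * t - 1) = \<bar>2 ^ Suc k * (s - t)\<bar>"
        by (simp only: dist_real_def)
      also have "\<dots> = 2 ^ Suc k * dist s t" unfolding abs_mult by (simp add: dist_real_def)
      finally show ?thesis .
    qed
    also have "K * (1/2) ^ k * (2 ^ Suc k * dist s t) = 2 * K * dist s t"
      by (simp add: power_one_over)
    finally show "dist (\<gamma> s) (\<gamma> t) \<le> 2 * K * dist s t" .
  qed (use K in simp)
  have lip_m: "(2 * K)-lipschitz_on {(1/2) ^ m..1} \<gamma>" for m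
  proof (induction m)
    case 0
    then show ?case using K by (simp add: lipschitz_on_def)
  next
    case (Suc m)
    have "(2 * K)-lipschitz_on {(1/2) ^ Suc m..1} (\<lambda>t. if t \<le> (1/2) ^ m then \<gamma> t else \<gamma> t)"
      by (rule lipschitz_on_concat[OF lip_piece Suc]) simp
    then show ?case by simp
  qed
  have lip_pos: "dist (\<gamma> s) (\<gamma> t) \<le> 2 * K * dist s t" if st: "0 < s" "s \<le> 1" "0 < t" "t \<le> 1" for s t
  proof -
    obtain m where m: "(1/2) ^ m < min s t" using real_arch_pow_inv[of "min s t" "1/2"] st by auto
    then show ?thesis using lipschitz_onD[OF lip_m[of m], of s t] st by auto
  qed
  \<comment> \<open>On the interval of level \<open>k\<close>, the point \<open>\<gamma> t\<close>
    is within \<open>K * (1/2) ^ k\<close> of \<open>X k\<close>, which is within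
    \<open>R * (1/2) ^ k\<close> of \<open>z\<close>, and \<open>(1/2) ^ k\<close> is at most
    \<open>2 * t\<close>.\<close>
  have lip_0: "dist z (\<gamma> t) \<le> 2 * (K + R) * t" if t: "0 < t" "t \<le> 1" for t
  proof -
    define k where "k = dyadic_level t"
    have k: "(1/2) ^ Suc k \<le> t" "t \<le> (1/2) ^ k"
      using dyadic_level[OF t] by (auto simp: k_def simp del: power_Suc)
    have "dist (X k) (\<gamma> t) = dist (g k 1) (g k (2 ^ Suc k * t - 1))" using piece[OF k] ends by simp
    also have "\<dots> \<le> K * (1/2) ^ k * dist 1 (2 ^ Suc k * t - 1)"
      by (rule lipschitz_onD[OF g]) (use unit[OF k] in auto)
    also have "\<dots> \<le> K * (1/2) ^ k * 1"
      using unit[OF k] K by (intro mult_left_mono) (auto simp: dist_real_def)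
    finally have "dist z (\<gamma> t) \<le> (K + R) * (1/2) ^ k"
      using lim[of k] dist_triangle[of z "\<gamma> t" "X k"] by (simp add: algebra_simps)
    also have "\<dots> \<le> (K + R) * (2 * t)" using k(1) K R by (intro mult_left_mono) auto
    finally show ?thesis by (simp add: algebra_simps)
  qed
  have "(2 * (K + R))-lipschitz_on {0..1::real} \<gamma>"
  proof (rule lipschitz_onI)
    fix s t :: real assume st: "s \<in> {0..1}" "t \<in> {0..1}"
    have \<gamma>0: "\<gamma> 0 = z" by (simp add: \<gamma>_def)
    consider "s = 0" "t = 0" | "s = 0" "0 < t" | "0 < s" "t = 0" | "0 < s" "0 < t" using st by force
    then show "dist (\<gamma> s) (\<gamma> t) \<le> 2 * (K + R) * dist s t"
    proof cases
      case 4
      then have "dist (\<gamma> s) (\<gamma> t) \<le> 2 * K * dist s t" using lip_pos st by auto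
      also have "\<dots> \<le> 2 * (K + R) * dist s t" using R by (intro mult_right_mono) auto
      finally show ?thesis .
    qed (use lip_0[of s] lip_0[of t] st \<gamma>0 in \<open>auto simp: dist_commute\<close>)
  qed (use K R in simp)
  moreover have "\<gamma> 0 = z" by (simp add: \<gamma>_def)
  moreover have "\<gamma> 1 = X 0" using piece[of 0 1] ends by simp
  moreover have "\<exists>k. t \<le> (1/2) ^ k \<and> \<gamma> t \<in> g k ` {0..1}" if t: "0 < t" "t \<le> 1" for t
  proof -
    define k where "k = dyadic_level t"
    have k: "(1/2) ^ Suc k \<le> t" "t \<le> (1/2) ^ k"
      using dyadic_level[OF t] by (auto simp: k_def simp del: power_Suc)
    then show ?thesis using piece[OF k] unit[OF k] by auto
  qed
  ultimately show ?thesis by blast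
qed

theorem local_john_if_harnack_chain:
  fixes \<Omega> :: "'a::euclidean_space set"
  assumes "open \<Omega>" and c: "0 < c"
    and corkscrew: "\<And>x r. x \<in> frontier \<Omega> \<Longrightarrow> 0 < r \<Longrightarrow> ennreal r < ediam (frontier \<Omega>) \<Longrightarrow>
      \<exists>X. ball X (c * r) \<subseteq> ball x r \<inter> \<Omega>"
    and harnack: "harnack_chain \<Omega>"
  shows "local_john \<Omega>"
proof -
  obtain C M where C: "1 \<le> C" and H: "\<forall>\<rho>>0. \<forall>\<Lambda>\<ge>1. \<forall>X\<in>\<Omega>. \<forall>X'\<in>\<Omega>.
     bdist \<Omega> X \<ge> \<rho> \<and> bdist \<Omega> X' \<ge> \<rho> \<and> dist X X' < \<Lambda> * \<rho> \<longrightarrow>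
     (\<exists>N z s. 1 \<le> N \<and> real N \<le> M \<Lambda> \<and> ball_chain \<Omega> C X X' N z s)"
    using harnack unfolding harnack_chain_iff by (elim exE conjE)
  \<comment> \<open>Consecutive corkscrew points will be at most \<open>3 * h k\<close> apart and
    have depth at least \<open>\<rho> = c * h k / 2\<close>; this choice makes
    \<open>\<Lambda> * \<rho>\<close> at least \<open>7 / 2 * h k\<close>, hence strictly
    larger.\<close>
  define \<Lambda> where "\<Lambda> = max 1 (7 / c)"
  have \<Lambda>: "1 \<le> \<Lambda>" "7 / c \<le> \<Lambda>" by (auto simp: \<Lambda>_def)
  define m where "m = nat \<lceil>M \<Lambda>\<rceil>"
  define L where "L = 2 ^ Suc m * (C * (C + 1)) ^ Suc m * C * \<Lambda>"
  have L: "0 < L" using C \<Lambda> by (simp add: L_def)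
  define K where "K = L * c / 2"
  have K: "0 < K" using L c by (simp add: K_def)
  define \<mu> where "\<mu> = c / (2 * L)"
  have \<mu>: "0 < \<mu>" using L c by (simp add: \<mu>_def)
  \<comment> \<open>The entries serve, in turn, \<open>1 \<le> D\<close>, the ball about
    \<open>Y\<close>, the length of the path, and the quotient of its speed by the growth rate of
    its depth.\<close>
  define D where "D = max (max 1 (1 / c)) (max (2 * (K + 2)) (2 * (K + 2) / \<mu>))"
  have D: "1 \<le> D" "1 / c \<le> D" "2 * (K + 2) \<le> D" "2 * (K + 2) / \<mu> \<le> D" by (auto simp: D_def)
  have "\<exists>Y \<in> ball x r \<inter> \<Omega>. ball Y (r / D) \<subseteq> \<Omega> \<and> (\<forall>z \<in> ball x r \<inter> frontier \<Omega>.
      \<exists>\<gamma>. path_in_from_to \<Omega> \<gamma> z Y \<and> nontangential \<Omega> D \<gamma> \<and> path_length \<gamma> 0 1 \<le> ennreal (D * r))"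
    if x: "x \<in> frontier \<Omega>" and r: "0 < r" "ennreal r < ediam (frontier \<Omega>)" for x r
  proof -
    have ne: "frontier \<Omega> \<noteq> {}" using x by blast
    have \<Omega>F: "\<Omega> \<inter> frontier \<Omega> = {}" using \<open>open \<Omega>\<close> by (auto simp: frontier_def interior_open)
    have cork: "\<exists>X. X \<in> ball z s \<inter> \<Omega> \<and> ball X (c * s) \<subseteq> \<Omega> \<and> c * s \<le> bdist \<Omega> X"
      if z: "z \<in> frontier \<Omega>" and s: "0 < s" "s \<le> r" for z s
    proof -
      have "ennreal s < ediam (frontier \<Omega>)" using s by (intro le_less_trans[OF ennreal_leI r(2)])
      then obtain X where X: "ball X (c * s) \<subseteq> ball z s \<inter> \<Omega>" using corkscrew z s by blast
      have "X \<in> ball X (c * s)" using c s by simp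
      then have "X \<in> ball z s \<inter> \<Omega>" using X by blast
      moreover have "ball X (c * s) \<subseteq> \<Omega>" using X by blast
      ultimately show ?thesis using bdist_ge_if_ball_subset_interior[OF _ \<Omega>F ne] by blast
    qed
    obtain Y where Y: "Y \<in> ball x r \<inter> \<Omega>" "ball Y (c * r) \<subseteq> \<Omega>" "c * r \<le> bdist \<Omega> Y"
      using cork[OF x r(1)] by blast
    have "r / D \<le> c * r"
    proof -
      have "r * (1 / c) \<le> r * D" using D(2) r(1) by (intro mult_left_mono) auto
      then show ?thesis using c D(1) by (simp add: field_simps)
    qed
    then have "ball Y (r / D) \<subseteq> \<Omega>" using Y(2) subset_ball by blast
    moreover have "\<exists>\<gamma>. path_in_from_to \<Omega> \<gamma> z Y \<and> nontangential \<Omega> D \<gamma> \<and> path_length \<gamma> 0 1 \<le> ennreal (D * r)"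
      if z: "z \<in> ball x r \<inter> frontier \<Omega>" for z
    proof -
      define h where "h k = r * (1/2) ^ k" for k :: nat
      have h: "0 < h k" "h k \<le> r" "h (Suc k) = h k / 2" for k
        using r(1) power_le_one[of "1/2::real" k] by (auto simp: h_def mult_le_cancel_left1)
      \<comment> \<open>The factor 2 is due to \<open>k = 0\<close>, where the same \<open>Y\<close>
        must serve every \<open>z\<close>: it is a corkscrew point of \<open>x\<close> and thus only
        within \<open>2 * r\<close> of \<open>z\<close>.\<close>
      have "\<exists>X. dist z X \<le> 2 * h k \<and> X \<in> \<Omega> \<and> c * h k \<le> bdist \<Omega> X \<and> (k = 0 \<longrightarrow> X = Y)" for k
      proof (cases "k = 0")
        case True
        have "dist z Y \<le> 2 * r" using z Y(1) dist_triangle[of z Y x] by (simp add: dist_commute)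
        then show ?thesis using True Y by (intro exI[of _ Y]) (auto simp: h_def)
      next
        case False
        obtain X where X: "X \<in> ball z (h k) \<inter> \<Omega>" "c * h k \<le> bdist \<Omega> X"
          using cork[of z "h k"] z h by blast
        then have "dist z X \<le> 2 * h k" using h(1)[of k] by simp
        then show ?thesis using False X by auto
      qed
      then obtain X where X: "\<And>k. dist z (X k) \<le> 2 * h k" "\<And>k. X k \<in> \<Omega>" "\<And>k. c * h k \<le> bdist \<Omega> (X k)" "X 0 = Y"
        by metis
      have "\<exists>g. (K * r * (1/2) ^ k)-lipschitz_on {0..1::real} g \<and> g 0 = X (Suc k) \<and> g 1 = X k \<and>
        g ` {0..1} \<subseteq> {y \<in> \<Omega>. \<mu> * h k \<le> bdist \<Omega> y}" for k
      proof -
        define \<rho> where "\<rho> = c * h k / 2"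
        have \<rho>: "0 < \<rho>" using c h by (simp add: \<rho>_def)
        have b: "\<rho> \<le> bdist \<Omega> (X (Suc k))" "\<rho> \<le> bdist \<Omega> (X k)"
          using X(3)[of k] X(3)[of "Suc k"] h(3)[of k] \<rho> by (auto simp: \<rho>_def)
        have \<Lambda>\<rho>: "7 / 2 * h k \<le> \<Lambda> * \<rho>"
          using mult_right_mono[OF \<Lambda>(2), of \<rho>] \<rho> c by (simp add: \<rho>_def)
        have "bdist \<Omega> (X (Suc k)) \<le> \<Lambda> * \<rho>"
          using bdist_le[of z \<Omega> "X (Suc k)"] z X(1)[of "Suc k"] h(1,3)[of k] \<Lambda>\<rho>
          by (simp add: dist_commute)
        moreover have "dist (X (Suc k)) (X k) < \<Lambda> * \<rho>"
          using dist_triangle[of "X (Suc k)" "X k" z] X(1)[of k] X(1)[of "Suc k"] h(1,3)[of k] \<Lambda>\<rho>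
          by (simp add: dist_commute)
        ultimately obtain N w s where N: "1 \<le> N" "real N \<le> M \<Lambda>" "ball_chain \<Omega> C (X (Suc k)) (X k) N w s"
          using H[rule_format, OF \<rho> \<Lambda>(1) X(2) X(2)] b by blast
        have "N \<le> m" using N(2) unfolding m_def by linarith
        obtain g where g: "(L * \<rho>)-lipschitz_on {0..1::real} g" "g 0 = X (Suc k)" "g 1 = X k"
          "g ` {0..1} \<subseteq> {y \<in> \<Omega>. \<rho> / L \<le> bdist \<Omega> y}"
          using lipschitz_path_if_ball_chain[OF N(3,1) \<open>N \<le> m\<close> C \<rho> b(1) \<open>bdist \<Omega> (X (Suc k)) \<le> \<Lambda> * \<rho>\<close> \<Lambda>(1) L_def]
          by blast
        have e: "L * \<rho> = K * r * (1/2) ^ k" "\<rho> / L = \<mu> * h k" by (simp_all add: \<rho>_def K_def \<mu>_def h_def)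
        show ?thesis using g unfolding e by blast
      qed
      then have "\<forall>k. \<exists>g. (K * r * (1/2) ^ k)-lipschitz_on {0..1::real} g \<and> g 0 = X (Suc k) \<and> g 1 = X k \<and>
        g ` {0..1} \<subseteq> {y \<in> \<Omega>. \<mu> * h k \<le> bdist \<Omega> y}" ..
      from choice[OF this] obtain g where "\<forall>k. (K * r * (1/2) ^ k)-lipschitz_on {0..1::real} (g k) \<and>
        g k 0 = X (Suc k) \<and> g k 1 = X k \<and> g k ` {0..1} \<subseteq> {y \<in> \<Omega>. \<mu> * h k \<le> bdist \<Omega> y}" ..
      then have g: "\<And>k. (K * r * (1/2) ^ k)-lipschitz_on {0..1::real} (g k)" "\<And>k. g k 0 = X (Suc k)"
        "\<And>k. g k 1 = X k" "\<And>k. g k ` {0..1} \<subseteq> {y \<in> \<Omega>. \<mu> * h k \<le> bdist \<Omega> y}" by blast+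
      have Kr: "0 \<le> K * r" using K r(1) by simp
      have lim: "dist z (X k) \<le> 2 * r * (1/2) ^ k" for k using X(1)[of k] by (simp add: h_def)
      obtain \<gamma> where \<gamma>: "(2 * (K * r + 2 * r))-lipschitz_on {0..1} \<gamma>" "\<gamma> 0 = z" "\<gamma> 1 = X 0"
        "\<forall>t::real. 0 < t \<and> t \<le> 1 \<longrightarrow> (\<exists>k. t \<le> (1/2) ^ k \<and> \<gamma> t \<in> g k ` {0..1})"
        using lipschitz_path_to_limit[OF Kr g(1-3) lim] by (elim exE conjE)
      \<comment> \<open>The piece \<open>g k\<close> has depth \<open>\<mu> * h k\<close> and is run
        at times up to \<open>(1/2) ^ k\<close>, so the depth grows linearly, to be set against the
        linear bound on the length.\<close>
      have deep: "\<gamma> t \<in> \<Omega> \<and> \<mu> * r * t \<le> bdist \<Omega> (\<gamma> t)" if t: "0 < t" "t \<le> 1" for t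
      proof -
        obtain k where k: "t \<le> (1/2) ^ k" "\<gamma> t \<in> g k ` {0..1}" using \<gamma>(4) t by blast
        have "\<mu> * r * t \<le> \<mu> * r * (1/2) ^ k" using k(1) \<mu> r(1) by (intro mult_left_mono) auto
        then show ?thesis using k(2) g(4)[of k] by (force simp: h_def)
      qed
      have len: "path_length \<gamma> 0 t \<le> ennreal (2 * (K + 2) * r * t)" if "0 \<le> t" "t \<le> 1" for t
        using path_length_le_if_lipschitz[OF \<gamma>(1) that] by (simp add: algebra_simps)
      have "path_in_from_to \<Omega> \<gamma> z Y"
        unfolding path_in_from_to_def
      proof (intro conjI ballI)
        show "path \<gamma>" unfolding path_def using \<gamma>(1) by (rule lipschitz_on_continuous_on)
        show "pathstart \<gamma> = z" "pathfinish \<gamma> = Y" using \<gamma>(2,3) X(4) by (simp_all add: pathstart_def pathfinish_def)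
        show "\<gamma> t \<in> \<Omega>" if "t \<in> {0<..1}" for t using deep that by simp
        show "path_image \<gamma> \<subseteq> closure \<Omega>"
        proof
          fix y assume "y \<in> path_image \<gamma>"
          then obtain t where t: "0 \<le> t" "t \<le> 1" "y = \<gamma> t" by (auto simp: path_image_def)
          show "y \<in> closure \<Omega>"
          proof (cases "t = 0")
            case True
            then show ?thesis using t \<gamma>(2) z by (simp add: frontier_def)
          next
            case False
            then show ?thesis using t deep[of t] closure_subset by auto
          qed
        qed
      qed
      moreover have "nontangential \<Omega> D \<gamma>"
        unfolding nontangential_def
      proof
        fix t :: real assume t: "t \<in> {0..1}"
        show "path_length \<gamma> 0 t \<le> ennreal (D * bdist \<Omega> (\<gamma> t))"
        proof (rule order_trans[OF len])
          have "2 * (K + 2) * r * t \<le> D * bdist \<Omega> (\<gamma> t)"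
          proof (cases "t = 0")
            case True
            then show ?thesis using D(1) by simp
          next
            case False
            have "2 * (K + 2) \<le> D * \<mu>" using D(4) \<mu> by (simp add: field_simps)
            then have "2 * (K + 2) * (r * t) \<le> D * \<mu> * (r * t)"
              using r(1) t by (intro mult_right_mono) auto
            also have "\<dots> = D * (\<mu> * r * t)" by simp
            also have "\<dots> \<le> D * bdist \<Omega> (\<gamma> t)"
              using deep[of t] t False D(1) by (intro mult_left_mono) auto
            finally show ?thesis by (simp add: ac_simps)
          qed
          then show "ennreal (2 * (K + 2) * r * t) \<le> ennreal (D * bdist \<Omega> (\<gamma> t))" by (rule ennreal_leI)
        qed (use t in auto)
      qed
      moreover have "path_length \<gamma> 0 1 \<le> ennreal (D * r)"
      proof -
        have "2 * (K + 2) * r * 1 \<le> D * r" using D(3) r(1) by simp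
        then show ?thesis using len[of 1] by (meson ennreal_leI order_trans zero_le_one order_refl)
      qed
      ultimately show ?thesis by blast
    qed
    ultimately show ?thesis using Y(1) by blast
  qed
  then show ?thesis unfolding local_john_def using D(1) by blast
qed

theorem corollary1p5:
  fixes n :: nat and \<Omega> :: "'a::euclidean_space set"
  assumes "n \<ge> 1" and "DIM('a) = n + 1"
    and "open \<Omega>"
    and "two_sided_corkscrew \<Omega>"
    and "ahlfors_david_regular n (frontier \<Omega>)"
  shows "local_john \<Omega> \<longleftrightarrow> harnack_chain \<Omega>"
proof
  obtain c where c: "0 < c"
    and cork: "\<And>x r. x \<in> frontier \<Omega> \<Longrightarrow> 0 < r \<Longrightarrow> ennreal r < ediam (frontier \<Omega>) \<Longrightarrow>
      \<exists>X X'. ball X (c * r) \<subseteq> ball x r \<inter> \<Omega> \<and> ball X' (c * r) \<subseteq> ball x r \<inter> interior (- \<Omega>)"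
    using assms(4) unfolding two_sided_corkscrew_def by blast
  show "harnack_chain \<Omega>" if "local_john \<Omega>"
  proof -
    obtain J where "1 \<le> J" and "\<And>x r. x \<in> frontier \<Omega> \<Longrightarrow> 0 < r \<Longrightarrow> ennreal r < ediam (frontier \<Omega>) \<Longrightarrow>
      \<exists>Y \<in> ball x r \<inter> \<Omega>. ball Y (r / J) \<subseteq> \<Omega> \<and> (\<forall>z \<in> ball x r \<inter> frontier \<Omega>.
        \<exists>\<gamma>. path_in_from_to \<Omega> \<gamma> z Y \<and> nontangential \<Omega> J \<gamma> \<and> path_length \<gamma> 0 1 \<le> ennreal (J * r))"
      using \<open>local_john \<Omega>\<close> unfolding local_john_def by blast
    then interpret john_corkscrew \<Omega> c J
      using assms(3) c cork by unfold_locales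
    obtain D where "1 \<le> D" and "\<And>x r. x \<in> frontier \<Omega> \<Longrightarrow> 0 < r \<Longrightarrow> ennreal r < ediam (frontier \<Omega>) \<Longrightarrow>
        ennreal (r ^ n / D) \<le> hausdorff_measure n (ball x r \<inter> frontier \<Omega>) \<and>
        hausdorff_measure n (ball x r \<inter> frontier \<Omega>) \<le> ennreal (D * r ^ n)"
      using assms(5) unfolding ahlfors_david_regular_def by blast
    then show ?thesis by (rule harnack_chain_if_john[OF assms(1,2)])
  qed
  show "local_john \<Omega>" if "harnack_chain \<Omega>"
    by (rule local_john_if_harnack_chain[OF assms(3) c _ that]) (use cork in blast)
qed

end
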